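(* Let $M>0$. There exist constants $C,C_1>0$ depending only on $M$ such that the following holds for all positive integers $n,p,k$ and every $\epsilon\in[0,1/5)$. Let $\hat\Gamma$ be any maximizer of $\mathcal{D}_{\mathcal{U}_k}(\Gamma,\{X_i\}_{i=1}^n)$ over $\Gamma\in\mathcal{F}_k$, and let $\hat\Sigma=\hat\Gamma/\beta$. Then for any $\delta\in(0,1/2)$ satisfying $C_1\left(\frac{k+\log p}{n}+\frac{\log(1/\delta)}{n}\right)<1$, $$\|\hat\Sigma-\Sigma\|_{\rm op}^2\le C\left(\left(\frac{k+\log p}{n}\vee\epsilon^2\right)+\frac{\log(1/\delta)}{n}\right)$$ with $\mathbb{P}_{(\epsilon,\Sigma,Q)}$-probability at least $1-2\delta$, uniformly over all probability distributions $Q$ on $\mathbb{R}^p$ and all $\Sigma\in\mathcal{F}_k(M)$.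
   Context: Contamination model: for $\epsilon\in[0,1]$, a covariance matrix $\Sigma\in\mathbb{R}^{p\times p}$ (throughout assumed nonzero) and a probability distribution $Q$ on $\mathbb{R}^p$, $\mathbb{P}_{(\epsilon,\Sigma,Q)}=(1-\epsilon)N(0,\Sigma)+\epsilon Q$; $X_1,\dots,X_n$ are i.i.d. from it, and the same symbol denotes their joint law. Classes: $\mathcal{F}_k=\{\Sigma=(\sigma_{ij})\in\mathbb{R}^{p\times p},\ \Sigma\succeq0:\ \sigma_{ij}=0\text{ if }|i-j|>k\}$, $\mathcal{F}(M)=\{\Sigma=\Sigma^T\succeq0:\ s_{\max}(\Sigma)\le M\}$ ($s_{\max}$ = largest singular value; $M$ does not scale with $p$ or $n$), and $\mathcal{F}_k(M)=\mathcal{F}_k\cap\mathcal{F}(M)$. Directions: with $S^{p-1}$ the Euclidean unit sphere of $\mathbb{R}^p$, $\mathcal{V}_{[l_1,l_2]}=\{u\in S^{p-1}:u_i=0\text{ if }i\notin[l_1,l_2]\}$; $\mathcal{U}_k=\bigcup_{l=1}^{p+1-2k}\mathcal{V}_{[l,l+2k-1]}$ if $2k\le p$, and $\mathcal{U}_k=S^{p-1}$ if $2k>p$. Empirical matrix depth relative to $\mathcal{U}\subset S^{p-1}$: $$\mathcal{D}_{\mathcal{U}}(\Gamma,\{X_i\}_{i=1}^n)=\min_{u\in\mathcal{U}}\min\left\{\frac1n\sum_{i=1}^n\mathbb{I}\{|u^TX_i|^2\le u^T\Gamma u\},\ \frac1n\sum_{i=1}^n\mathbb{I}\{|u^TX_i|^2\ge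 u^T\Gamma u\}\right\};$$ it takes finitely many values, so maximizers exist. The constant $\beta$ is defined by $\Phi(\sqrt\beta)=3/4$ with $\Phi$ the standard normal cumulative distribution function. $\|\cdot\|_{\rm op}$ is the operator norm; $a\vee b=\max(a,b)$. *)

theory Defs
  imports "HOL-Probability.Probability" "Jordan_Normal_Form.Spectral_Radius"
begin

text \<open>
  Vectors and matrices are those of \<open>Jordan_Normal_Form\<close> (so that the dimension is a term),
  and indices run from \<open>0\<close> to \<open>p - 1\<close>.  The type of vectors contains vectors of every
  dimension; \<open>\<real>\<^sup>p\<close> is the carrier \<open>carrier_vec p\<close>.
\<close>

unbundle no vec_syntax
unbundle no inner_syntax

subsection \<open>Probability on \<open>\<real>\<^sup>p\<close>\<close>

text \<open>The Borel sigma-algebra of \<open>\<real>\<^sup>p\<close>, transported from the product space along coordinates.\<close>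

definition borel_vec :: "nat \<Rightarrow> real vec measure" where
  "borel_vec p = vimage_algebra (carrier_vec p) (\<lambda>v. \<lambda>i\<in>{..<p}. v $ i) (\<Pi>\<^sub>M i\<in>{..<p}. borel)"

text \<open>
  \<open>N(0,\<Sigma>)\<close> as the law of \<open>A Z\<close> where \<open>Z\<close> is a standard Gaussian vector and \<open>A A\<^sup>T = \<Sigma>\<close>; this
  covers singular \<open>\<Sigma>\<close>.  A positive semidefinite \<open>\<Sigma>\<close> has such a factor \<open>A\<close>, and the law does
  not depend on which one is chosen.
\<close>

definition gaussian_vec :: "nat \<Rightarrow> real mat \<Rightarrow> real vec measure" where
  "gaussian_vec p \<Sigma> =
     (let A = (SOME A. A \<in> carrier_mat p p \<and> A * transpose_mat A = \<Sigma>)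
      in distr (\<Pi>\<^sub>M i\<in>{..<p}. std_normal_distribution) (borel_vec p) (\<lambda>z. A *\<^sub>v vec p z))"

definition mixture :: "real \<Rightarrow> 'a measure \<Rightarrow> 'a measure \<Rightarrow> 'a measure" where
  "mixture \<epsilon> N Q = measure_of (space N) (sets N)
     (\<lambda>S. ennreal (1 - \<epsilon>) * emeasure N S + ennreal \<epsilon> * emeasure Q S)"

definition contaminated :: "nat \<Rightarrow> real \<Rightarrow> real mat \<Rightarrow> real vec measure \<Rightarrow> real vec measure" where
  "contaminated p \<epsilon> \<Sigma> Q = mixture \<epsilon> (gaussian_vec p \<Sigma>) Q"

text \<open>Joint law of an i.i.d. sample of size \<open>n\<close>, indexed by \<open>{..<n}\<close>.\<close>

definition iid_sample :: "nat \<Rightarrow> 'a measure \<Rightarrow> (nat \<Rightarrow> 'a) measure" where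
  "iid_sample n P = (\<Pi>\<^sub>M i\<in>{..<n}. P)"

text \<open>
  An arbitrary selection of maximizers need not be measurable, so neither need be the event that
  it satisfies some bound.  Hence the event is only required to contain a measurable set of large
  probability; for measurable events this is the usual notion.
\<close>

definition with_prob_at_least :: "'a measure \<Rightarrow> real \<Rightarrow> ('a \<Rightarrow> bool) \<Rightarrow> bool" where
  "with_prob_at_least M c P \<longleftrightarrow> (\<exists>E\<in>sets M. measure M E \<ge> c \<and> (\<forall>x\<in>E. P x))"

subsection \<open>Matrices\<close>

definition psd :: "nat \<Rightarrow> real mat \<Rightarrow> bool" where
  "psd p A \<longleftrightarrow> A \<in> carrier_mat p p \<and> transpose_mat A = A \<and>
     (\<forall>v\<in>carrier_vec p. v \<bullet> (A *\<^sub>v v) \<ge> 0)"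

definition s_max :: "real mat \<Rightarrow> real" where
  "s_max A = Max (sqrt ` spectrum (transpose_mat A * A))"

definition unit_sphere :: "nat \<Rightarrow> real vec set" where
  "unit_sphere p = {u \<in> carrier_vec p. u \<bullet> u = 1}"

definition op_norm :: "real mat \<Rightarrow> real" where
  "op_norm A = (SUP u\<in>unit_sphere (dim_col A). sqrt ((A *\<^sub>v u) \<bullet> (A *\<^sub>v u)))"

definition F_band :: "nat \<Rightarrow> nat \<Rightarrow> real mat set" where
  "F_band p k = {\<Sigma>. psd p \<Sigma> \<and> (\<forall>i<p. \<forall>j<p. \<bar>int i - int j\<bar> > int k \<longrightarrow> \<Sigma> $$ (i, j) = 0)}"

definition F_bounded :: "nat \<Rightarrow> real \<Rightarrow> real mat set" where
  "F_bounded p M = {\<Sigma>. psd p \<Sigma> \<and> s_max \<Sigma> \<le> M}"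

definition F_band_bounded :: "nat \<Rightarrow> nat \<Rightarrow> real \<Rightarrow> real mat set" where
  "F_band_bounded p k M = F_band p k \<inter> F_bounded p M"

subsection \<open>Matrix depth\<close>

definition V_dirs :: "nat \<Rightarrow> nat set \<Rightarrow> real vec set" where
  "V_dirs p I = {u \<in> unit_sphere p. \<forall>i<p. i \<notin> I \<longrightarrow> u $ i = 0}"

text \<open>With indices starting at \<open>0\<close>, the windows \<open>[l, l + 2k - 1]\<close>, \<open>1 \<le> l \<le> p + 1 - 2k\<close>, become
  \<open>{l..<l + 2k}\<close>, \<open>0 \<le> l \<le> p - 2k\<close>.\<close>

definition U_dirs :: "nat \<Rightarrow> nat \<Rightarrow> real vec set" where
  "U_dirs p k = (if 2 * k \<le> p then (\<Union>l\<in>{0..p - 2 * k}. V_dirs p {l..<l + 2 * k})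
                 else unit_sphere p)"

text \<open>The minimum over \<open>U\<close> is that of a finite set: both averages are multiples of \<open>1/n\<close> in
  \<open>[0, 1]\<close>.\<close>

definition matrix_depth :: "real vec set \<Rightarrow> nat \<Rightarrow> real mat \<Rightarrow> (nat \<Rightarrow> real vec) \<Rightarrow> real" where
  "matrix_depth U n \<Gamma> X = Min ((\<lambda>u. min
      ((1 / real n) * (\<Sum>i<n. of_bool (\<bar>u \<bullet> X i\<bar>\<^sup>2 \<le> u \<bullet> (\<Gamma> *\<^sub>v u))))
      ((1 / real n) * (\<Sum>i<n. of_bool (\<bar>u \<bullet> X i\<bar>\<^sup>2 \<ge> u \<bullet> (\<Gamma> *\<^sub>v u))))) ` U)"

definition depth_const :: real where
  "depth_const = (THE b. b \<ge> 0 \<and> cdf std_normal_distribution (sqrt b) = 3 / 4)"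

end

theory Submission
  imports Defs
begin

text \<open>
  The error of the estimator is compared with the Gaussian part of the sample only.  The measure
  \<open>(1 - \<epsilon>) N(0, \<Sigma>)\<close> is dominated by the contaminated law \<open>P\<close>, so it has a density \<open>\<gamma>\<close> with respect
  to \<open>P\<close> with values in \<open>[0, 1]\<close> (\<open>mixture_weight\<close>).  Weighting the observation \<open>X\<^sub>i\<close> by \<open>\<gamma> (X\<^sub>i)\<close>
  replaces the unobservable knowledge of which observations are clean: \<open>1 - \<gamma> (X\<^sub>i)\<close> has mean \<open>\<epsilon>\<close>,
  hence a count over the sample and the corresponding weighted count differ by about \<open>n \<epsilon>\<close> at most,
  whatever \<open>Q\<close> is.

  For a direction \<open>u\<close> with \<open>\<sigma>\<^sup>2 = u\<^sup>T \<Sigma> u > 0\<close>, the weighted count of the observations in the slab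
  \<open>|u\<^sup>T x| \<le> s \<sigma>\<close> has mean \<open>n (1 - \<epsilon>) P(|Z| \<le> s)\<close>, with \<open>Z\<close> standard normal.  Within a window of \<open>2 k\<close>
  coordinates these counts deviate from their means by \<open>O(sqrt (n D))\<close>, uniformly in \<open>u\<close>, with
  probability \<open>1 - O(exp (- D))\<close> for every \<open>D\<close> between \<open>2 k\<close> and \<open>n\<close> (\<open>slab_deviation\<close>).  A single net
  would lose a factor logarithmic in \<open>n\<close>; chaining avoids it.  The nets live at the scales
  \<open>16\<^sup>-\<^sup>j\<close>, and the increments between consecutive nets obey Bernstein's inequality with geometrically
  decreasing variances, because thin shells around a slab have small Gaussian mass.  At the finest
  scale, of order \<open>D / n\<close>, the remaining increment is dominated by a thin shell and the quadratic form
  \<open>\<Sum>\<^sub>i \<gamma> (X\<^sub>i) \<langle>h, Y\<^sub>i\<rangle>\<^sup>2\<close> of the small difference \<open>h\<close>, which is \<open>O(n |h|\<^sup>2)\<close> simultaneously for all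
  \<open>h\<close>.  A union over at most \<open>p\<close> windows adds \<open>log p\<close> to \<open>D\<close>.

  Put \<open>r = 300 sqrt (D / n)\<close>.  Since \<open>\<beta>\<close> is the median of \<open>Z\<^sup>2\<close>, the matrix \<open>\<beta> \<Sigma>\<close> has depth at least
  \<open>(1 - \<epsilon>) / 2 - 2 r\<close>, and so does every maximizer \<open>\<Gamma>\<close>.  If \<open>u\<^sup>T \<Gamma> u / \<beta>\<close> were further from \<open>u\<^sup>T \<Sigma> u\<close> than
  \<open>K (\<epsilon> + r) u\<^sup>T \<Sigma> u\<close>, then one of the two counts at \<open>u\<close> would fall below this level
  (\<open>deep_value_close\<close>); by monotonicity in \<open>s\<close> this uses only three values of \<open>s\<close>.  The bound
  \<open>\<epsilon> < 1/5\<close> enters here: the contamination shifts the level of the median of \<open>|Z|\<close> by at most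
  \<open>\<epsilon> / (1 - \<epsilon>) < 1/4\<close>, which keeps the threshold in a range where the density of \<open>|Z|\<close> is bounded below.

  It remains to pass from the directions in windows to the operator norm.  The quadratic form of a
  matrix of bandwidth \<open>k\<close> is an alternating average of its restrictions to windows of length \<open>2 k\<close>
  and \<open>k\<close> (\<open>banded_qform_bound\<close>), polarisation turns quadratic forms into the norm of a symmetric
  matrix, and \<open>u\<^sup>T \<Sigma> u \<le> s_max \<Sigma>\<close> on the sphere (\<open>qform_le_s_max\<close>).
\<close>

section \<open>Coordinate vectors\<close>

text \<open>Dimensions vary in the argument (windows, orthonormal frames), so vectors are functions on
  \<open>nat\<close> and the dimension is an argument of the inner product.\<close>

definition ip :: "nat \<Rightarrow> (nat \<Rightarrow> real) \<Rightarrow> (nat \<Rightarrow> real) \<Rightarrow> real" where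
  "ip d x y = (\<Sum>j<d. x j * y j)"

abbreviation sq_norm :: "nat \<Rightarrow> (nat \<Rightarrow> real) \<Rightarrow> real" where
  "sq_norm d x \<equiv> ip d x x"

lemma ip_cong: "(\<And>j. j < d \<Longrightarrow> x j = x' j) \<Longrightarrow> (\<And>j. j < d \<Longrightarrow> y j = y' j) \<Longrightarrow> ip d x y = ip d x' y'"
  by (simp add: ip_def)

lemma ip_commute: "ip d x y = ip d y x"
  by (simp add: ip_def mult.commute)

lemma ip_algebra:
  "ip d (\<lambda>j. x j + x' j) y = ip d x y + ip d x' y"
  "ip d (\<lambda>j. x j - x' j) y = ip d x y - ip d x' y"
  "ip d (\<lambda>j. a * x j) y = a * ip d x y"
  "ip d y (\<lambda>j. x j + x' j) = ip d y x + ip d y x'"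
  "ip d y (\<lambda>j. x j - x' j) = ip d y x - ip d y x'"
  "ip d y (\<lambda>j. a * x j) = a * ip d y x"
  by (simp_all add: ip_def ring_distribs sum.distrib sum_subtractf sum_distrib_left mult.assoc mult.left_commute)

lemma sq_norm_nonneg [simp]: "0 \<le> sq_norm d x"
  by (simp add: ip_def sum_nonneg)

lemma sq_norm_eq_0_iff: "sq_norm d x = 0 \<longleftrightarrow> (\<forall>j<d. x j = 0)"
  by (simp add: ip_def sum_nonneg_eq_0_iff Ball_def)

lemma ip_sum_left: "ip d (\<lambda>x. \<Sum>i\<in>I. f i x) y = (\<Sum>i\<in>I. ip d (f i) y)"
  by (simp add: ip_def sum_distrib_right) (rule sum.swap)

lemma ip_sum_right: "ip d y (\<lambda>x. \<Sum>i\<in>I. f i x) = (\<Sum>i\<in>I. ip d y (f i))"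
  using ip_sum_left[of d f I y] by (simp add: ip_commute)

lemma ip_Cauchy_Schwarz: "(ip d x y)\<^sup>2 \<le> sq_norm d x * sq_norm d y"
  using Cauchy_Schwarz_ineq_sum[of x y "{..<d}"] by (simp add: ip_def power2_eq_square)

section \<open>Nets of the unit ball\<close>

lemma geometric_partial_sum_le:
  fixes q :: real
  assumes "0 \<le> q" "q < 1"
  shows "(\<Sum>j\<le>J. q ^ j) \<le> 1 / (1 - q)"
proof -
  have "(\<Sum>j\<le>J. q ^ j) \<le> (\<Sum>j. q ^ j)" using assms by (intro sum_le_suminf) auto
  then show ?thesis using assms by (simp add: suminf_geometric)
qed

lemma geometric_two_sided_sum_le:
  fixes \<theta> :: real and B :: nat
  assumes "0 < \<theta>" "\<theta> \<le> 1"
  shows "(\<Sum>z\<in>{-int B..int B}. exp (- \<theta> * \<bar>real_of_int z\<bar>)) \<le> 4 / \<theta>"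
proof -
  define q where "q = exp (- \<theta>)"
  have q: "0 < q" "q < 1" using assms by (auto simp: q_def)
  have "q * (1 + \<theta>) \<le> 1"
    using exp_ge_add_one_self[of \<theta>] by (simp add: q_def exp_minus field_simps)
  moreover have "q * \<theta> \<le> \<theta>" using q assms by simp
  moreover have "(1 - q) * (1+\<theta>) \<le> (1-q) * 2" using q assms by (intro mult_left_mono) auto
  ultimately have q2: "\<theta> / 2 \<le> 1 - q" by (simp add: algebra_simps)
  have e: "exp (- \<theta> * \<bar>real_of_int (int k)\<bar>) = q ^ k" for k
    by (simp add: q_def exp_of_nat_mult[symmetric] mult.commute)
  have "(\<Sum>z\<in>{-int B..int B}. exp (- \<theta> * \<bar>real_of_int z\<bar>))
      \<le> (\<Sum>z\<in>int ` {..B} \<union> (\<lambda>k. - int k) ` {..B}. exp (- \<theta> * \<bar>real_of_int z\<bar>))"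
  proof (rule sum_mono2)
    show "{-int B..int B} \<subseteq> int ` {..B} \<union> (\<lambda>k. - int k) ` {..B}"
    proof
      fix z assume z: "z \<in> {-int B..int B}"
      show "z \<in> int ` {..B} \<union> (\<lambda>k. - int k) ` {..B}"
      proof (cases "z \<ge> 0")
        case True then have "z = int (nat z)" "nat z \<le> B" using z by auto
        then show ?thesis by blast
      next
        case False then have "z = - int (nat (-z))" "nat (-z) \<le> B" using z by auto
        then show ?thesis by blast
      qed
    qed
  qed auto
  also have "\<dots> \<le> (\<Sum>z\<in>int ` {..B}. exp (- \<theta> * \<bar>real_of_int z\<bar>)) + (\<Sum>z\<in>(\<lambda>k. - int k) ` {..B}. exp (- \<theta> * \<bar>real_of_int z\<bar>))"
    by (subst sum_Un) (auto intro!: sum_nonneg)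
  also have "\<dots> = (\<Sum>k\<le>B. q^k) + (\<Sum>k\<le>B. q^k)"
    using e by (subst (1 2) sum.reindex) (auto simp: inj_on_def)
  also have "\<dots> \<le> 2 * (1 / (1 - q))"
  proof -
    have "(\<Sum>k\<le>B. q^k) \<le> 1 / (1 - q)"
      using q by (intro geometric_partial_sum_le) auto
    then show ?thesis by simp
  qed
  also have "\<dots> \<le> 2 * (1 / (\<theta> / 2))"
    using q2 assms q by (intro mult_left_mono divide_left_mono) auto
  finally show ?thesis by simp
qed

text \<open>An exponential generating function bounds the number of integer points in an \<open>\<ell>\<^sub>1\<close>-ball:
  each point is charged \<open>exp (\<theta> (b - |m|\<^sub>1)) \<ge> 1\<close>, and the total charge factorises.\<close>

lemma card_integer_l1_ball_le:
  fixes \<theta> b :: real and d :: nat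
  assumes "0 < \<theta>" "\<theta> \<le> 1"
  defines "N \<equiv> {m \<in> PiE {..<d} (\<lambda>_. UNIV :: int set). (\<Sum>j<d. \<bar>real_of_int (m j)\<bar>) \<le> b}"
  shows "finite N" "real (card N) \<le> exp (\<theta> * b) * (4 / \<theta>) ^ d"
proof -
  define B where "B = nat \<lceil>b\<rceil>"
  let ?P = "PiE {..<d} (\<lambda>_. {-int B..int B})"
  have sub: "N \<subseteq> ?P"
  proof
    fix m assume m: "m \<in> N"
    have "m j \<in> {-int B..int B}" if j: "j < d" for j
    proof -
      have "\<bar>real_of_int (m j)\<bar> \<le> (\<Sum>j<d. \<bar>real_of_int (m j)\<bar>)"
        using j by (intro member_le_sum) auto
      also have "\<dots> \<le> b" using m by (simp add: N_def)
      finally have "\<bar>real_of_int (m j)\<bar> \<le> b" .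
      then show ?thesis unfolding B_def by (simp add: abs_le_iff) linarith
    qed
    then show "m \<in> ?P" using m by (auto simp: N_def PiE_def Pi_def)
  qed
  have fP: "finite ?P" by (intro finite_PiE) auto
  show fN: "finite N" using sub fP by (rule finite_subset)
  have "real (card N) = (\<Sum>m\<in>N. 1)" by simp
  also have "\<dots> \<le> (\<Sum>m\<in>N. exp (\<theta> * b) * (\<Prod>j<d. exp (- \<theta> * \<bar>real_of_int (m j)\<bar>)))"
  proof (rule sum_mono)
    fix m assume m: "m \<in> N"
    have "exp (\<theta> * b) * (\<Prod>j<d. exp (- \<theta> * \<bar>real_of_int (m j)\<bar>))
        = exp (\<theta> * (b - (\<Sum>j<d. \<bar>real_of_int (m j)\<bar>)))"
      by (simp add: exp_sum[symmetric] exp_add[symmetric] sum_distrib_left algebra_simps sum_negf)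
    also have "\<dots> \<ge> 1" using m assms(1) by (simp add: N_def)
    finally show "1 \<le> exp (\<theta> * b) * (\<Prod>j<d. exp (- \<theta> * \<bar>real_of_int (m j)\<bar>))" .
  qed
  also have "\<dots> \<le> (\<Sum>m\<in>?P. exp (\<theta> * b) * (\<Prod>j<d. exp (- \<theta> * \<bar>real_of_int (m j)\<bar>)))"
    by (rule sum_mono2[OF fP sub]) (simp add: prod_nonneg)
  also have "\<dots> = exp (\<theta> * b) * (\<Prod>j<d. \<Sum>z\<in>{-int B..int B}. exp (- \<theta> * \<bar>real_of_int z\<bar>))"
    by (subst prod_sum_PiE) (auto simp: sum_distrib_left)
  also have "\<dots> \<le> exp (\<theta> * b) * (\<Prod>j<d. 4 / \<theta>)"
    using geometric_two_sided_sum_le[OF assms(1,2)]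
    by (intro mult_left_mono prod_mono) (auto intro!: sum_nonneg)
  finally show "real (card N) \<le> exp (\<theta> * b) * (4 / \<theta>) ^ d" by simp
qed

text \<open>Cells of a cubic grid of mesh \<open>\<theta> / sqrt d\<close> have diameter at most \<open>\<theta>\<close>, and by Cauchy--Schwarz the
  cells that meet the unit ball are indexed by an \<open>\<ell>\<^sub>1\<close>-ball of radius \<open>2 d / \<theta>\<close>; hence the count is
  of the form \<open>(const / \<theta>)\<^sup>d\<close>, without a power of \<open>d\<close>.  One point of \<open>S\<close> is kept per cell, because
  the distributional assumptions used later hold on the sphere only, not at grid points.\<close>

lemma internal_net:
  fixes \<theta> :: real
  assumes th: "0 < \<theta>" "\<theta> \<le> 1" and S: "\<And>c. c \<in> S \<Longrightarrow> sq_norm d c \<le> 1"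
  shows "\<exists>T\<subseteq>S. finite T \<and> real (card T) \<le> (32 / \<theta>) ^ d \<and>
           (\<forall>c\<in>S. \<exists>c'\<in>T. sq_norm d (\<lambda>j. c j - c' j) \<le> \<theta>\<^sup>2)"
proof -
  define \<kappa> where "\<kappa> = sqrt (real d) / \<theta>"
  have k0: "0 \<le> \<kappa>" using th by (simp add: \<kappa>_def)
  define cell where "cell c = (\<lambda>j\<in>{..<d}. \<lfloor>c j * \<kappa>\<rfloor>)" for c :: "nat \<Rightarrow> real"
  define N where "N = {m \<in> PiE {..<d} (\<lambda>_. UNIV :: int set). (\<Sum>j<d. \<bar>real_of_int (m j)\<bar>) \<le> 2 * real d / \<theta>}"
  have cellN: "cell c \<in> N" if c: "c \<in> S" for c
  proof -
    have "(\<Sum>j<d. \<bar>real_of_int (cell c j)\<bar>) \<le> (\<Sum>j<d. \<kappa> * \<bar>c j\<bar> + 1)"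
    proof (rule sum_mono)
      fix j assume "j \<in> {..<d}"
      have "\<bar>real_of_int \<lfloor>c j * \<kappa>\<rfloor>\<bar> \<le> \<bar>c j * \<kappa>\<bar> + 1" by linarith
      then show "\<bar>real_of_int (cell c j)\<bar> \<le> \<kappa> * \<bar>c j\<bar> + 1"
        using \<open>j \<in> {..<d}\<close> k0 by (simp add: cell_def abs_mult mult.commute)
    qed
    also have "\<dots> = \<kappa> * (\<Sum>j<d. \<bar>c j\<bar>) + real d"
      by (simp add: sum.distrib sum_distrib_left)
    finally have *: "(\<Sum>j<d. \<bar>real_of_int (cell c j)\<bar>) \<le> \<kappa> * (\<Sum>j<d. \<bar>c j\<bar>) + real d" .
    have "(\<Sum>j<d. \<bar>c j\<bar>) \<le> sqrt (real d)"
    proof -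
      have "(ip d (\<lambda>j. \<bar>c j\<bar>) (\<lambda>_. 1))\<^sup>2 \<le> sq_norm d (\<lambda>j. \<bar>c j\<bar>) * sq_norm d (\<lambda>_. 1)"
        by (rule ip_Cauchy_Schwarz)
      also have "\<dots> \<le> 1 * real d"
        using S[OF c] by (intro mult_mono) (auto simp: ip_def)
      finally show ?thesis by (simp add: ip_def real_le_rsqrt)
    qed
    then have "\<kappa> * (\<Sum>j<d. \<bar>c j\<bar>) \<le> \<kappa> * sqrt (real d)" using k0 by (rule mult_left_mono)
    also have "\<kappa> * sqrt (real d) = real d / \<theta>" by (simp add: \<kappa>_def)
    finally have "\<kappa> * (\<Sum>j<d. \<bar>c j\<bar>) \<le> real d / \<theta>" .
    moreover have "real d \<le> real d / \<theta>" using th mult_right_mono[of \<theta> 1 "real d"] by (simp add: field_simps)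
    ultimately have "(\<Sum>j<d. \<bar>real_of_int (cell c j)\<bar>) \<le> 2 * real d / \<theta>" using * by simp
    then show ?thesis by (auto simp: N_def cell_def)
  qed
  have N: "finite N" "real (card N) \<le> exp (\<theta> * (2 * real d / \<theta>)) * (4 / \<theta>) ^ d"
    using card_integer_l1_ball_le[OF th, of d "2 * real d / \<theta>"] by (auto simp: N_def)
  define rep where "rep m = (SOME c. c \<in> S \<and> cell c = m)" for m
  have rep: "rep (cell c) \<in> S \<and> cell (rep (cell c)) = cell c" if "c \<in> S" for c
    unfolding rep_def by (rule someI[of _ c]) (use that in auto)
  define T where "T = rep ` (cell ` S)"
  have fin: "finite (cell ` S)" using N(1) cellN by (meson finite_subset image_subsetI)
  have "card T \<le> card (cell ` S)" unfolding T_def using fin by (rule card_image_le)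
  also have "\<dots> \<le> card N" using cellN N(1) by (intro card_mono) auto
  finally have "real (card T) \<le> exp (\<theta> * (2 * real d / \<theta>)) * (4 / \<theta>) ^ d" using N(2) by linarith
  also have "\<dots> = (exp 1 ^ 2 * (4/\<theta>)) ^ d"
  proof -
    have "exp (\<theta> * (2 * real d / \<theta>)) = exp (real (2 * d) * 1)" using th by simp
    also have "\<dots> = (exp 1 ^ 2) ^ d" unfolding exp_of_nat_mult by (simp add: power_mult)
    finally show ?thesis by (simp only: power_mult_distrib)
  qed
  also have "\<dots> \<le> (32 / \<theta>) ^ d"
  proof (rule power_mono)
    have "exp 1 \<le> (2.72::real)" using e_less_272 by simp
    then have "exp 1 ^ 2 \<le> (2.72::real)^2" by (intro power_mono) auto
    also have "\<dots> \<le> 8" by (simp add: power2_eq_square)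
    finally have "exp (1::real) ^ 2 * (4/\<theta>) \<le> 8 * (4 / \<theta>)" using th by (intro mult_right_mono) auto
    then show "exp (1::real) ^ 2 * (4/\<theta>) \<le> 32 / \<theta>" by simp
  qed (use th in auto)
  finally have card: "real (card T) \<le> (32 / \<theta>) ^ d" .
  have "\<exists>c'\<in>T. sq_norm d (\<lambda>j. c j - c' j) \<le> \<theta>\<^sup>2" if c: "c \<in> S" for c
  proof (intro bexI)
    let ?c = "rep (cell c)"
    show "?c \<in> T" using c by (auto simp: T_def)
    have "sq_norm d (\<lambda>j. c j - ?c j) * \<kappa>\<^sup>2 = (\<Sum>j<d. (c j * \<kappa> - ?c j * \<kappa>)\<^sup>2)"
      unfolding ip_def sum_distrib_right by (rule sum.cong) (simp_all add: power2_eq_square algebra_simps)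
    also have "\<dots> \<le> (\<Sum>j<d. 1)"
    proof (rule sum_mono)
      fix j assume j: "j \<in> {..<d}"
      have "cell ?c j = cell c j" using rep[OF c] by simp
      then have "\<lfloor>?c j * \<kappa>\<rfloor> = \<lfloor>c j * \<kappa>\<rfloor>" using j by (simp add: cell_def)
      then have "\<bar>c j * \<kappa> - ?c j * \<kappa>\<bar> \<le> 1" by linarith
      then show "(c j * \<kappa> - ?c j * \<kappa>)\<^sup>2 \<le> 1" by (simp add: abs_square_le_1)
    qed
    finally have *: "sq_norm d (\<lambda>j. c j - ?c j) * \<kappa>\<^sup>2 \<le> real d" by simp
    show "sq_norm d (\<lambda>j. c j - ?c j) \<le> \<theta>\<^sup>2"
    proof (cases "d = 0")
      case True then show ?thesis by (simp add: ip_def)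
    next
      case False
      have "\<kappa>\<^sup>2 = real d / \<theta>\<^sup>2" by (simp add: \<kappa>_def power_divide)
      with * False th show ?thesis by (simp add: field_simps)
    qed
  qed
  moreover have "T \<subseteq> S" using rep by (auto simp: T_def)
  moreover have "finite T" using fin by (simp add: T_def)
  ultimately show ?thesis using card by blast
qed

section \<open>Gram factors and orthonormal frames\<close>

definition qform :: "nat \<Rightarrow> (nat \<Rightarrow> nat \<Rightarrow> real) \<Rightarrow> (nat \<Rightarrow> real) \<Rightarrow> real" where
  "qform p S v = (\<Sum>i<p. \<Sum>j<p. v i * v j * S i j)"

lemma qform_Suc:
  assumes "\<And>i. i < p \<Longrightarrow> S p i = S i p"
  shows "qform (Suc p) S v = qform p S v + 2 * v p * (\<Sum>i<p. v i * S i p) + (v p)\<^sup>2 * S p p"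
proof -
  have "(\<Sum>j<p. v p * v j * S p j) = v p * (\<Sum>i<p. v i * S i p)"
    using assms by (simp add: sum_distrib_left mult.assoc)
  moreover have "(\<Sum>i<p. v i * v p * S i p) = v p * (\<Sum>i<p. v i * S i p)"
    by (simp add: sum_distrib_left algebra_simps)
  ultimately show ?thesis
    by (simp add: qform_def sum.distrib power2_eq_square algebra_simps)
qed

lemma qform_cong: "(\<And>i. i < p \<Longrightarrow> v i = w i) \<Longrightarrow> (\<And>i j. i < p \<Longrightarrow> j < p \<Longrightarrow> S i j = T i j) \<Longrightarrow> qform p S v = qform p T w"
  by (simp add: qform_def)

lemma linear_bounded_below_imp_zero:
  fixes a b :: real
  assumes "\<And>t. 0 \<le> a + b * t"
  shows "b = 0"
proof (rule ccontr)
  assume "b \<noteq> 0"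
  then show False using assms[of "- (a + 1) / b"] by simp
qed

text \<open>The Cholesky step: the last column is split off.  If its diagonal entry vanishes, then so does
  the whole column, since the form is bounded below along every line; otherwise the Schur complement
  is again positive semidefinite, being the form minimised over the last coordinate.\<close>

lemma psd_Gram_factor:
  assumes "\<And>i j. i < p \<Longrightarrow> j < p \<Longrightarrow> S i j = S j i" "\<And>v. 0 \<le> qform p S v"
  shows "\<exists>a. \<forall>i<p. \<forall>j<p. S i j = ip p (a i) (a j)"
  using assms
proof (induction p arbitrary: S)
  case 0 then show ?case by simp
next
  case (Suc p)
  have sym: "S i j = S j i" if "i \<le> p" "j \<le> p" for i j using Suc.prems(1) that by simp
  have dec: "qform (Suc p) S v = qform p S v + 2 * v p * (\<Sum>i<p. v i * S i p) + (v p)\<^sup>2 * S p p" for v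
    by (rule qform_Suc) (use sym in auto)
  have spp: "0 \<le> S p p"
    using Suc.prems(2)[of "\<lambda>i. if i = p then 1 else 0"] unfolding dec
    by (simp add: qform_def)
  show ?case
  proof (cases "S p p = 0")
    case True
    have col: "S i p = 0" if i: "i < p" for i
    proof -
      have "0 \<le> qform p S (\<lambda>j. of_bool (j = i)) + 2 * S i p * t" for t
      proof -
        let ?v = "\<lambda>j. if j = p then t else of_bool (j = i)"
        have "0 \<le> qform (Suc p) S ?v" by (rule Suc.prems(2))
        also have "\<dots> = qform p S (\<lambda>j. of_bool (j = i)) + 2 * t * (\<Sum>j<p. of_bool (j = i) * S j p)"
        proof -
          have "qform p S ?v = qform p S (\<lambda>j. of_bool (j = i))" by (rule qform_cong) auto
          moreover have "(\<Sum>j<p. ?v j * S j p) = (\<Sum>j<p. of_bool (j = i) * S j p)" by (rule sum.cong) auto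
          ultimately show ?thesis unfolding dec True by simp
        qed
        also have "(\<Sum>j<p. of_bool (j = i) * S j p) = S i p" using i
          by (simp add: of_bool_def if_distrib if_distribR cong: if_cong)
        finally show ?thesis by (simp add: algebra_simps)
      qed
      then show ?thesis using linear_bounded_below_imp_zero by fastforce
    qed
    have "0 \<le> qform p S v" for v
    proof -
      have "qform p S (v(p := 0)) = qform p S v" by (rule qform_cong) auto
      then show ?thesis using Suc.prems(2)[of "v(p := 0)"] unfolding dec by simp
    qed
    then obtain a where a: "\<forall>i<p. \<forall>j<p. S i j = ip p (a i) (a j)"
      using Suc.IH[of S] sym by (metis less_imp_le)
    let ?b = "\<lambda>i l. if i = p \<or> l = p then 0 else a i l"
    have "S i j = ip (Suc p) (?b i) (?b j)" if "i \<le> p" "j \<le> p" for i j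
    proof (cases "i = p \<or> j = p")
      case ip: True
      then have "S i j = 0" using that col[of i] col[of j] sym[of i j] True by (cases "i = j") force+
      then show ?thesis using ip by (auto simp: ip_def)
    next
      case False
      then have "S i j = ip p (a i) (a j)" using a that by simp
      then show ?thesis using False by (simp add: ip_def)
    qed
    then show ?thesis by (intro exI[of _ ?b]) auto
  next
    case False
    then have pos: "0 < S p p" using spp by simp
    define S' where "S' i j = S i j - S i p * S j p / S p p" for i j
    have "0 \<le> qform p S' v" for v
    proof -
      define m where "m = (\<Sum>i<p. v i * S i p)"
      let ?v = "\<lambda>j. if j = p then - m / S p p else v j"
      have "0 \<le> qform (Suc p) S ?v" by (rule Suc.prems(2))
      also have "\<dots> = qform p S v + 2 * (- m / S p p) * m + (- m / S p p)\<^sup>2 * S p p"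
      proof -
        have "qform p S ?v = qform p S v" by (rule qform_cong) auto
        moreover have "(\<Sum>j<p. ?v j * S j p) = m" unfolding m_def by (rule sum.cong) auto
        ultimately show ?thesis unfolding dec by simp
      qed
      also have "\<dots> = qform p S v - m * m / S p p"
        using pos by (simp add: power2_eq_square)
      also have "\<dots> = qform p S' v"
        unfolding qform_def S'_def m_def sum_product
        by (simp add: sum_divide_distrib sum_subtractf[symmetric] right_diff_distrib algebra_simps)
      finally show ?thesis .
    qed
    moreover have "S' i j = S' j i" if "i < p" "j < p" for i j
      using sym[of i j] that by (simp add: S'_def mult.commute)
    ultimately obtain a where a: "\<forall>i<p. \<forall>j<p. S' i j = ip p (a i) (a j)"
      using Suc.IH[of S'] by blast
    let ?b = "\<lambda>i l. if l = p then S i p / sqrt (S p p) else if i = p then 0 else a i l"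
    have "S i j = ip (Suc p) (?b i) (?b j)" if "i \<le> p" "j \<le> p" for i j
    proof -
      have "ip (Suc p) (?b i) (?b j) = (if i = p \<or> j = p then 0 else ip p (a i) (a j)) + S i p * S j p / S p p"
        using pos by (auto simp: ip_def)
      also have "\<dots> = S i j"
      proof (cases "i = p \<or> j = p")
        case True
        then show ?thesis using sym[of p j] that pos by auto
      next
        case False
        then have "ip p (a i) (a j) = S' i j" using a that by simp
        then show ?thesis using False by (simp add: S'_def)
      qed
      finally show ?thesis by simp
    qed
    then show ?thesis by (intro exI[of _ ?b]) auto
  qed
qed

text \<open>The coefficients in both directions are kept: \<open>T\<close> makes the frame a function of the observed
  coordinates, \<open>R\<close> recovers the coordinates from the frame.  Dependent vectors are skipped, so that
  singular covariance matrices need no separate treatment.\<close>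

lemma Gram_Schmidt_family:
  fixes a :: "'i \<Rightarrow> nat \<Rightarrow> real"
  assumes "finite I"
  shows "\<exists>m e T R. m \<le> card I \<and> (\<forall>j<m. \<forall>l<m. ip p (e j) (e l) = of_bool (j = l)) \<and>
     (\<forall>i\<in>I. \<forall>x<p. a i x = (\<Sum>j<m. R i j * e j x)) \<and>
     (\<forall>j<m. \<forall>x<p. e j x = (\<Sum>i\<in>I. T j i * a i x))"
  using assms
proof (induction I)
  case empty
  show ?case by (intro exI[of _ 0]) simp
next
  case (insert i I)
  from insert.IH obtain m e T R where m: "m \<le> card I"
    and orth: "\<And>j l. j < m \<Longrightarrow> l < m \<Longrightarrow> ip p (e j) (e l) = of_bool (j = l)"
    and R: "\<And>i x. i \<in> I \<Longrightarrow> x < p \<Longrightarrow> a i x = (\<Sum>j<m. R i j * e j x)"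
    and T: "\<And>j x. j < m \<Longrightarrow> x < p \<Longrightarrow> e j x = (\<Sum>i\<in>I. T j i * a i x)"
    by blast
  define r where "r j = ip p (a i) (e j)" for j
  define b where "b x = a i x - (\<Sum>j<m. r j * e j x)" for x
  have be: "ip p b (e l) = 0" if "l < m" for l
  proof -
    have "ip p (\<lambda>x. \<Sum>j<m. r j * e j x) (e l) = (\<Sum>j<m. r j * ip p (e j) (e l))"
      by (simp add: ip_sum_left ip_algebra)
    also have "\<dots> = (\<Sum>j<m. if j = l then r l else 0)" using that orth by (intro sum.cong) auto
    also have "\<dots> = r l" using that by simp
    finally show ?thesis unfolding b_def by (simp add: ip_algebra r_def)
  qed
  have ai: "a i x = b x + (\<Sum>j<m. r j * e j x)" for x by (simp add: b_def)
  show ?case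
  proof (cases "sq_norm p b = 0")
    case True
    then have b0: "b x = 0" if "x < p" for x using that by (simp add: sq_norm_eq_0_iff)
    let ?R = "\<lambda>k. if k = i then r else R k" and ?T = "\<lambda>j k. if k = i then 0 else T j k"
    have 3: "e j x = (\<Sum>k\<in>insert i I. ?T j k * a k x)" if "j < m" "x < p" for j x
    proof -
      have "(\<Sum>k\<in>I. ?T j k * a k x) = (\<Sum>k\<in>I. T j k * a k x)"
        using insert.hyps(2) by (intro sum.cong) auto
      then show ?thesis using insert.hyps T[OF that] by simp
    qed
    have 2: "a k x = (\<Sum>j<m. ?R k j * e j x)" if "k \<in> insert i I" "x < p" for k x
    proof (cases "k = i")
      case True
      then show ?thesis using ai[of x] b0[OF that(2)] by simp
    next
      case False
      then show ?thesis using R[of k x] that by simp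
    qed
    have 0: "m \<le> card (insert i I)" using m insert.hyps by simp
    show ?thesis
      by (intro exI[of _ m] exI[of _ e] exI[of _ ?T] exI[of _ ?R] conjI allI impI ballI)
        (assumption | rule 0 orth 2 3)+
  next
    case False
    define s where "s = sqrt (sq_norm p b)"
    have s: "0 < s" using False by (simp add: s_def less_le)
    have ss: "s * s = sq_norm p b" by (simp add: s_def)
    let ?e = "\<lambda>j. if j = m then (\<lambda>x. (1/s) * b x) else e j"
    let ?R = "\<lambda>k j. if k = i then (if j = m then s else r j) else (if j = m then 0 else R k j)"
    let ?T = "\<lambda>j k. if j = m then (1/s) * (if k = i then 1 else - (\<Sum>l<m. r l * T l k)) else if k = i then 0 else T j k"
    have 1: "ip p (?e j) (?e l) = of_bool (j = l)" if "j < Suc m" "l < Suc m" for j l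
    proof (cases "j = m")
      case jm: True
      show ?thesis
      proof (cases "l = m")
        case True
        have "ip p (?e j) (?e l) = (1/s) * ((1/s) * sq_norm p b)"
          unfolding jm True by (simp only: ip_algebra simp_thms if_True)
        also have "\<dots> = 1" using s by (simp add: ss[symmetric])
        finally show ?thesis using jm True by simp
      next
        case False
        then have "ip p (?e j) (?e l) = (1/s) * ip p b (e l)" unfolding jm by (simp only: ip_algebra simp_thms if_True if_False)
        then show ?thesis using be[of l] that False jm by simp
      qed
    next
      case jm: False
      show ?thesis
      proof (cases "l = m")
        case True
        then have "ip p (?e j) (?e l) = (1/s) * ip p (e j) b" using jm by (simp only: ip_algebra simp_thms if_True if_False)
        then show ?thesis using be[of j] that jm True ip_commute[of p b "e j"] by simp
      next
        case False
        then show ?thesis using jm that orth[of j l] by simp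
      qed
    qed
    have 2: "a k x = (\<Sum>j<Suc m. ?R k j * ?e j x)" if "k \<in> insert i I" "x < p" for k x
    proof (cases "k = i")
      case True
      then show ?thesis using ai[of x] s by simp
    next
      case False
      then show ?thesis using R that by simp
    qed
    have 3: "?e j x = (\<Sum>k\<in>insert i I. ?T j k * a k x)" if "j < Suc m" "x < p" for j x
    proof (cases "j = m")
      case False
      have "(\<Sum>k\<in>I. ?T j k * a k x) = (\<Sum>k\<in>I. T j k * a k x)"
        using insert.hyps(2) False by (intro sum.cong) auto
      then show ?thesis using insert.hyps T[of j x] that False by simp
    next
      case True
      have "(\<Sum>l<m. r l * e l x) = (\<Sum>l<m. \<Sum>k\<in>I. r l * T l k * a k x)"
        using T that by (simp add: sum_distrib_left mult.assoc)
      also have "\<dots> = (\<Sum>k\<in>I. (\<Sum>l<m. r l * T l k) * a k x)"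
        by (subst sum.swap) (simp add: sum_distrib_right)
      finally have *: "b x = a i x - (\<Sum>k\<in>I. (\<Sum>l<m. r l * T l k) * a k x)" by (simp add: b_def)
      have "(\<Sum>k\<in>I. ?T m k * a k x) = (\<Sum>k\<in>I. (1/s) * (- (\<Sum>l<m. r l * T l k)) * a k x)"
        using insert.hyps(2) by (intro sum.cong) auto
      also have "\<dots> = - (1/s) * (\<Sum>k\<in>I. (\<Sum>l<m. r l * T l k) * a k x)"
        unfolding sum_distrib_left[of "- (1/s)"] by (intro sum.cong) simp_all
      finally show ?thesis using True insert.hyps * by (simp add: right_diff_distrib diff_divide_distrib)
    qed
    have 0: "Suc m \<le> card (insert i I)" using m insert.hyps by simp
    show ?thesis
      by (intro exI[of _ "Suc m"] exI[of _ ?e] exI[of _ ?T] exI[of _ ?R] conjI allI impI ballI)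
        (assumption | rule 0 1 2 3)+
  qed
qed

section \<open>Exponential inequalities for i.i.d. sums\<close>

abbreviation sample :: "nat \<Rightarrow> 'a measure \<Rightarrow> (nat \<Rightarrow> 'a) measure" where
  "sample n P \<equiv> \<Pi>\<^sub>M i\<in>{..<n}. P"

lemma prob_space_sample: "prob_space P \<Longrightarrow> prob_space (sample n P)"
  by (intro prob_space_PiM)

lemma borel_measurable_sample_sum [measurable]:
  fixes f :: "'a \<Rightarrow> real"
  assumes [measurable]: "f \<in> borel_measurable P"
  shows "(\<lambda>X. \<Sum>i<n. f (X i)) \<in> borel_measurable (sample n P)"
  by measurable

lemma Chernoff_sample:
  fixes g :: "'a \<Rightarrow> real"
  assumes P: "prob_space P" and g[measurable]: "g \<in> borel_measurable P"
    and B: "(\<integral>\<^sup>+x. ennreal (exp (g x)) \<partial>P) \<le> ennreal B" "0 \<le> B"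
  shows "measure (sample n P) {X \<in> space (sample n P). a \<le> (\<Sum>i<n. g (X i))} \<le> exp (- a) * B ^ n"
proof -
  interpret P: prob_space P by fact
  interpret PS: product_sigma_finite "\<lambda>_::nat. P" by standard
  interpret S: prob_space "sample n P" using P by (rule prob_space_sample)
  let ?A = "{X \<in> space (sample n P). a \<le> (\<Sum>i<n. g (X i))}"
  have A[measurable]: "?A \<in> sets (sample n P)" by measurable
  have "emeasure (sample n P) ?A = (\<integral>\<^sup>+X. indicator ?A X \<partial>sample n P)" by simp
  also have "\<dots> \<le> (\<integral>\<^sup>+X. ennreal (exp (- a)) * (\<Prod>i<n. ennreal (exp (g (X i)))) \<partial>sample n P)"
  proof (rule nn_integral_mono)
    fix X assume "X \<in> space (sample n P)"
    have "indicator ?A X \<le> ennreal (exp (- a + (\<Sum>i<n. g (X i))))"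
      by (auto simp: indicator_def)
    also have "\<dots> = ennreal (exp (- a)) * (\<Prod>i<n. ennreal (exp (g (X i))))"
      by (simp add: exp_diff exp_add[symmetric] exp_sum[symmetric] prod_ennreal ennreal_mult'[symmetric])
    finally show "indicator ?A X \<le> ennreal (exp (- a)) * (\<Prod>i<n. ennreal (exp (g (X i))))" .
  qed
  also have "\<dots> = ennreal (exp (- a)) * (\<integral>\<^sup>+X. (\<Prod>i<n. ennreal (exp (g (X i)))) \<partial>sample n P)"
    by (rule nn_integral_cmult) measurable
  also have "(\<integral>\<^sup>+X. (\<Prod>i<n. ennreal (exp (g (X i)))) \<partial>sample n P) = (\<Prod>i<n. \<integral>\<^sup>+x. ennreal (exp (g x)) \<partial>P)"
    by (rule PS.product_nn_integral_prod) auto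
  also have "\<dots> \<le> (\<Prod>i<n. ennreal B)"
    by (intro prod_mono_ennreal B)
  also have "\<dots> = ennreal (B ^ n)" using B(2) by (simp add: ennreal_power)
  finally have "emeasure (sample n P) ?A \<le> ennreal (exp (- a) * B ^ n)"
    by (simp add: ennreal_mult' mult_left_mono)
  then show ?thesis using B(2) by (simp add: S.emeasure_eq_measure)
qed

lemma exp_le_quadratic:
  fixes x :: real
  assumes "-1 \<le> x" "x \<le> 1"
  shows "exp x \<le> 1 + x + x\<^sup>2"
proof (cases "0 \<le> x")
  case True
  then show ?thesis using assms by (intro exp_bound) auto
next
  case False
  then have "1 \<le> (1 - x) * (1 + x + x\<^sup>2)"
    by (simp add: algebra_simps power2_eq_square mult_le_0_iff zero_le_mult_iff)
  also have "\<dots> \<le> exp (- x) * (1 + x + x\<^sup>2)"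
    using exp_ge_add_one_self[of "-x"] assms by (intro mult_right_mono) (auto simp: add_nonneg_nonneg)
  finally show ?thesis by (simp add: exp_minus field_simps)
qed

text \<open>From \<open>exp y \<le> 1 + y + y\<^sup>2\<close> on \<open>[-1, 1]\<close>, the centred sum has exponential moment at most
  \<open>exp (l\<^sup>2 n v)\<close> for \<open>l \<le> 1\<close>.  The value \<open>l = sqrt (L / (n v))\<close> balances the exponent, and
  \<open>L \<le> n v\<close> keeps it in range; enlarging \<open>v\<close> covers the Poisson regime.\<close>

lemma Bernstein_sample_upper:
  fixes f :: "'a \<Rightarrow> real"
  assumes P: "prob_space P" and f[measurable]: "f \<in> borel_measurable P"
    and bd: "\<And>x. \<bar>f x\<bar> \<le> 1" and v: "(\<integral>x. (f x)\<^sup>2 \<partial>P) \<le> v" and L: "0 \<le> L" "L \<le> real n * v"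
  shows "measure (sample n P) {X \<in> space (sample n P).
           real n * (\<integral>x. f x \<partial>P) + 2 * sqrt (real n * v * L) \<le> (\<Sum>i<n. f (X i))} \<le> exp (- L)"
proof (cases "L = 0")
  case True
  interpret S: prob_space "sample n P" using P by (rule prob_space_sample)
  show ?thesis using True by (simp add: S.prob_le_1)
next
  case False
  then have Lp: "0 < L" using L by simp
  then have nv: "0 < real n * v" using L by linarith
  interpret P: prob_space P by fact
  define l where "l = sqrt (L / (real n * v))"
  have l0: "0 < l" and l1: "l \<le> 1" using Lp nv L by (auto simp: l_def)
  have intf: "integrable P f" by (rule P.integrable_const_bound[of _ 1]) (use bd in auto)
  have intf2: "integrable P (\<lambda>x. (f x)\<^sup>2)"
    by (rule P.integrable_const_bound[of _ 1]) (use bd in \<open>auto simp: abs_square_le_1\<close>)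
  let ?E = "\<integral>x. f x \<partial>P"
  have "(\<integral>\<^sup>+x. ennreal (exp (l * f x)) \<partial>P) \<le> (\<integral>\<^sup>+x. ennreal (1 + l * f x + l\<^sup>2 * (f x)\<^sup>2) \<partial>P)"
  proof (intro nn_integral_mono ennreal_leI)
    fix x
    have "\<bar>l * f x\<bar> \<le> 1 * 1" unfolding abs_mult using l0 l1 bd[of x] by (intro mult_mono) auto
    then have "exp (l * f x) \<le> 1 + l * f x + (l * f x)\<^sup>2"
      by (intro exp_le_quadratic) (auto simp: abs_le_iff)
    then show "exp (l * f x) \<le> 1 + l * f x + l\<^sup>2 * (f x)\<^sup>2" by (simp add: power_mult_distrib)
  qed
  also have "\<dots> = ennreal (\<integral>x. 1 + l * f x + l\<^sup>2 * (f x)\<^sup>2 \<partial>P)"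
  proof (rule nn_integral_eq_integral)
    show "integrable P (\<lambda>x. 1 + l * f x + l\<^sup>2 * (f x)\<^sup>2)" using intf intf2 by auto
    show "AE x in P. 0 \<le> 1 + l * f x + l\<^sup>2 * (f x)\<^sup>2"
    proof (rule AE_I2)
      fix x
      have "\<bar>l * f x\<bar> \<le> 1 * 1" unfolding abs_mult using l0 l1 bd[of x] by (intro mult_mono) auto
      then show "0 \<le> 1 + l * f x + l\<^sup>2 * (f x)\<^sup>2" by (simp add: add_nonneg_nonneg abs_le_iff)
    qed
  qed
  also have "(\<integral>x. 1 + l * f x + l\<^sup>2 * (f x)\<^sup>2 \<partial>P) = 1 + l * ?E + l\<^sup>2 * (\<integral>x. (f x)\<^sup>2 \<partial>P)"
    using intf intf2 by (simp add: P.prob_space)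
  also have "ennreal \<dots> \<le> ennreal (exp (l * ?E + l\<^sup>2 * v))"
  proof (rule ennreal_leI)
    have "1 + l * ?E + l\<^sup>2 * (\<integral>x. (f x)\<^sup>2 \<partial>P) \<le> 1 + (l * ?E + l\<^sup>2 * v)"
      using v by (simp add: mult_left_mono)
    also have "\<dots> \<le> exp (l * ?E + l\<^sup>2 * v)" by (rule exp_ge_add_one_self)
    finally show "1 + l * ?E + l\<^sup>2 * (\<integral>x. (f x)\<^sup>2 \<partial>P) \<le> exp (l * ?E + l\<^sup>2 * v)" .
  qed
  finally have mgf: "(\<integral>\<^sup>+x. ennreal (exp (l * f x)) \<partial>P) \<le> ennreal (exp (l * ?E + l\<^sup>2 * v))" .
  let ?a = "real n * ?E + 2 * sqrt (real n * v * L)"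
  have "measure (sample n P) {X \<in> space (sample n P). l * ?a \<le> (\<Sum>i<n. l * f (X i))}
      \<le> exp (- (l * ?a)) * exp (l * ?E + l\<^sup>2 * v) ^ n"
    by (rule Chernoff_sample[OF P _ mgf]) auto
  also have "\<dots> = exp (- 2 * (l * sqrt (real n * v * L)) + l\<^sup>2 * (real n * v))"
    by (simp add: exp_of_nat_mult[symmetric] exp_add[symmetric] algebra_simps)
  also have "l * sqrt (real n * v * L) = L"
  proof -
    have "l * sqrt (real n * v * L) = sqrt (L / (real n * v) * (real n * v * L))"
      unfolding l_def by (rule real_sqrt_mult[symmetric])
    also have "L / (real n * v) * (real n * v * L) = L\<^sup>2" using less_imp_neq[OF nv] by (simp add: power2_eq_square)
    finally show ?thesis using Lp by simp
  qed
  also have "l\<^sup>2 * (real n * v) = L" using less_imp_neq[OF nv] nv Lp unfolding l_def by (subst real_sqrt_pow2) (auto simp: less_imp_le)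
  also have "(\<lambda>X. l * ?a \<le> (\<Sum>i<n. l * f (X i))) = (\<lambda>X. ?a \<le> (\<Sum>i<n. f (X i)))"
    using l0 by (simp add: sum_distrib_left[symmetric] fun_eq_iff)
  finally show ?thesis by simp
qed

lemma Bernstein_sample:
  fixes f :: "'a \<Rightarrow> real"
  assumes P: "prob_space P" and f[measurable]: "f \<in> borel_measurable P"
    and bd: "\<And>x. \<bar>f x\<bar> \<le> 1" and v: "(\<integral>x. (f x)\<^sup>2 \<partial>P) \<le> v" and L: "0 \<le> L" "L \<le> real n * v"
  shows "measure (sample n P) {X \<in> space (sample n P).
           2 * sqrt (real n * v * L) < \<bar>(\<Sum>i<n. f (X i)) - real n * (\<integral>x. f x \<partial>P)\<bar>} \<le> 2 * exp (- L)"
proof -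
  interpret S: prob_space "sample n P" using P by (rule prob_space_sample)
  let ?A = "\<lambda>g. {X \<in> space (sample n P). real n * (\<integral>x. g x \<partial>P) + 2 * sqrt (real n * v * L) \<le> (\<Sum>i<n. g (X i))}"
  have "measure (sample n P) {X \<in> space (sample n P).
      2 * sqrt (real n * v * L) < \<bar>(\<Sum>i<n. f (X i)) - real n * (\<integral>x. f x \<partial>P)\<bar>}
      \<le> measure (sample n P) (?A f \<union> ?A (\<lambda>x. - f x))"
    by (rule S.finite_measure_mono) (auto simp: sum_negf)
  also have "\<dots> \<le> measure (sample n P) (?A f) + measure (sample n P) (?A (\<lambda>x. - f x))"
    by (rule measure_Un_le) measurable
  also have "\<dots> \<le> exp (- L) + exp (- L)"
    by (intro add_mono Bernstein_sample_upper P L) (use bd v in auto)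
  finally show ?thesis by simp
qed

section \<open>Weighted slabs\<close>

lemma slab_indicator_diff:
  fixes a b s \<tau> q :: real
  assumes "0 \<le> q" "\<tau> < \<bar>a - b\<bar> \<Longrightarrow> 1 \<le> q"
  shows "\<bar>of_bool (\<bar>a\<bar> \<le> s) - of_bool (\<bar>b\<bar> \<le> s)\<bar> \<le> of_bool (\<bar>\<bar>b\<bar> - s\<bar> \<le> \<tau>) + q"
  using assms by (auto simp: of_bool_def abs_if split: if_splits)

text \<open>What chaining needs from the law of the clean observations, expressed with the weight \<open>\<gamma>\<close>:
  projections to unit vectors give mass \<open>O(t)\<close> to shells of width \<open>t\<close>, and projections to the unit
  ball have squares with an exponential moment.\<close>

locale weighted_projections = prob_space P for P :: "'a measure" +
  fixes \<gamma> :: "'a \<Rightarrow> real" and d :: nat and Y :: "nat \<Rightarrow> 'a \<Rightarrow> real"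
  assumes meas_weight [measurable]: "\<gamma> \<in> borel_measurable P"
    and weight_bounds: "0 \<le> \<gamma> x" "\<gamma> x \<le> 1"
    and meas_Y: "j < d \<Longrightarrow> Y j \<in> borel_measurable P"
    and slab_mass: "sq_norm d c = 1 \<Longrightarrow> 0 \<le> s \<Longrightarrow> 0 \<le> t \<Longrightarrow>
      (\<integral>x. \<gamma> x * of_bool (\<bar>\<bar>ip d c (\<lambda>j. Y j x)\<bar> - s\<bar> \<le> t) \<partial>P) \<le> 2 * t"
    and exp_square_mass: "sq_norm d h \<le> 1 \<Longrightarrow>
      (\<integral>\<^sup>+x. ennreal (\<gamma> x * (exp ((ip d h (\<lambda>j. Y j x))\<^sup>2 / 4) - 1)) \<partial>P) \<le> 1"
begin

definition proj :: "(nat \<Rightarrow> real) \<Rightarrow> 'a \<Rightarrow> real" where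
  "proj c x = ip d c (\<lambda>j. Y j x)"

definition slab :: "real \<Rightarrow> (nat \<Rightarrow> real) \<Rightarrow> 'a \<Rightarrow> real" where
  "slab s c x = \<gamma> x * of_bool (\<bar>proj c x\<bar> \<le> s)"

definition shell :: "real \<Rightarrow> real \<Rightarrow> (nat \<Rightarrow> real) \<Rightarrow> 'a \<Rightarrow> real" where
  "shell s t c x = \<gamma> x * of_bool (\<bar>\<bar>proj c x\<bar> - s\<bar> \<le> t)"

lemma meas_proj [measurable]: "proj c \<in> borel_measurable P"
  unfolding proj_def ip_def using meas_Y by (intro borel_measurable_sum borel_measurable_times) auto

lemma meas_slab [measurable]: "slab s c \<in> borel_measurable P"
  unfolding slab_def by measurable

lemma meas_shell [measurable]: "shell s t c \<in> borel_measurable P"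
  unfolding shell_def by measurable

lemma slab_bounds: "0 \<le> slab s c x" "slab s c x \<le> 1"
  using weight_bounds[of x] by (auto simp: slab_def)

lemma shell_bounds: "0 \<le> shell s t c x" "shell s t c x \<le> 1"
  using weight_bounds[of x] by (auto simp: shell_def)

lemma integrable_bounded [intro]:
  fixes f :: "'a \<Rightarrow> real"
  shows "f \<in> borel_measurable P \<Longrightarrow> (\<And>x. \<bar>f x\<bar> \<le> 1) \<Longrightarrow> integrable P f"
  by (rule integrable_const_bound[of _ 1]) auto

lemma proj_diff: "proj (\<lambda>j. c j - c' j) x = proj c x - proj c' x"
  by (simp add: proj_def ip_algebra)

lemma proj_scaled_diff: "proj (\<lambda>j. a * (c j - c' j)) x = a * (proj c x - proj c' x)"
  unfolding proj_def ip_algebra ..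

lemma sq_norm_scaled_diff: "sq_norm d (\<lambda>j. a * (c j - c' j)) = a\<^sup>2 * sq_norm d (\<lambda>j. c j - c' j)"
  unfolding ip_algebra(3,6) power2_eq_square by (rule mult.assoc[symmetric])

lemma square_mass:
  assumes "sq_norm d h \<le> 1"
  shows "integrable P (\<lambda>x. \<gamma> x * (proj h x)\<^sup>2)" "(\<integral>x. \<gamma> x * (proj h x)\<^sup>2 \<partial>P) \<le> 4"
proof -
  have "(\<integral>\<^sup>+x. ennreal (\<gamma> x * (proj h x)\<^sup>2) \<partial>P)
      \<le> (\<integral>\<^sup>+x. ennreal 4 * ennreal (\<gamma> x * (exp ((proj h x)\<^sup>2 / 4) - 1)) \<partial>P)"
  proof (rule nn_integral_mono)
    fix x
    have "\<gamma> x * ((proj h x)\<^sup>2 / 4) \<le> \<gamma> x * (exp ((proj h x)\<^sup>2 / 4) - 1)"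
    proof (rule mult_left_mono)
      show "(proj h x)\<^sup>2 / 4 \<le> exp ((proj h x)\<^sup>2 / 4) - 1"
        using exp_ge_add_one_self[of "(proj h x)\<^sup>2 / 4"] by linarith
    qed (rule weight_bounds)
    then have "\<gamma> x * (proj h x)\<^sup>2 \<le> 4 * (\<gamma> x * (exp ((proj h x)\<^sup>2 / 4) - 1))" by simp
    then have "ennreal (\<gamma> x * (proj h x)\<^sup>2) \<le> ennreal (4 * (\<gamma> x * (exp ((proj h x)\<^sup>2 / 4) - 1)))"
      by (rule ennreal_leI)
    also have "\<dots> = ennreal 4 * ennreal (\<gamma> x * (exp ((proj h x)\<^sup>2 / 4) - 1))"
      using weight_bounds[of x] by (intro ennreal_mult) auto
    finally show "ennreal (\<gamma> x * (proj h x)\<^sup>2) \<le> ennreal 4 * ennreal (\<gamma> x * (exp ((proj h x)\<^sup>2 / 4) - 1))" .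
  qed
  also have "\<dots> = ennreal 4 * (\<integral>\<^sup>+x. ennreal (\<gamma> x * (exp ((proj h x)\<^sup>2 / 4) - 1)) \<partial>P)"
    by (rule nn_integral_cmult) measurable
  also have "\<dots> \<le> ennreal 4 * 1"
    using exp_square_mass[OF assms] unfolding proj_def by (intro mult_left_mono) auto
  finally have *: "(\<integral>\<^sup>+x. ennreal (\<gamma> x * (proj h x)\<^sup>2) \<partial>P) \<le> ennreal 4" by simp
  then show i: "integrable P (\<lambda>x. \<gamma> x * (proj h x)\<^sup>2)"
    using weight_bounds by (intro integrableI_bounded) (auto simp: less_top[symmetric] top_unique abs_mult intro: le_less_trans)
  have "ennreal (\<integral>x. \<gamma> x * (proj h x)\<^sup>2 \<partial>P) \<le> ennreal 4"
    using * weight_bounds by (subst nn_integral_eq_integral[OF i, symmetric]) auto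
  then show "(\<integral>x. \<gamma> x * (proj h x)\<^sup>2 \<partial>P) \<le> 4" by (subst (asm) ennreal_le_iff) auto
qed

text \<open>Two slabs differ at \<open>x\<close> only if \<open>x\<close> lies within \<open>\<tau>\<close> of the boundary of one of them or the
  projections differ by more than \<open>\<tau>\<close>; the second event is charged to the square of the difference.
  For \<open>|c - c'| \<le> \<tau>\<^sup>2\<close> the rescaled difference lies in the unit ball, so that both parts have mass
  \<open>O(\<tau>)\<close>.\<close>

lemma slab_diff_le:
  assumes "0 < \<tau>"
  shows "\<bar>slab s c x - slab s c' x\<bar> \<le> shell s \<tau> c' x + \<tau>\<^sup>2 * (\<gamma> x * (proj (\<lambda>j. (1 / \<tau>\<^sup>2) * (c j - c' j)) x)\<^sup>2)"
proof -
  let ?q = "\<tau>\<^sup>2 * (proj (\<lambda>j. (1 / \<tau>\<^sup>2) * (c j - c' j)) x)\<^sup>2"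
  have "?q = ((proj c x - proj c' x) / \<tau>)\<^sup>2"
    unfolding proj_scaled_diff using assms by (simp add: power_divide power_mult_distrib power2_eq_square)
  moreover have "1 \<le> ((proj c x - proj c' x) / \<tau>)\<^sup>2" if "\<tau> < \<bar>proj c x - proj c' x\<bar>"
    using that assms abs_le_square_iff[of 1 "(proj c x - proj c' x) / \<tau>"] by simp
  ultimately have q: "0 \<le> ?q" "\<tau> < \<bar>proj c x - proj c' x\<bar> \<Longrightarrow> 1 \<le> ?q" by auto
  have "\<bar>of_bool (\<bar>proj c x\<bar> \<le> s) - of_bool (\<bar>proj c' x\<bar> \<le> s)\<bar> \<le> of_bool (\<bar>\<bar>proj c' x\<bar> - s\<bar> \<le> \<tau>) + ?q"
    using q by (rule slab_indicator_diff)
  then have "\<gamma> x * \<bar>of_bool (\<bar>proj c x\<bar> \<le> s) - of_bool (\<bar>proj c' x\<bar> \<le> s)\<bar> \<le> \<gamma> x * (of_bool (\<bar>\<bar>proj c' x\<bar> - s\<bar> \<le> \<tau>) + ?q)"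
    using weight_bounds[of x] by (intro mult_left_mono)
  also have "\<gamma> x * \<bar>of_bool (\<bar>proj c x\<bar> \<le> s) - of_bool (\<bar>proj c' x\<bar> \<le> s)\<bar> = \<bar>slab s c x - slab s c' x\<bar>"
    using weight_bounds[of x] by (simp add: slab_def abs_mult right_diff_distrib[symmetric])
  also have "\<gamma> x * (of_bool (\<bar>\<bar>proj c' x\<bar> - s\<bar> \<le> \<tau>) + ?q) = shell s \<tau> c' x + \<tau>\<^sup>2 * (\<gamma> x * (proj (\<lambda>j. (1 / \<tau>\<^sup>2) * (c j - c' j)) x)\<^sup>2)"
    by (simp add: shell_def algebra_simps)
  finally show ?thesis .
qed

lemma sq_norm_rescaled:
  assumes "0 < \<tau>" "sq_norm d (\<lambda>j. c j - c' j) \<le> (\<tau>\<^sup>2)\<^sup>2"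
  shows "sq_norm d (\<lambda>j. (1 / \<tau>\<^sup>2) * (c j - c' j)) \<le> 1"
  unfolding sq_norm_scaled_diff using assms by (simp add: power_divide)

lemma slab_increment:
  assumes c: "sq_norm d c' = 1" "0 \<le> s" and \<tau>: "0 < \<tau>" "\<tau> \<le> 1" and near: "sq_norm d (\<lambda>j. c j - c' j) \<le> (\<tau>\<^sup>2)\<^sup>2"
  shows "(\<integral>x. \<bar>slab s c x - slab s c' x\<bar> \<partial>P) \<le> 6 * \<tau>"
    and "(\<integral>x. (slab s c x - slab s c' x)\<^sup>2 \<partial>P) \<le> 6 * \<tau>"
proof -
  let ?h = "\<lambda>j. (1 / \<tau>\<^sup>2) * (c j - c' j)"
  have h: "sq_norm d ?h \<le> 1" using sq_norm_rescaled[OF \<tau>(1) near] .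
  have abs1: "\<bar>slab s c x - slab s c' x\<bar> \<le> 1" for x using slab_bounds[of s c x] slab_bounds[of s c' x] by auto
  have "(\<integral>x. \<bar>slab s c x - slab s c' x\<bar> \<partial>P) \<le> (\<integral>x. shell s \<tau> c' x + \<tau>\<^sup>2 * (\<gamma> x * (proj ?h x)\<^sup>2) \<partial>P)"
  proof (rule integral_mono)
    show "integrable P (\<lambda>x. \<bar>slab s c x - slab s c' x\<bar>)"
      using abs1 by (intro integrable_bounded) auto
    show "integrable P (\<lambda>x. shell s \<tau> c' x + \<tau>\<^sup>2 * (\<gamma> x * (proj ?h x)\<^sup>2))"
      using shell_bounds[of s \<tau> c']
      by (intro Bochner_Integration.integrable_add integrable_mult_right square_mass(1)[OF h]) (auto intro!: integrable_bounded)
  qed (rule slab_diff_le[OF \<tau>(1)])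
  also have "\<dots> = (\<integral>x. shell s \<tau> c' x \<partial>P) + \<tau>\<^sup>2 * (\<integral>x. \<gamma> x * (proj ?h x)\<^sup>2 \<partial>P)"
    using shell_bounds square_mass[OF h]
    by (subst Bochner_Integration.integral_add) (auto intro!: integrable_bounded)
  also have "\<dots> \<le> 2 * \<tau> + \<tau>\<^sup>2 * 4"
    using slab_mass[OF c, of \<tau>] \<tau> square_mass[OF h] unfolding shell_def proj_def
    by (intro add_mono mult_left_mono) auto
  also have "\<dots> \<le> 6 * \<tau>" using \<tau> by (simp add: power2_eq_square)
  finally show 1: "(\<integral>x. \<bar>slab s c x - slab s c' x\<bar> \<partial>P) \<le> 6 * \<tau>" .
  have "(\<integral>x. (slab s c x - slab s c' x)\<^sup>2 \<partial>P) \<le> (\<integral>x. \<bar>slab s c x - slab s c' x\<bar> \<partial>P)"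
  proof (intro integral_mono integrable_bounded)
    fix x
    show "(slab s c x - slab s c' x)\<^sup>2 \<le> \<bar>slab s c x - slab s c' x\<bar>"
      using abs1[of x] mult_left_le[of "\<bar>slab s c x - slab s c' x\<bar>" "\<bar>slab s c x - slab s c' x\<bar>"]
      by (simp add: power2_eq_square)
    show "\<bar>(slab s c x - slab s c' x)\<^sup>2\<bar> \<le> 1" using abs1[of x] by (simp add: abs_square_le_1)
    show "\<bar>\<bar>slab s c x - slab s c' x\<bar>\<bar> \<le> 1" using abs1[of x] by simp
  qed measurable
  with 1 show "(\<integral>x. (slab s c x - slab s c' x)\<^sup>2 \<partial>P) \<le> 6 * \<tau>" by linarith
qed

lemma shell_second_moment:
  assumes c: "sq_norm d c = 1" "0 \<le> s" "0 \<le> t"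
  shows "(\<integral>x. shell s t c x \<partial>P) \<le> 2 * t" "(\<integral>x. (shell s t c x)\<^sup>2 \<partial>P) \<le> 2 * t"
proof -
  show 1: "(\<integral>x. shell s t c x \<partial>P) \<le> 2 * t"
    using slab_mass[OF c] unfolding shell_def proj_def .
  have "(\<integral>x. (shell s t c x)\<^sup>2 \<partial>P) \<le> (\<integral>x. shell s t c x \<partial>P)"
  proof (intro integral_mono integrable_bounded)
    fix x
    show "(shell s t c x)\<^sup>2 \<le> shell s t c x"
      using shell_bounds[of s t c x] mult_left_le[of "shell s t c x" "shell s t c x"] by (simp add: power2_eq_square)
    show "\<bar>(shell s t c x)\<^sup>2\<bar> \<le> 1" using shell_bounds[of s t c x] by (simp add: power_le_one)
    show "\<bar>shell s t c x\<bar> \<le> 1" using shell_bounds[of s t c x] by simp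
  qed measurable
  with 1 show "(\<integral>x. (shell s t c x)\<^sup>2 \<partial>P) \<le> 2 * t" by linarith
qed

definition quad :: "nat \<Rightarrow> (nat \<Rightarrow> real) \<Rightarrow> (nat \<Rightarrow> 'a) \<Rightarrow> real" where
  "quad n h X = (\<Sum>i<n. \<gamma> (X i) * (proj h (X i))\<^sup>2)"

lemma quad_nonneg: "0 \<le> quad n h X"
  unfolding quad_def using weight_bounds by (intro sum_nonneg) auto

text \<open>By convexity \<open>exp (\<gamma> y) \<le> 1 + \<gamma> (exp y - 1)\<close>, which turns the assumption on the weighted mass into
  an exponential moment of at most \<open>2\<close> under the full law.\<close>

lemma quad_tail:
  assumes "sq_norm d h \<le> 1"
  shows "measure (sample n P) {X \<in> space (sample n P). 4 * a \<le> quad n h X} \<le> exp (real n - a)"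
proof -
  have "(\<integral>\<^sup>+x. ennreal (exp (\<gamma> x * (proj h x)\<^sup>2 / 4)) \<partial>P)
      \<le> (\<integral>\<^sup>+x. 1 + ennreal (\<gamma> x * (exp ((proj h x)\<^sup>2 / 4) - 1)) \<partial>P)"
  proof (rule nn_integral_mono)
    fix x
    let ?y = "(proj h x)\<^sup>2 / 4"
    have "exp ((1 - \<gamma> x) *\<^sub>R 0 + \<gamma> x *\<^sub>R ?y) \<le> (1 - \<gamma> x) * exp 0 + \<gamma> x * exp ?y"
      using exp_convex weight_bounds[of x] by (intro convex_onD) auto
    then have "exp (\<gamma> x * (proj h x)\<^sup>2 / 4) \<le> 1 + \<gamma> x * (exp ?y - 1)" by (simp add: algebra_simps)
    then have "ennreal (exp (\<gamma> x * (proj h x)\<^sup>2 / 4)) \<le> ennreal (1 + \<gamma> x * (exp ?y - 1))" by (rule ennreal_leI)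
    also have "\<dots> = 1 + ennreal (\<gamma> x * (exp ?y - 1))" using weight_bounds[of x] by (subst ennreal_plus) auto
    finally show "ennreal (exp (\<gamma> x * (proj h x)\<^sup>2 / 4)) \<le> 1 + ennreal (\<gamma> x * (exp ?y - 1))" .
  qed
  also have "\<dots> = 1 + (\<integral>\<^sup>+x. ennreal (\<gamma> x * (exp ((proj h x)\<^sup>2 / 4) - 1)) \<partial>P)"
    by (subst nn_integral_add) (auto simp: emeasure_space_1)
  also have "\<dots> \<le> 1 + 1"
    using exp_square_mass[OF assms] unfolding proj_def by (intro add_left_mono) auto
  also have "\<dots> = ennreal 2" by simp
  finally have "(\<integral>\<^sup>+x. ennreal (exp (\<gamma> x * (proj h x)\<^sup>2 / 4)) \<partial>P) \<le> ennreal 2" .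
  then have "measure (sample n P) {X \<in> space (sample n P). a \<le> (\<Sum>i<n. \<gamma> (X i) * (proj h (X i))\<^sup>2 / 4)}
      \<le> exp (- a) * 2 ^ n"
    by (intro Chernoff_sample prob_space_axioms) auto
  also have "(2::real) ^ n \<le> exp 1 ^ n"
    using exp_ge_add_one_self[of 1] by (intro power_mono) auto
  then have "exp (- a) * 2 ^ n \<le> exp (- a) * exp 1 ^ n" by simp
  also have "\<dots> = exp (real n - a)"
    by (simp add: exp_of_nat_mult[symmetric] exp_add[symmetric])
  finally show ?thesis by (simp add: quad_def sum_divide_distrib[symmetric] mult.commute)
qed

text \<open>At a net point \<open>h'\<close> near \<open>h\<close>, \<open>q (h) \<le> 2 q (h') + 2 q (h - h')\<close>, and \<open>h - h'\<close> is a quarter of a vector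
  of the ball; so the supremum \<open>m\<close> of \<open>q\<close> satisfies \<open>m \<le> 2 b + m / 8\<close>.\<close>

lemma quad_from_net:
  assumes T: "\<And>h. sq_norm d h \<le> 1 \<Longrightarrow> \<exists>h'\<in>T. sq_norm d (\<lambda>j. h j - h' j) \<le> (1/4)\<^sup>2"
    and b: "\<And>h'. h' \<in> T \<Longrightarrow> quad n h' X \<le> b" and h: "sq_norm d h \<le> 1"
  shows "quad n h X \<le> 3 * b"
proof -
  define U where "U = (\<lambda>h. quad n h X) ` {h. sq_norm d h \<le> 1}"
  have bdd: "bdd_above U"
  proof (rule bdd_aboveI)
    fix y assume "y \<in> U"
    then obtain h where h: "sq_norm d h \<le> 1" "y = quad n h X" by (auto simp: U_def)
    have "quad n h X \<le> (\<Sum>i<n. sq_norm d (\<lambda>j. Y j (X i)))"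
      unfolding quad_def
    proof (rule sum_mono)
      fix i
      have "\<gamma> (X i) * (proj h (X i))\<^sup>2 \<le> 1 * (proj h (X i))\<^sup>2"
        using weight_bounds by (intro mult_right_mono) auto
      also have "\<dots> \<le> sq_norm d h * sq_norm d (\<lambda>j. Y j (X i))"
        unfolding proj_def using ip_Cauchy_Schwarz by simp
      also have "\<dots> \<le> 1 * sq_norm d (\<lambda>j. Y j (X i))" using h by (intro mult_right_mono) auto
      finally show "\<gamma> (X i) * (proj h (X i))\<^sup>2 \<le> sq_norm d (\<lambda>j. Y j (X i))" by simp
    qed
    then show "y \<le> (\<Sum>i<n. sq_norm d (\<lambda>j. Y j (X i)))" using h by simp
  qed
  define m where "m = Sup U"
  have le_m: "quad n g X \<le> m" if "sq_norm d g \<le> 1" for g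
    unfolding m_def using that bdd by (intro cSup_upper) (auto simp: U_def)
  have "m \<le> 2 * b + m / 8"
    unfolding m_def
  proof (rule cSup_least)
    show "U \<noteq> {}" using h by (auto simp: U_def)
    fix y assume "y \<in> U"
    then obtain g where g: "sq_norm d g \<le> 1" "y = quad n g X" by (auto simp: U_def)
    from T[OF g(1)] obtain g' where g': "g' \<in> T" "sq_norm d (\<lambda>j. g j - g' j) \<le> (1/4)\<^sup>2" by blast
    have "quad n g X \<le> 2 * quad n g' X + 2 * quad n (\<lambda>j. g j - g' j) X"
      unfolding quad_def sum_distrib_left sum.distrib[symmetric]
    proof (rule sum_mono)
      fix i
      have "0 \<le> (proj g (X i) - 2 * proj g' (X i))\<^sup>2" by simp
      then have "(proj g (X i))\<^sup>2 \<le> 2 * (proj g' (X i))\<^sup>2 + 2 * (proj g (X i) - proj g' (X i))\<^sup>2"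
        by (simp add: power2_eq_square algebra_simps)
      then have "\<gamma> (X i) * (proj g (X i))\<^sup>2 \<le> \<gamma> (X i) * (2 * (proj g' (X i))\<^sup>2 + 2 * (proj g (X i) - proj g' (X i))\<^sup>2)"
        using weight_bounds by (intro mult_left_mono) auto
      then show "\<gamma> (X i) * (proj g (X i))\<^sup>2 \<le> 2 * (\<gamma> (X i) * (proj g' (X i))\<^sup>2) + 2 * (\<gamma> (X i) * (proj (\<lambda>j. g j - g' j) (X i))\<^sup>2)"
        by (simp add: proj_diff algebra_simps)
    qed
    moreover have "quad n (\<lambda>j. g j - g' j) X \<le> m / 16"
    proof -
      have "quad n (\<lambda>j. 4 * (g j - g' j)) X \<le> m"
        using g'(2) unfolding sq_norm_scaled_diff by (intro le_m, unfold sq_norm_scaled_diff) (simp add: power2_eq_square)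
      moreover have "quad n (\<lambda>j. 4 * (g j - g' j)) X = 16 * quad n (\<lambda>j. g j - g' j) X"
        unfolding quad_def proj_scaled_diff proj_diff sum_distrib_left
        by (intro sum.cong refl, subst power_mult_distrib) simp
      ultimately show ?thesis by simp
    qed
    ultimately show "y \<le> 2 * b + Sup U / 8" using g b[OF g'(1)] by (simp add: m_def)
  qed
  moreover have "0 \<le> b" using T[OF h] b quad_nonneg by (meson order_trans)
  ultimately have "m \<le> 3 * b" by simp
  then show ?thesis using le_m[OF h] by simp
qed

end

section \<open>Chaining\<close>

lemma Suc_le_power4: "real (Suc j) \<le> 4 ^ j"
proof (induction j)
  case (Suc j)
  have "1 \<le> (4::real) ^ j" by simp
  with Suc show ?case by simp
qed simp

lemma Suc_div_power4_le: "real (Suc j) / 4 ^ j \<le> ((3/4) ^ j)\<^sup>2"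
proof -
  have "real (Suc j) \<le> (9/4) ^ j"
  proof (induction j)
    case (Suc j)
    have "real (Suc (Suc j)) \<le> (9/4) * real (Suc j)" by simp
    also have "\<dots> \<le> (9/4) * (9/4)^j" using Suc by (intro mult_left_mono) auto
    finally show ?case by simp
  qed simp
  then have "real (Suc j) / 4 ^ j \<le> (9/4)^j / 4^j" by (intro divide_right_mono) auto
  also have "\<dots> = ((3/4) ^ j)\<^sup>2" by (simp add: power_divide[symmetric] power_mult[symmetric] power_mult mult.commute power_mult_distrib[symmetric] power2_eq_square)
  finally show ?thesis .
qed

lemma net_card_exp:
  assumes "real N \<le> (32 / (1 / 16 ^ j)) ^ d"
  shows "real N \<le> exp (4 * real d * real (Suc j))"
proof -
  have e: "(32::real) \<le> exp 4"
  proof -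
    have "5/2 \<le> exp (1::real)" using exp_lower_Taylor_quadratic[of 1] by simp
    then have "(5/2)^4 \<le> exp (1::real) ^ 4" by (intro power_mono) auto
    then show ?thesis by (simp add: exp_of_nat_mult[symmetric] power_divide)
  qed
  have "(32 / (1 / 16 ^ j) :: real) = 32 * 16 ^ j" by simp
  also have "\<dots> \<le> 32 ^ Suc j" by (simp add: power_mono)
  also have "\<dots> \<le> exp 4 ^ Suc j" using e by (intro power_mono) auto
  finally have "(32 / (1 / 16 ^ j)) ^ d \<le> (exp 4 ^ Suc j :: real) ^ d" by (intro power_mono) auto
  also have "\<dots> = exp (4 * real d * real (Suc j))"
    by (simp only: exp_of_nat_mult[symmetric] mult.commute mult.left_commute)
  finally show ?thesis using assms by linarith
qed

lemma dyadic_scale: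
  fixes y :: real
  assumes "1 \<le> y"
  obtains J where "y \<le> 4 ^ J" "4 ^ J \<le> 4 * y"
proof -
  obtain n where n: "y < 4 ^ n" using real_arch_pow[of 4 y] by auto
  define J where "J = (LEAST n. y \<le> 4 ^ n)"
  have J: "y \<le> 4 ^ J" unfolding J_def by (rule LeastI[of _ n]) (use n in simp)
  have "4 ^ J \<le> 4 * y"
  proof (cases J)
    case 0 then show ?thesis using assms by simp
  next
    case (Suc k)
    then have "\<not> y \<le> 4 ^ k" using not_less_Least[of k "\<lambda>n. y \<le> 4 ^ n"] by (simp add: J_def)
    then show ?thesis using Suc by simp
  qed
  with J show ?thesis by (rule that)
qed

context weighted_projections
begin

text \<open>A point \<open>c\<close> of the sphere is linked to nets \<open>T j\<close> of mesh \<open>16\<^sup>-\<^sup>j\<close>, \<open>j \<le> J\<close>.  Level \<open>j\<close> has at most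
  \<open>exp (4 d (j + 1))\<close> increments of second moment \<open>O(4\<^sup>-\<^sup>j)\<close>; requiring each to stay within
  \<open>40 sqrt (n D) (3/4)\<^sup>j\<close> costs a failure probability \<open>2 exp (- 5 (j + 1) D)\<close> apiece, so both the
  deviations and the failure probabilities are summable over the levels.  With
  \<open>4\<^sup>J\<close> of order \<open>sqrt (n / D)\<close>, Bernstein's inequality stays in its Gaussian regime at every level,
  and the nets are fine enough for the rest: below \<open>16\<^sup>-\<^sup>J\<close> both the mean of the increments and the
  bound by a shell and a quadratic form are \<open>O(n 4\<^sup>-\<^sup>J)\<close>.\<close>

theorem slab_deviation:
  fixes D s :: real and n :: nat
  assumes D: "1 \<le> D" "real d \<le> D" "D \<le> real n" and s: "0 \<le> s"
  shows "\<exists>E\<in>sets (sample n P). 1 - 8 * exp (- D) \<le> measure (sample n P) E \<and>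
     (\<forall>X\<in>E. \<forall>c. sq_norm d c = 1 \<longrightarrow>
        \<bar>(\<Sum>i<n. slab s c (X i)) - real n * (\<integral>x. slab s c x \<partial>P)\<bar> \<le> 300 * sqrt (real n * D))"
proof -
  let ?M = "sample n P"
  interpret S: prob_space ?M by (rule prob_space_sample[OF prob_space_axioms])
  define y where "y = sqrt (real n / D)"
  have y1: "1 \<le> y" using D by (simp add: y_def)
  then obtain J where J: "y \<le> 4 ^ J" "4 ^ J \<le> 4 * y" by (rule dyadic_scale)
  have n0: "0 < real n" using D by linarith
  have ysq: "D * y\<^sup>2 = real n" using D by (simp add: y_def)
  define B where "B = sqrt (real n * D)"
  have B0: "0 \<le> B" using D by (simp add: B_def)
  have By: "B = D * y"
  proof -
    have "(D * y)\<^sup>2 = real n * D" unfolding ysq[symmetric] by (simp add: power2_eq_square)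
    moreover have "0 \<le> D * y" using D y1 by simp
    ultimately show ?thesis unfolding B_def by (rule real_sqrt_unique)
  qed
  \<comment> \<open>The upper bound on \<open>J\<close> is used only through this inequality, which keeps all levels in the
    range \<open>L \<le> n v\<close> of Bernstein's inequality.\<close>
  have Dn: "D * (16 ^ J) \<le> 16 * real n"
  proof -
    have "(16::real) ^ J = (4 ^ J)\<^sup>2" by (simp add: power2_eq_square power_mult_distrib[symmetric])
    also have "\<dots> \<le> (4 * y)\<^sup>2" using J y1 by (intro power_mono) auto
    finally have "D * 16 ^ J \<le> D * (4 * y)\<^sup>2" using D by (intro mult_left_mono) auto
    also have "\<dots> = 16 * real n" using ysq by (simp add: power_mult_distrib)
    finally show ?thesis .
  qed
  define \<tau> :: "nat \<Rightarrow> real" where "\<tau> j = 1 / 4 ^ j" for j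
  have \<tau>: "0 < \<tau> j" "\<tau> j \<le> 1" for j by (auto simp: \<tau>_def)
  have \<tau>J: "real n * \<tau> J \<le> B"
  proof -
    have "real n * \<tau> J = D * y\<^sup>2 / 4 ^ J" using ysq by (simp add: \<tau>_def)
    also have "\<dots> \<le> D * y\<^sup>2 / y" using J y1 D by (intro divide_left_mono) auto
    also have "\<dots> = B" using By y1 by (simp add: power2_eq_square)
    finally show ?thesis .
  qed
  define S where "S = {c. sq_norm d c = 1}"
  have "\<forall>j. \<exists>T. T \<subseteq> S \<and> finite T \<and> real (card T) \<le> (32 / (1 / 16 ^ j)) ^ d \<and>
           (\<forall>c\<in>S. \<exists>c'\<in>T. sq_norm d (\<lambda>i. c i - c' i) \<le> (1 / 16 ^ j)\<^sup>2)"
  proof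
    fix j :: nat
    show "\<exists>T. T \<subseteq> S \<and> finite T \<and> real (card T) \<le> (32 / (1 / 16 ^ j)) ^ d \<and>
           (\<forall>c\<in>S. \<exists>c'\<in>T. sq_norm d (\<lambda>i. c i - c' i) \<le> (1 / 16 ^ j)\<^sup>2)"
      by (rule internal_net) (simp_all add: S_def)
  qed
  from choice[OF this] obtain T where T_all: "\<forall>j. T j \<subseteq> S \<and> finite (T j) \<and> real (card (T j)) \<le> (32 / (1 / 16 ^ j)) ^ d \<and>
           (\<forall>c\<in>S. \<exists>c'\<in>T j. sq_norm d (\<lambda>i. c i - c' i) \<le> (1 / 16 ^ j)\<^sup>2)"
    by (rule exE)
  then have T: "\<And>j. T j \<subseteq> S" "\<And>j. finite (T j)" "\<And>j. real (card (T j)) \<le> (32 / (1 / 16 ^ j)) ^ d"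
    and Tnet: "\<And>j c. c \<in> S \<Longrightarrow> \<exists>c'\<in>T j. sq_norm d (\<lambda>i. c i - c' i) \<le> (1 / 16 ^ j)\<^sup>2"
    by blast+
  have T16: "(1 / 16 ^ j)\<^sup>2 = ((\<tau> j)\<^sup>2)\<^sup>2" for j
  proof -
    have "(16::real) ^ j = (4 ^ j)\<^sup>2" by (simp add: power2_eq_square power_mult_distrib[symmetric])
    then show ?thesis by (simp add: \<tau>_def power_divide)
  qed
  define \<pi> where "\<pi> j c = (SOME c'. c' \<in> T j \<and> sq_norm d (\<lambda>i. c i - c' i) \<le> ((\<tau> j)\<^sup>2)\<^sup>2)" for j c
  have \<pi>: "\<pi> j c \<in> T j" "sq_norm d (\<lambda>i. c i - \<pi> j c i) \<le> ((\<tau> j)\<^sup>2)\<^sup>2" if "c \<in> S" for j c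
    using someI_ex[of "\<lambda>c'. c' \<in> T j \<and> sq_norm d (\<lambda>i. c i - c' i) \<le> ((\<tau> j)\<^sup>2)\<^sup>2"] Tnet[OF that, of j]
    unfolding \<pi>_def T16 by blast+
  obtain H where H: "finite H" "real (card H) \<le> (32 / (1/4)) ^ d" "\<And>h. h \<in> H \<Longrightarrow> sq_norm d h \<le> 1"
    and Hnet: "\<And>h. sq_norm d h \<le> 1 \<Longrightarrow> \<exists>h'\<in>H. sq_norm d (\<lambda>i. h i - h' i) \<le> (1/4)\<^sup>2"
    using internal_net[of "1/4" "{h. sq_norm d h \<le> 1}" d] by auto
  define dev where "dev f X = \<bar>(\<Sum>i<n. f (X i)) - real n * (\<integral>x. f x \<partial>P)\<bar>" for f :: "'a \<Rightarrow> real" and X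
  define a where "a j = 40 * B * (3/4) ^ j" for j
  \<comment> \<open>Level \<open>0\<close> has no parent: its increment is the slab itself.\<close>
  define inc where "inc j c = (\<lambda>x. if j = 0 then slab s c x else slab s c x - slab s (\<pi> (j - 1) c) x)" for j c
  have inc_meas[measurable]: "inc j c \<in> borel_measurable P" for j c
    unfolding inc_def by measurable
  define bad where "bad f j = {X \<in> space ?M. a j < dev f X}" for f j
  have bad_meas[measurable]: "bad f j \<in> sets ?M" if [measurable]: "f \<in> borel_measurable P" for f j
    unfolding bad_def dev_def by measurable
  have bad_prob: "measure ?M (bad f j) \<le> 2 * exp (- (5 * real (Suc j) * D))"
    if f[measurable]: "f \<in> borel_measurable P" and f1: "\<And>x. \<bar>f x\<bar> \<le> 1" and v: "(\<integral>x. (f x)\<^sup>2 \<partial>P) \<le> 80 / 4 ^ j"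
      and j: "j \<le> J" for f j
  proof -
    let ?L = "5 * real (Suc j) * D"
    have "D * 16 ^ j \<le> D * 16 ^ J" using D j by (intro mult_left_mono power_increasing) auto
    then have "D * 16 ^ j \<le> 16 * real n" using Dn by linarith
    then have "real (Suc j) * (D * 16 ^ j) \<le> 4 ^ j * (16 * real n)"
      using D by (intro mult_mono[OF Suc_le_power4]) auto
    moreover have "(16::real) ^ j = 4 ^ j * 4 ^ j" by (simp add: power_mult_distrib[symmetric])
    ultimately have "4 ^ j * (real (Suc j) * D * 4 ^ j) \<le> 4 ^ j * (16 * real n)" by (simp only: mult_ac)
    then have "real (Suc j) * D * 4 ^ j \<le> 16 * real n" by simp
    then have L: "?L \<le> real n * (80 / 4 ^ j)" by (simp add: field_simps)
    have "real n * (80 / 4 ^ j) * ?L = 400 * (real n * D) * (real (Suc j) / 4 ^ j)" by simp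
    also have "\<dots> \<le> 400 * (real n * D) * ((3/4) ^ j)\<^sup>2"
      using D by (intro mult_left_mono Suc_div_power4_le) auto
    also have "\<dots> = (20 * B * (3/4) ^ j)\<^sup>2" using D by (simp add: B_def power_mult_distrib)
    finally have "sqrt (real n * (80 / 4 ^ j) * ?L) \<le> 20 * B * (3/4) ^ j"
      using B0 by (intro real_le_lsqrt) auto
    then have "2 * sqrt (real n * (80 / 4 ^ j) * ?L) \<le> a j" by (simp add: a_def)
    then have "measure ?M (bad f j) \<le> measure ?M {X \<in> space ?M. 2 * sqrt (real n * (80 / 4 ^ j) * ?L) < \<bar>(\<Sum>i<n. f (X i)) - real n * (\<integral>x. f x \<partial>P)\<bar>}"
      by (intro S.finite_measure_mono) (auto simp: bad_def dev_def)
    also have "\<dots> \<le> 2 * exp (- ?L)"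
      using D by (intro Bernstein_sample prob_space_axioms f f1 v L) auto
    finally show ?thesis .
  qed
  have inc1: "\<bar>inc j c x\<bar> \<le> 1" for j c x
    using slab_bounds[of s c x] slab_bounds[of s "\<pi> (j - 1) c" x] by (auto simp: inc_def)
  have inc_v: "(\<integral>x. (inc j c x)\<^sup>2 \<partial>P) \<le> 80 / 4 ^ j" if c: "c \<in> S" for j c
  proof (cases j)
    case 0
    have "(\<integral>x. (inc j c x)\<^sup>2 \<partial>P) \<le> (\<integral>x. 1 \<partial>P)"
      using inc1[of j c] by (intro integral_mono integrable_bounded) (auto simp: abs_square_le_1)
    then show ?thesis using 0 by (simp add: prob_space)
  next
    case (Suc i)
    have "(\<integral>x. (slab s c x - slab s (\<pi> i c) x)\<^sup>2 \<partial>P) \<le> 6 * \<tau> i"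
      using \<pi>[OF c, of i] T(1)[of i] s \<tau>[of i] by (intro slab_increment) (auto simp: S_def)
    also have "\<dots> \<le> 80 / 4 ^ j" using Suc by (simp add: \<tau>_def field_simps)
    finally show ?thesis using Suc by (simp add: inc_def)
  qed
  have shell_v: "(\<integral>x. (shell s (\<tau> J) c x)\<^sup>2 \<partial>P) \<le> 80 / 4 ^ J" if c: "c \<in> S" for c
  proof -
    have "(\<integral>x. (shell s (\<tau> J) c x)\<^sup>2 \<partial>P) \<le> 2 * \<tau> J"
      using shell_second_moment(2)[of c s "\<tau> J"] c s \<tau>[of J] by (simp add: S_def)
    also have "\<dots> \<le> 80 / 4 ^ J" by (simp add: \<tau>_def divide_right_mono)
    finally show ?thesis .
  qed
  \<comment> \<open>The term \<open>6 D\<close> pays for the quarter-net of the ball, which has at most \<open>exp (5 D)\<close> points.\<close>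
  define b where "b = real n + 6 * D"
  define Bad where "Bad = (\<Union>j\<in>{..J}. \<Union>c\<in>T j. bad (inc j c) j) \<union> (\<Union>c\<in>T J. bad (shell s (\<tau> J) c) J)
      \<union> (\<Union>h\<in>H. {X \<in> space ?M. 4 * b \<le> quad n h X})"
  have quad_meas[measurable]: "{X \<in> space ?M. 4 * b \<le> quad n h X} \<in> sets ?M" for h
    unfolding quad_def by measurable
  have Bad_meas: "Bad \<in> sets ?M"
    unfolding Bad_def using T(2) H(1) by (intro sets.Un sets.finite_UN finite_atMost) auto
  have net_bound: "(\<Sum>c\<in>T j. measure ?M (bad (f c) j)) \<le> 2 * exp (- D) * exp (- D) ^ j"
    if "\<And>c. c \<in> S \<Longrightarrow> measure ?M (bad (f c) j) \<le> 2 * exp (- (5 * real (Suc j) * D))" for f j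
  proof -
    have "(\<Sum>c\<in>T j. measure ?M (bad (f c) j)) \<le> (\<Sum>c\<in>T j. 2 * exp (- (5 * real (Suc j) * D)))"
      using that T(1) by (intro sum_mono) auto
    also have "\<dots> = real (card (T j)) * (2 * exp (- (5 * real (Suc j) * D)))" by simp
    also have "\<dots> \<le> exp (4 * D * real (Suc j)) * (2 * exp (- (5 * real (Suc j) * D)))"
    proof (intro mult_right_mono)
      have "real (card (T j)) \<le> exp (4 * real d * real (Suc j))" using T(3) by (rule net_card_exp)
      also have "\<dots> \<le> exp (4 * D * real (Suc j))" using D by (simp add: mult_right_mono)
      finally show "real (card (T j)) \<le> exp (4 * D * real (Suc j))" .
    qed simp
    also have "\<dots> = 2 * exp (- D * real (Suc j))"
      by (simp add: exp_add[symmetric] algebra_simps)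
    also have "\<dots> = 2 * exp (- D) * exp (- D) ^ j"
      by (simp add: exp_of_nat_mult[symmetric] exp_add[symmetric] algebra_simps)
    finally show ?thesis .
  qed
  have eD: "exp (- D) \<le> 1 / 2"
  proof -
    have "exp (- D) \<le> exp (- 1)" using D by simp
    also have "\<dots> \<le> 1 / 2" using exp_ge_add_one_self[of 1] by (simp add: exp_minus field_simps)
    finally show ?thesis .
  qed
  define BI where "BI j = (\<Union>c\<in>T j. bad (inc j c) j)" for j
  define BS where "BS = (\<Union>c\<in>T J. bad (shell s (\<tau> J) c) J)"
  define BQ where "BQ = (\<Union>h\<in>H. {X \<in> space ?M. 4 * b \<le> quad n h X})"
  have BI_meas: "BI j \<in> sets ?M" for j unfolding BI_def using T(2) by (intro sets.finite_UN) auto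
  have BS_meas: "BS \<in> sets ?M" unfolding BS_def using T(2) by (intro sets.finite_UN) auto
  have BQ_meas: "BQ \<in> sets ?M" unfolding BQ_def using H(1) by (intro sets.finite_UN) auto
  have UBI_meas: "(\<Union>j\<in>{..J}. BI j) \<in> sets ?M" using BI_meas by (intro sets.finite_UN) auto
  have "measure ?M Bad = measure ?M ((\<Union>j\<in>{..J}. BI j) \<union> BS \<union> BQ)"
    unfolding Bad_def BI_def BS_def BQ_def ..
  also have "\<dots> \<le> measure ?M ((\<Union>j\<in>{..J}. BI j) \<union> BS) + measure ?M BQ"
    by (rule measure_Un_le) (use UBI_meas BS_meas BQ_meas in auto)
  also have "measure ?M ((\<Union>j\<in>{..J}. BI j) \<union> BS) \<le> measure ?M (\<Union>j\<in>{..J}. BI j) + measure ?M BS"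
    by (rule measure_Un_le) (use UBI_meas BS_meas in auto)
  also have "measure ?M (\<Union>j\<in>{..J}. BI j) \<le> (\<Sum>j\<le>J. measure ?M (BI j))"
    by (rule measure_UNION_le) (use BI_meas in auto)
  also have "\<dots> \<le> (\<Sum>j\<le>J. \<Sum>c\<in>T j. measure ?M (bad (inc j c) j))"
    unfolding BI_def by (intro sum_mono measure_UNION_le) (use T(2) in auto)
  also have "\<dots> \<le> (\<Sum>j\<le>J. 2 * exp (- D) * exp (- D) ^ j)"
    by (intro sum_mono net_bound bad_prob inc1 inc_v) auto
  also have "\<dots> = 2 * exp (- D) * (\<Sum>j\<le>J. exp (- D) ^ j)" by (simp only: sum_distrib_left)
  also have "\<dots> \<le> 2 * exp (- D) * 2"
  proof (intro mult_left_mono)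
    have "(\<Sum>j\<le>J. exp (- D) ^ j) \<le> 1 / (1 - exp (- D))" using eD D by (intro geometric_partial_sum_le) auto
    also have "\<dots> \<le> 1 / (1/2)" using eD D by (intro divide_left_mono) auto
    finally show "(\<Sum>j\<le>J. exp (- D) ^ j) \<le> 2" by simp
  qed simp
  also have "measure ?M BS \<le> (\<Sum>c\<in>T J. measure ?M (bad (shell s (\<tau> J) c) J))"
    unfolding BS_def using T(2) by (intro measure_UNION_le) auto
  also have "\<dots> \<le> 2 * exp (- D) * exp (- D) ^ J"
    using shell_bounds by (intro net_bound bad_prob shell_v) auto
  also have "\<dots> \<le> 2 * exp (- D) * 1" using D by (intro mult_left_mono power_le_one) auto
  also have "measure ?M BQ \<le> (\<Sum>h\<in>H. measure ?M {X \<in> space ?M. 4 * b \<le> quad n h X})"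
    unfolding BQ_def using H(1) by (intro measure_UNION_le) auto
  also have "\<dots> \<le> (\<Sum>h\<in>H. exp (real n - b))" using H(3) by (intro sum_mono quad_tail)
  also have "\<dots> = real (card H) * exp (- 6 * D)" by (simp add: b_def)
  also have "\<dots> \<le> exp (5 * D) * exp (- 6 * D)"
  proof (intro mult_right_mono)
    have "real (card H) \<le> 128 ^ d" using H(2) by simp
    also have "\<dots> \<le> exp 5 ^ d"
    proof (intro power_mono)
      have "13/8 \<le> exp (1/2::real)" using exp_lower_Taylor_quadratic[of "1/2"] by (simp add: power2_eq_square)
      then have "(13/8)^10 \<le> exp (1/2::real) ^ 10" by (intro power_mono) auto
      then show "128 \<le> exp (5::real)" by (simp add: exp_of_nat_mult[symmetric] power_divide)
    qed simp
    also have "\<dots> = exp (5 * real d)" by (simp add: exp_of_nat_mult[symmetric] mult.commute)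
    also have "\<dots> \<le> exp (5 * D)" using D by simp
    finally show "real (card H) \<le> exp (5 * D)" .
  qed simp
  also have "\<dots> = exp (- D)" by (simp add: exp_add[symmetric])
  finally have Bad: "measure ?M Bad \<le> 7 * exp (- D)" by simp
  define E where "E = space ?M - Bad"
  have E_meas: "E \<in> sets ?M" using Bad_meas by (simp add: E_def)
  have "measure ?M E = 1 - measure ?M Bad" unfolding E_def using Bad_meas by (rule S.prob_compl)
  then have E_prob: "1 - 8 * exp (- D) \<le> measure ?M E" using Bad exp_gt_zero[of "-D"] by linarith
  have main: "\<bar>(\<Sum>i<n. slab s c (X i)) - real n * (\<integral>x. slab s c x \<partial>P)\<bar> \<le> 300 * B"
    if X: "X \<in> E" and c1: "sq_norm d c = 1" for X c
  proof -
    have XM: "X \<in> space ?M" and XB: "X \<notin> Bad" using X by (auto simp: E_def)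
    have g_inc: "dev (inc j c) X \<le> a j" if "j \<le> J" "c \<in> T j" for j c
      using XB XM that unfolding Bad_def bad_def by force
    have g_shell: "dev (shell s (\<tau> J) c) X \<le> a J" if "c \<in> T J" for c
      using XB XM that unfolding Bad_def bad_def by force
    have g_quad: "quad n h X \<le> 3 * (4 * b)" if "sq_norm d h \<le> 1" for h
    proof (rule quad_from_net[OF Hnet _ that])
      fix h' assume "h' \<in> H"
      then show "quad n h' X \<le> 4 * b" using XB XM unfolding Bad_def by force
    qed
    have chain: "c \<in> T j \<Longrightarrow> j \<le> J \<Longrightarrow> dev (slab s c) X \<le> (\<Sum>i\<le>j. a i)" for j c
    proof (induction j arbitrary: c)
      case 0
      then show ?case using g_inc[of 0 c] by (simp add: inc_def)
    next
      case (Suc j)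
      have cS: "c \<in> S" using Suc.prems T(1) by blast
      let ?c' = "\<pi> j c"
      have "dev (slab s ?c') X \<le> (\<Sum>i\<le>j. a i)" using Suc.IH[of ?c'] \<pi>(1)[OF cS] Suc.prems by simp
      moreover have "dev (inc (Suc j) c) X \<le> a (Suc j)" using g_inc Suc.prems by blast
      moreover have "dev (slab s c) X \<le> dev (slab s ?c') X + dev (inc (Suc j) c) X"
      proof -
        have I: "(\<integral>x. inc (Suc j) c x \<partial>P) = (\<integral>x. slab s c x \<partial>P) - (\<integral>x. slab s ?c' x \<partial>P)"
          unfolding inc_def using slab_bounds by (simp, intro Bochner_Integration.integral_diff integrable_bounded) auto
        have S: "(\<Sum>i<n. inc (Suc j) c (X i)) = (\<Sum>i<n. slab s c (X i)) - (\<Sum>i<n. slab s ?c' (X i))"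
          by (simp add: inc_def sum_subtractf)
        show ?thesis unfolding dev_def I S right_diff_distrib by linarith
      qed
      ultimately show ?case by simp
    qed
    have cS: "c \<in> S" using c1 by (simp add: S_def)
    let ?c = "\<pi> J c"
    let ?h = "\<lambda>i. (1 / (\<tau> J)\<^sup>2) * (c i - ?c i)"
    have c': "?c \<in> T J" "sq_norm d (\<lambda>i. c i - ?c i) \<le> ((\<tau> J)\<^sup>2)\<^sup>2" using \<pi>[OF cS] by auto
    have c'1: "sq_norm d ?c = 1" using c' T(1) by (auto simp: S_def)
    have "(\<Sum>i\<le>J. a i) = 40 * B * (\<Sum>i\<le>J. (3/4) ^ i)" unfolding a_def by (simp add: sum_distrib_left)
    also have "\<dots> \<le> 40 * B * (1 / (1 - 3/4))" using B0 by (intro mult_left_mono geometric_partial_sum_le) auto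
    finally have 1: "dev (slab s ?c) X \<le> 160 * B" using chain[OF c'(1)] by simp
    have "a J \<le> 40 * B * 1" unfolding a_def using B0 by (intro mult_left_mono power_le_one) auto
    then have "(\<Sum>i<n. shell s (\<tau> J) ?c (X i)) \<le> real n * (\<integral>x. shell s (\<tau> J) ?c x \<partial>P) + 40 * B"
      using g_shell[OF c'(1)] unfolding dev_def by linarith
    also have "real n * (\<integral>x. shell s (\<tau> J) ?c x \<partial>P) \<le> real n * (2 * \<tau> J)"
      using shell_second_moment(1)[OF c'1 s] \<tau>[of J] by (intro mult_left_mono) auto
    finally have 2: "(\<Sum>i<n. shell s (\<tau> J) ?c (X i)) \<le> 42 * B" using \<tau>J by simp
    have "\<bar>(\<Sum>i<n. slab s c (X i)) - (\<Sum>i<n. slab s ?c (X i))\<bar> \<le> (\<Sum>i<n. \<bar>slab s c (X i) - slab s ?c (X i)\<bar>)"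
      unfolding sum_subtractf[symmetric] by (rule sum_abs)
    also have "\<dots> \<le> (\<Sum>i<n. shell s (\<tau> J) ?c (X i) + (\<tau> J)\<^sup>2 * (\<gamma> (X i) * (proj ?h (X i))\<^sup>2))"
      by (intro sum_mono slab_diff_le \<tau>)
    also have "\<dots> = (\<Sum>i<n. shell s (\<tau> J) ?c (X i)) + (\<tau> J)\<^sup>2 * quad n ?h X"
      by (simp add: sum.distrib quad_def sum_distrib_left)
    also have "\<dots> \<le> 42 * B + 84 * B"
    proof (intro add_mono 2)
      have "quad n ?h X \<le> 3 * (4 * b)" using g_quad sq_norm_rescaled[OF \<tau>(1) c'(2)] by blast
      also have "\<dots> \<le> 84 * real n" using D by (simp add: b_def)
      finally have "(\<tau> J)\<^sup>2 * quad n ?h X \<le> \<tau> J * (84 * real n)"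
        using \<tau>[of J] quad_nonneg by (intro mult_mono) (auto simp: power2_eq_square)
      also have "\<dots> = 84 * (real n * \<tau> J)" by simp
      also have "\<dots> \<le> 84 * B" using \<tau>J by simp
      finally show "(\<tau> J)\<^sup>2 * quad n ?h X \<le> 84 * B" .
    qed
    finally have 3: "\<bar>(\<Sum>i<n. slab s c (X i)) - (\<Sum>i<n. slab s ?c (X i))\<bar> \<le> 126 * B" by simp
    have "\<bar>(\<integral>x. slab s c x \<partial>P) - (\<integral>x. slab s ?c x \<partial>P)\<bar> = \<bar>\<integral>x. slab s c x - slab s ?c x \<partial>P\<bar>"
      using slab_bounds by (subst Bochner_Integration.integral_diff) (auto intro!: integrable_bounded)
    also have "\<dots> \<le> (\<integral>x. \<bar>slab s c x - slab s ?c x\<bar> \<partial>P)" by (rule integral_abs_bound)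
    also have "\<dots> \<le> 6 * \<tau> J" using slab_increment(1)[OF c'1 s \<tau> c'(2)] .
    finally have "real n * \<bar>(\<integral>x. slab s c x \<partial>P) - (\<integral>x. slab s ?c x \<partial>P)\<bar> \<le> real n * (6 * \<tau> J)"
      by (intro mult_left_mono) auto
    then have 4: "\<bar>real n * (\<integral>x. slab s c x \<partial>P) - real n * (\<integral>x. slab s ?c x \<partial>P)\<bar> \<le> 6 * B"
      using \<tau>J by (simp add: right_diff_distrib[symmetric] abs_mult)
    show ?thesis using 1 3 4 B0 unfolding dev_def by linarith
  qed
  show ?thesis using E_meas E_prob main unfolding B_def by blast
qed

end

section \<open>The standard Gaussian law\<close>

abbreviation std_gaussian :: "nat \<Rightarrow> (nat \<Rightarrow> real) measure" where
  "std_gaussian p \<equiv> \<Pi>\<^sub>M i\<in>{..<p}. std_normal_distribution"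

interpretation N: prob_space std_normal_distribution
  by (rule prob_space_normal_density) simp

interpretation N: real_distribution std_normal_distribution
  by (rule real_dist_normal_dist)

lemma prob_space_std_gaussian: "prob_space (std_gaussian p)"
  by (intro prob_space_PiM N.prob_space_axioms)

lemma sets_std_gaussian: "sets (std_gaussian p) = sets (\<Pi>\<^sub>M i\<in>{..<p}. borel)"
  by (intro sets_PiM_cong) auto

lemma meas_component_std_gaussian: "i < p \<Longrightarrow> (\<lambda>z. z i) \<in> borel_measurable (std_gaussian p)"
  unfolding measurable_cong_sets[OF sets_std_gaussian refl] by measurable

lemma meas_ip_std_gaussian: "(\<lambda>z. ip p w z) \<in> borel_measurable (std_gaussian p)"
  unfolding ip_def by (intro borel_measurable_sum borel_measurable_times meas_component_std_gaussian) auto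

lemma distr_component_std_gaussian:
  assumes "i < p" shows "distr (std_gaussian p) borel (\<lambda>z. z i) = std_normal_distribution"
proof -
  have "distr (std_gaussian p) std_normal_distribution (\<lambda>z. z i) = std_normal_distribution"
    using assms by (subst distr_PiM_component) (auto intro: N.prob_space_axioms)
  moreover have "distr (std_gaussian p) std_normal_distribution (\<lambda>z. z i) = distr (std_gaussian p) borel (\<lambda>z. z i)"
    by (rule distr_cong) auto
  ultimately show ?thesis by simp
qed

lemma indep_components_std_gaussian:
  assumes "0 < p"
  shows "prob_space.indep_vars (std_gaussian p) (\<lambda>_. borel) (\<lambda>i z. z i) {..<p}"
proof -
  interpret G: prob_space "std_gaussian p" by (rule prob_space_std_gaussian)
  have "distr (std_gaussian p) (\<Pi>\<^sub>M i\<in>{..<p}. borel) (\<lambda>x. \<lambda>i\<in>{..<p}. x i) = distr (std_gaussian p) (std_gaussian p) (\<lambda>x. x)"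
  proof (rule distr_cong)
    show "sets (\<Pi>\<^sub>M i\<in>{..<p}. borel) = sets (std_gaussian p)" using sets_std_gaussian by simp
    fix x assume "x \<in> space (std_gaussian p)"
    then show "(\<lambda>i\<in>{..<p}. x i) = x" by (auto simp: space_PiM PiE_def extensional_def)
  qed simp
  also have "\<dots> = std_gaussian p" by (simp add: distr_id)
  also have "\<dots> = (\<Pi>\<^sub>M i\<in>{..<p}. distr (std_gaussian p) borel (\<lambda>z. z i))"
    by (intro PiM_cong) (simp_all add: distr_component_std_gaussian)
  finally show ?thesis
    using assms by (subst G.indep_vars_iff_distr_eq_PiM') (auto intro: meas_component_std_gaussian)
qed

text \<open>Vanishing coefficients are removed first: a normal law of variance zero has no density.\<close>

lemma distr_ip_std_gaussian:
  assumes "sq_norm p w = 1"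
  shows "distr (std_gaussian p) borel (\<lambda>z. ip p w z) = std_normal_distribution"
proof -
  interpret G: prob_space "std_gaussian p" by (rule prob_space_std_gaussian)
  define I where "I = {i. i < p \<and> w i \<noteq> 0}"
  have I: "I \<subseteq> {..<p}" "finite I" by (auto simp: I_def)
  have sq: "(\<Sum>i\<in>I. (\<bar>w i\<bar>)\<^sup>2) = 1"
  proof -
    have "(\<Sum>i\<in>I. (\<bar>w i\<bar>)\<^sup>2) = (\<Sum>i<p. w i * w i)"
      by (rule sum.mono_neutral_cong_left) (auto simp: I_def power2_eq_square)
    then show ?thesis using assms by (simp add: ip_def)
  qed
  then have ne: "I \<noteq> {}" by auto
  then have p: "0 < p" using I by auto
  have "G.indep_vars (\<lambda>_. borel) (\<lambda>i z. w i * z i) I"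
    using G.indep_vars_compose2[OF G.indep_vars_subset[OF indep_components_std_gaussian[OF p] I(1)], of "\<lambda>i x. w i * x" "\<lambda>_. borel"]
    by simp
  moreover have "distributed (std_gaussian p) lborel (\<lambda>z. w i * z i) (normal_density 0 \<bar>w i\<bar>)" if "i \<in> I" for i
  proof -
    have "distributed (std_gaussian p) lborel (\<lambda>z. z i) std_normal_density"
      unfolding distributed_def using that I meas_component_std_gaussian[of i p] distr_component_std_gaussian[of i p]
      by (auto simp: distr_def cong: measurable_cong_sets) 
    then have "distributed (std_gaussian p) lborel (\<lambda>z. 0 + w i * z i) (normal_density (0 + w i * 0) (\<bar>w i\<bar> * 1))"
      by (rule G.normal_density_affine) (use that in \<open>auto simp: I_def\<close>)
    then show ?thesis by simp
  qed
  ultimately have "distributed (std_gaussian p) lborel (\<lambda>z. \<Sum>i\<in>I. w i * z i) (normal_density (\<Sum>i\<in>I. 0) (sqrt (\<Sum>i\<in>I. (\<bar>w i\<bar>)\<^sup>2)))"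
    using I ne by (intro G.sum_indep_normal) (auto simp: I_def)
  then have "distr (std_gaussian p) lborel (\<lambda>z. \<Sum>i\<in>I. w i * z i) = std_normal_distribution"
    using sq by (simp add: distributed_def)
  moreover have "(\<Sum>i\<in>I. w i * z i) = ip p w z" for z
    unfolding ip_def by (rule sum.mono_neutral_left) (auto simp: I_def)
  moreover have "distr (std_gaussian p) lborel (\<lambda>z. ip p w z) = distr (std_gaussian p) borel (\<lambda>z. ip p w z)"
    by (rule distr_cong) auto
  ultimately show ?thesis by simp
qed

lemma std_normal_density_le_half: "std_normal_density x \<le> 1 / 2"
proof -
  have "2 \<le> sqrt (2 * pi)" using pi_gt3 by (intro real_le_rsqrt) auto
  then have "1 / sqrt (2 * pi) \<le> 1 / 2" by (intro divide_left_mono) auto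
  moreover have "exp (- x\<^sup>2 / 2) \<le> 1" by simp
  ultimately have "1 / sqrt (2 * pi) * exp (- x\<^sup>2 / 2) \<le> 1 / 2 * 1" by (intro mult_mono) auto
  then show ?thesis by (simp add: std_normal_density_def)
qed

lemma N_interval_le:
  assumes "a \<le> b" shows "N.prob {a..b} \<le> (b - a) / 2"
proof -
  have "emeasure std_normal_distribution {a..b} = (\<integral>\<^sup>+x. ennreal (std_normal_density x) * indicator {a..b} x \<partial>lborel)"
    by (subst emeasure_density) auto
  also have "\<dots> \<le> (\<integral>\<^sup>+x. ennreal (1/2) * indicator {a..b} x \<partial>lborel)"
    by (intro nn_integral_mono mult_right_mono ennreal_leI std_normal_density_le_half) auto
  also have "\<dots> = ennreal (1/2) * ennreal (b - a)"
    using assms by (subst nn_integral_cmult_indicator) auto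
  also have "\<dots> = ennreal ((b - a) / 2)" using assms by (subst ennreal_mult[symmetric]) auto
  finally show ?thesis using assms by (simp add: N.emeasure_eq_measure)
qed

lemma N_interval_ge:
  assumes "0 \<le> a" "a \<le> b" "b \<le> c" shows "std_normal_density c * (b - a) \<le> N.prob {a<..b}"
proof -
  have "ennreal (std_normal_density c * (b - a)) = ennreal (std_normal_density c) * ennreal (b - a)"
    using assms by (intro ennreal_mult) auto
  also have "\<dots> = (\<integral>\<^sup>+x. ennreal (std_normal_density c) * indicator {a<..b} x \<partial>lborel)"
    using assms by (subst nn_integral_cmult_indicator) auto
  also have "\<dots> \<le> (\<integral>\<^sup>+x. ennreal (std_normal_density x) * indicator {a<..b} x \<partial>lborel)"
  proof (intro nn_integral_mono)
    fix x
    have "std_normal_density c \<le> std_normal_density x" if "x \<in> {a<..b}"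
      using that assms unfolding std_normal_density_def
      by (intro mult_left_mono) (auto intro!: power_mono)
    then show "ennreal (std_normal_density c) * indicator {a<..b} x \<le> ennreal (std_normal_density x) * indicator {a<..b} x"
      by (auto simp: indicator_def intro!: ennreal_leI)
  qed
  also have "\<dots> = emeasure std_normal_distribution {a<..b}"
    by (subst emeasure_density) auto
  finally show ?thesis by (simp add: N.emeasure_eq_measure)
qed

definition sym_mass :: "real \<Rightarrow> real" where
  "sym_mass s = N.prob {x. \<bar>x\<bar> \<le> s}"

lemma sym_mass_le: "0 \<le> s \<Longrightarrow> sym_mass s \<le> s"
proof -
  assume "0 \<le> s"
  have "{x. \<bar>x\<bar> \<le> s} = {-s..s}" by auto
  then show ?thesis using N_interval_le[of "-s" s] \<open>0 \<le> s\<close> by (simp add: sym_mass_def)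
qed

lemma sym_mass_mono: "s \<le> t \<Longrightarrow> sym_mass s \<le> sym_mass t"
  unfolding sym_mass_def by (rule N.finite_measure_mono) auto

lemma sym_mass_growth:
  assumes "0 \<le> a" "a \<le> b" "b \<le> c"
  shows "std_normal_density c * (b - a) \<le> sym_mass b - sym_mass a"
proof -
  have "sym_mass a + N.prob {a<..b} = N.prob ({x. \<bar>x\<bar> \<le> a} \<union> {a<..b})"
    unfolding sym_mass_def by (rule N.finite_measure_Union[symmetric]) auto
  also have "\<dots> \<le> sym_mass b" unfolding sym_mass_def using assms by (intro N.finite_measure_mono) auto
  finally show ?thesis using N_interval_ge[OF assms] by linarith
qed

lemma N_shell_le:
  assumes "0 \<le> t" shows "N.prob {x. \<bar>\<bar>x\<bar> - s\<bar> \<le> t} \<le> 2 * t"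
proof -
  have "N.prob {x. \<bar>\<bar>x\<bar> - s\<bar> \<le> t} \<le> N.prob ({s - t..s + t} \<union> {- s - t..- s + t})"
    by (rule N.finite_measure_mono) auto
  also have "\<dots> \<le> N.prob {s - t..s + t} + N.prob {- s - t..- s + t}"
    by (rule measure_Un_le) auto
  also have "\<dots> \<le> t + t"
    using N_interval_le[of "s - t" "s + t"] N_interval_le[of "- s - t" "- s + t"] assms by simp
  finally show ?thesis by simp
qed

lemma sym_mass_4: "15 / 16 \<le> sym_mass 4"
proof -
  have var: "N.variance (\<lambda>x. x) = 1" and ex: "N.expectation (\<lambda>x. x) = 0" and int: "integrable std_normal_distribution (\<lambda>x. x\<^sup>2)"
    using std_normal_distribution_even_moments[of 1] integral_std_normal_distribution_moment_odd[of 1]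
    by (simp_all add: fact_2 numeral_2_eq_2)
  have "N.prob {x \<in> space std_normal_distribution. 4 \<le> \<bar>x - N.expectation (\<lambda>x. x)\<bar>} \<le> N.variance (\<lambda>x. x) / 4\<^sup>2"
    by (rule N.Chebyshev_inequality) (use int in auto)
  then have "N.prob {x. 4 \<le> \<bar>x\<bar>} \<le> 1 / 16" using var ex by simp
  moreover have "1 \<le> N.prob {x. \<bar>x\<bar> \<le> 4} + N.prob {x. 4 \<le> \<bar>x\<bar>}"
  proof -
    have "1 = N.prob ({x. \<bar>x\<bar> \<le> 4} \<union> {x. 4 \<le> \<bar>x\<bar>})"
    proof -
      have "{x. \<bar>x\<bar> \<le> 4} \<union> {x. 4 \<le> \<bar>x\<bar>} = (UNIV :: real set)" by auto
      then show ?thesis using N.prob_space by simp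
    qed
    also have "\<dots> \<le> N.prob {x. \<bar>x\<bar> \<le> 4} + N.prob {x. 4 \<le> \<bar>x\<bar>}" by (rule measure_Un_le) auto
    finally show ?thesis .
  qed
  ultimately show ?thesis by (simp add: sym_mass_def)
qed

text \<open>Multiplying the standard normal density by \<open>exp (x\<^sup>2 / 4)\<close> gives \<open>sqrt 2\<close> times the density of
  variance \<open>2\<close>.\<close>

lemma N_exp_square: "(\<integral>\<^sup>+x. ennreal (exp (x\<^sup>2 / 4) - 1) \<partial>std_normal_distribution) \<le> 1"
proof -
  have eq: "std_normal_density x * exp (x\<^sup>2 / 4) = sqrt 2 * normal_density 0 (sqrt 2) x" for x
  proof -
    have "exp (- x\<^sup>2 / 2) * exp (x\<^sup>2 / 4) = exp (- x\<^sup>2 / 4)" by (simp add: exp_add[symmetric])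
    moreover have "1 / sqrt 2 = sqrt 2 / (2::real)" by (simp add: field_simps)
    ultimately show ?thesis by (simp add: normal_density_def real_sqrt_mult mult.assoc) (simp add: field_simps)
  qed
  have "(\<integral>\<^sup>+x. ennreal (exp (x\<^sup>2 / 4)) \<partial>std_normal_distribution)
      = (\<integral>\<^sup>+x. ennreal (std_normal_density x) * ennreal (exp (x\<^sup>2 / 4)) \<partial>lborel)"
    by (subst nn_integral_density) auto
  also have "\<dots> = (\<integral>\<^sup>+x. ennreal (sqrt 2) * ennreal (normal_density 0 (sqrt 2) x) \<partial>lborel)"
    by (simp only: ennreal_mult[symmetric] exp_ge_zero normal_density_nonneg eq real_sqrt_ge_zero zero_le_numeral)
  also have "\<dots> = ennreal (sqrt 2) * (\<integral>\<^sup>+x. ennreal (normal_density 0 (sqrt 2) x) \<partial>lborel)"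
    by (rule nn_integral_cmult) simp
  also have "(\<integral>\<^sup>+x. ennreal (normal_density 0 (sqrt 2) x) \<partial>lborel) = 1"
    by (subst nn_integral_eq_integral) auto
  finally have 1: "(\<integral>\<^sup>+x. ennreal (exp (x\<^sup>2 / 4)) \<partial>std_normal_distribution) = ennreal (sqrt 2)" by simp
  have "(\<integral>\<^sup>+x. ennreal (exp (x\<^sup>2 / 4)) \<partial>std_normal_distribution)
      = (\<integral>\<^sup>+x. ennreal (exp (x\<^sup>2 / 4) - 1) + 1 \<partial>std_normal_distribution)"
    by (intro nn_integral_cong) (simp add: ennreal_plus[symmetric] flip: ennreal_1)
  also have "\<dots> = (\<integral>\<^sup>+x. ennreal (exp (x\<^sup>2 / 4) - 1) \<partial>std_normal_distribution) + 1"
    by (subst nn_integral_add) (auto simp: N.emeasure_space_1[simplified])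
  finally have "(\<integral>\<^sup>+x. ennreal (exp (x\<^sup>2 / 4) - 1) \<partial>std_normal_distribution) + 1 = ennreal (sqrt 2)" using 1 by simp
  also have "\<dots> \<le> ennreal 2" using sqrt2_less_2 by (intro ennreal_leI) simp
  also have "\<dots> = 1 + 1" by simp
  finally show ?thesis 
    using ennreal_add_left_cancel_le[of 1 "\<integral>\<^sup>+x. ennreal (exp (x\<^sup>2 / 4) - 1) \<partial>std_normal_distribution" 1]
    by (simp add: add.commute)
qed

text \<open>The symmetry of the law is the case \<open>p = 1\<close>, \<open>w = - 1\<close> of the law of a projection.\<close>

lemma cdf_N_eq_sym_mass:
  assumes "0 \<le> s" shows "cdf std_normal_distribution s = (1 + sym_mass s) / 2"
proof -
  have refl: "distr std_normal_distribution borel uminus = std_normal_distribution"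
    using distr_ip_std_gaussian[of 1 "\<lambda>_. -1"] distr_component_std_gaussian[of 0 1] meas_component_std_gaussian[of 0 1]
      distr_distr[of uminus borel borel "\<lambda>z. z 0" "std_gaussian 1"]
    by (simp add: ip_def comp_def)
  have "N.prob {..<-s} = N.prob (uminus -` {s<..} \<inter> space std_normal_distribution)"
    by (rule arg_cong[where f=N.prob]) auto
  also have "\<dots> = measure (distr std_normal_distribution borel uminus) {s<..}"
    by (subst measure_distr) auto
  finally have "N.prob {..<-s} = N.prob {s<..}" using refl by simp
  moreover have "N.prob {s<..} = 1 - cdf std_normal_distribution s"
  proof -
    have "{s<..} = space std_normal_distribution - {..s}" by auto
    then show ?thesis using N.prob_compl[of "{..s}"] by (simp add: cdf_def)
  qed
  moreover have "cdf std_normal_distribution s = N.prob {..<-s} + sym_mass s"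
  proof -
    have "{..s} = {..<-s} \<union> {x. \<bar>x\<bar> \<le> s}" using assms by auto
    then show ?thesis unfolding cdf_def sym_mass_def by (auto intro!: N.finite_measure_Union)
  qed
  ultimately show ?thesis by simp
qed

lemma ex_quartile: "\<exists>s. 0 \<le> s \<and> sym_mass s = 1 / 2"
proof -
  have sing: "N.prob {x} = 0" for x
    using N_interval_le[of x x] measure_nonneg[of std_normal_distribution "{x}"] by simp
  have cont: "isCont (cdf std_normal_distribution) x" for x
    unfolding N.isCont_cdf by (rule sing)
  have "\<exists>s\<ge>0. s \<le> 4 \<and> cdf std_normal_distribution s = 3/4"
  proof (rule IVT)
    show "cdf std_normal_distribution 0 \<le> 3/4"
      using cdf_N_eq_sym_mass[of 0] sym_mass_le[of 0] by simp
    show "3/4 \<le> cdf std_normal_distribution 4"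
      using cdf_N_eq_sym_mass[of 4] sym_mass_4 by simp
  qed (use cont in auto)
  then show ?thesis using cdf_N_eq_sym_mass by force
qed

lemma quartile_unique:
  assumes "0 \<le> s" "0 \<le> t" "sym_mass s = 1 / 2" "sym_mass t = 1 / 2"
  shows "s = t"
proof -
  have "False" if "0 \<le> a" "a < b" "sym_mass a = 1/2" "sym_mass b = 1/2" for a b :: real
  proof -
    have "0 < std_normal_density b * (b - a)" using that by (simp add: normal_density_pos)
    then show False using sym_mass_growth[of a b b] that by simp
  qed
  then show ?thesis using assms by (metis linorder_neqE)
qed

lemma quartile_bounds:
  assumes "0 \<le> s" "sym_mass s = 1 / 2" shows "1 / 5 < s" "s < 4"
proof -
  show "1/5 < s" using sym_mass_le[OF assms(1)] assms(2) by simp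
  show "s < 4" using sym_mass_mono[of 4 s] sym_mass_4 assms(2) by (cases "s < 4") auto
qed

section \<open>Quadratic forms of banded matrices\<close>

text \<open>The starting point \<open>l\<close> is an integer: windows that overlap the ends of \<open>{..<p}\<close> are admitted, so
  that every pair of indices lies in the same number of windows as any other at the same distance.\<close>

definition window :: "int \<Rightarrow> nat \<Rightarrow> (nat \<Rightarrow> real) \<Rightarrow> nat \<Rightarrow> real" where
  "window l w v i = of_bool (l \<le> int i \<and> int i < l + int w) * v i"

lemma card_common_windows:
  assumes "i < p" "j < p" "w \<le> 2 * k"
  shows "card {l \<in> {- int (2 * k)..int p}. (l \<le> int i \<and> int i < l + int w) \<and> (l \<le> int j \<and> int j < l + int w)}
    = nat (int w - \<bar>int i - int j\<bar>)"
proof -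
  have "{l \<in> {- int (2 * k)..int p}. (l \<le> int i \<and> int i < l + int w) \<and> (l \<le> int j \<and> int j < l + int w)}
    = {max (int i) (int j) - int w + 1..min (int i) (int j)}"
    using assms by auto
  moreover have "min (int i) (int j) + 1 - (max (int i) (int j) - int w + 1) = int w - \<bar>int i - int j\<bar>" by linarith
  ultimately show ?thesis by (simp only: card_atLeastAtMost_int)
qed

lemma sum_qform_windows:
  assumes "w \<le> 2 * k"
  shows "(\<Sum>l\<in>{- int (2 * k)..int p}. qform p S (window l w v))
    = (\<Sum>i<p. \<Sum>j<p. v i * v j * S i j * real (nat (int w - \<bar>int i - int j\<bar>)))"
proof -
  let ?L = "{- int (2 * k)..int p}"
  let ?P = "\<lambda>l i. l \<le> int i \<and> int i < l + int w"
  have "(\<Sum>l\<in>?L. qform p S (window l w v))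
      = (\<Sum>i<p. \<Sum>j<p. \<Sum>l\<in>?L. v i * v j * S i j * of_bool (?P l i \<and> ?P l j))"
    unfolding qform_def
    by (subst sum.swap, intro sum.cong refl, subst sum.swap, intro sum.cong refl) (simp add: window_def of_bool_conj)
  also have "\<dots> = (\<Sum>i<p. \<Sum>j<p. v i * v j * S i j * real (nat (int w - \<bar>int i - int j\<bar>)))"
  proof (intro sum.cong refl)
    fix i j assume "i \<in> {..<p}" "j \<in> {..<p}"
    then have "real (nat (int w - \<bar>int i - int j\<bar>)) = (\<Sum>l\<in>?L. of_bool (?P l i \<and> ?P l j))"
      using card_common_windows[of i p j w k] assms by (simp add: of_bool_def sum.If_cases Int_def)
    then show "(\<Sum>l\<in>?L. v i * v j * S i j * of_bool (?P l i \<and> ?P l j))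
      = v i * v j * S i j * real (nat (int w - \<bar>int i - int j\<bar>))"
      by (simp only: sum_distrib_left)
  qed
  finally show ?thesis .
qed

lemma sum_sq_norm_windows:
  assumes "w \<le> 2 * k"
  shows "(\<Sum>l\<in>{- int (2 * k)..int p}. sq_norm p (window l w v)) = real w * sq_norm p v"
proof -
  have id: "sq_norm p u = qform p (\<lambda>i j. of_bool (i = j)) u" for u
    unfolding ip_def qform_def
  proof (rule sum.cong)
    fix i assume "i \<in> {..<p}"
    then have "(\<Sum>j<p. u i * u j * of_bool (i = j)) = (\<Sum>j\<in>{i}. u i * u j * of_bool (i = j))"
      by (intro sum.mono_neutral_right) auto
    then show "u i * u i = (\<Sum>j<p. u i * u j * of_bool (i = j))" by simp
  qed simp
  have "(\<Sum>l\<in>{- int (2 * k)..int p}. sq_norm p (window l w v))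
    = (\<Sum>i<p. \<Sum>j<p. real w * (v i * v j * of_bool (i = j)))"
    unfolding id sum_qform_windows[OF assms] by (intro sum.cong) auto
  also have "\<dots> = real w * sq_norm p v" unfolding id[of v] qform_def by (simp only: sum_distrib_left)
  finally show ?thesis .
qed

text \<open>For entries within the band, \<open>(2 k - |i - j|) - (k - |i - j|) = k\<close>.\<close>

lemma banded_qform_windows:
  assumes "\<And>i j. i < p \<Longrightarrow> j < p \<Longrightarrow> \<bar>int i - int j\<bar> > int k \<Longrightarrow> S i j = 0"
  shows "real k * qform p S v = (\<Sum>l\<in>{- int (2 * k)..int p}. qform p S (window l (2 * k) v))
      - (\<Sum>l\<in>{- int (2 * k)..int p}. qform p S (window l k v))"
proof -
  have "v i * v j * S i j * real (nat (int (2 * k) - \<bar>int i - int j\<bar>))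
      - v i * v j * S i j * real (nat (int k - \<bar>int i - int j\<bar>)) = real k * (v i * v j * S i j)"
    if "i < p" "j < p" for i j
  proof (cases "\<bar>int i - int j\<bar> > int k")
    case True then show ?thesis using assms[OF that] by simp
  next
    case False
    then have "real (nat (int (2 * k) - \<bar>int i - int j\<bar>)) - real (nat (int k - \<bar>int i - int j\<bar>)) = real k"
      by (simp add: of_nat_nat)
    moreover have "\<And>x A B c :: real. A - B = c \<Longrightarrow> x * A - x * B = c * x"
      by (simp add: right_diff_distrib[symmetric])
    ultimately show ?thesis by blast
  qed
  then have "real k * qform p S v = (\<Sum>i<p. \<Sum>j<p. v i * v j * S i j * real (nat (int (2 * k) - \<bar>int i - int j\<bar>))
      - v i * v j * S i j * real (nat (int k - \<bar>int i - int j\<bar>)))"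
    unfolding qform_def sum_distrib_left by (intro sum.cong refl) simp
  also have "\<dots> = (\<Sum>l\<in>{- int (2 * k)..int p}. qform p S (window l (2 * k) v))
      - (\<Sum>l\<in>{- int (2 * k)..int p}. qform p S (window l k v))"
    by (subst (1 2) sum_qform_windows) (simp_all add: sum_subtractf)
  finally show ?thesis .
qed

text \<open>The windows of length \<open>w\<close> cover each index \<open>w\<close> times, so the two families have total squared
  norm \<open>(2 k + k) |v|\<^sup>2\<close>; a window of length \<open>k\<close> is also one of length \<open>2 k\<close>, truncated.\<close>

lemma banded_qform_bound:
  assumes band: "\<And>i j. i < p \<Longrightarrow> j < p \<Longrightarrow> \<bar>int i - int j\<bar> > int k \<Longrightarrow> S i j = 0"
    and k: "0 < k"
    and win: "\<And>l u. \<bar>qform p S (window l (2 * k) u)\<bar> \<le> m * sq_norm p (window l (2 * k) u)"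
  shows "\<bar>qform p S v\<bar> \<le> 3 * m * sq_norm p v"
proof -
  let ?L = "{- int (2 * k)..int p}"
  have win': "\<bar>qform p S (window l k v)\<bar> \<le> m * sq_norm p (window l k v)" for l
  proof -
    have "window l (2 * k) (window l k v) = window l k v" by (auto simp: window_def fun_eq_iff)
    then show ?thesis using win[of l "window l k v"] by simp
  qed
  have "real k * \<bar>qform p S v\<bar> = \<bar>real k * qform p S v\<bar>" by (simp add: abs_mult)
  also have "\<dots> \<le> \<bar>\<Sum>l\<in>?L. qform p S (window l (2 * k) v)\<bar> + \<bar>\<Sum>l\<in>?L. qform p S (window l k v)\<bar>"
    using banded_qform_windows[of p k S v, OF band] by simp
  also have "\<dots> \<le> (\<Sum>l\<in>?L. m * sq_norm p (window l (2 * k) v)) + (\<Sum>l\<in>?L. m * sq_norm p (window l k v))"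
    by (intro add_mono sum_abs[THEN order_trans] sum_mono win win')
  also have "\<dots> = m * (real (2 * k) * sq_norm p v) + m * (real k * sq_norm p v)"
    unfolding sum_distrib_left[symmetric] by (subst (1 2) sum_sq_norm_windows) simp_all
  also have "\<dots> = real k * (3 * m * sq_norm p v)" by (simp add: algebra_simps)
  finally show ?thesis using k by simp
qed

text \<open>Polarisation at \<open>y \<plusminus> |y| u\<close>, where \<open>y = S u\<close>: the difference of the two values of the form is
  \<open>4 |y|\<^sup>3\<close>, and the squared norms of the two vectors add up to \<open>4 |y|\<^sup>2\<close>.\<close>

lemma symmetric_image_norm_le:
  assumes sym: "\<And>i j. i < p \<Longrightarrow> j < p \<Longrightarrow> S i j = S j i"
    and c: "\<And>v. \<bar>qform p S v\<bar> \<le> c * sq_norm p v" and u: "sq_norm p u = 1"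
  shows "sqrt (sq_norm p (\<lambda>i. \<Sum>j<p. S i j * u j)) \<le> c"
proof -
  define y where "y i = (\<Sum>j<p. S i j * u j)" for i
  define s where "s = sqrt (sq_norm p y)"
  have s0: "0 \<le> s" and ss: "s\<^sup>2 = sq_norm p y" by (auto simp: s_def)
  have yu: "(\<Sum>i<p. \<Sum>j<p. y i * u j * S i j) = s\<^sup>2"
    by (simp add: ss ip_def y_def sum_distrib_left algebra_simps)
  have uy: "(\<Sum>i<p. \<Sum>j<p. u i * y j * S i j) = s\<^sup>2"
    unfolding yu[symmetric] by (subst sum.swap, intro sum.cong refl) (auto simp: sym)
  have Q: "qform p S (\<lambda>i. y i + t * u i) = qform p S y + t * (2 * s\<^sup>2) + t\<^sup>2 * qform p S u" for t
  proof -
    have "qform p S (\<lambda>i. y i + t * u i) = qform p S y + t * (\<Sum>i<p. \<Sum>j<p. y i * u j * S i j)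
        + t * (\<Sum>i<p. \<Sum>j<p. u i * y j * S i j) + t\<^sup>2 * qform p S u"
      unfolding qform_def sum_distrib_left sum.distrib[symmetric]
      by (intro sum.cong refl) (simp add: power2_eq_square algebra_simps)
    then show ?thesis using yu uy by simp
  qed
  have N: "sq_norm p (\<lambda>i. y i + t * u i) = s\<^sup>2 + t * (2 * ip p y u) + t\<^sup>2" for t
    using u by (simp only: ip_algebra ip_commute[of p u y] ss) (simp add: power2_eq_square algebra_simps)
  have "4 * s * s\<^sup>2 = qform p S (\<lambda>i. y i + s * u i) - qform p S (\<lambda>i. y i + (- s) * u i)"
    unfolding Q by simp
  also have "\<dots> \<le> c * sq_norm p (\<lambda>i. y i + s * u i) + c * sq_norm p (\<lambda>i. y i + (- s) * u i)"
    using c[of "\<lambda>i. y i + s * u i"] c[of "\<lambda>i. y i + (- s) * u i"] by linarith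
  also have "\<dots> = 4 * c * s\<^sup>2" unfolding N by (simp add: algebra_simps)
  finally have "4 * s * s\<^sup>2 \<le> 4 * c * s\<^sup>2" .
  moreover have "0 \<le> c" using c[of u] u by simp
  ultimately have "s \<le> c" by (cases "s = 0") auto
  then show ?thesis unfolding s_def y_def[abs_def] .
qed

section \<open>Depth in one direction\<close>

text \<open>Thresholds below and above the quartile \<open>z\<close> at which the mass differs from \<open>1/2\<close> by more than the
  contamination and the fluctuation can explain.  At distance \<open>\<eta>\<close> from \<open>z\<close> inside \<open>[0, 4]\<close> the mass
  changes by at least a multiple of \<open>\<eta>\<close>.  For \<open>\<epsilon>\<close> near \<open>1/5\<close> this \<open>\<eta>\<close> may leave the interval; then
  the fixed points \<open>1/5\<close> and \<open>4\<close> serve, whose masses are at most \<open>1/5\<close> and at least \<open>15/16\<close>.\<close>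

lemma thresholds_exist:
  fixes \<epsilon> r z :: real
  assumes "0 \<le> \<epsilon>" "\<epsilon> < 1/5" "0 < r" "r \<le> 1/200" and z: "0 \<le> z" "sym_mass z = 1/2"
  shows "\<exists>a b. 0 \<le> a \<and> 0 \<le> b \<and> b \<le> 4 \<and> z - 2 * (\<epsilon> + 5 * r) / std_normal_density 4 \<le> a
    \<and> b \<le> z + 2 * (\<epsilon> + 5 * r) / std_normal_density 4
    \<and> \<epsilon> + 5 * r < (1 - \<epsilon>) * (1/2 - sym_mass a) \<and> \<epsilon> + 5 * r < (1 - \<epsilon>) * (sym_mass b - 1/2)"
proof -
  let ?k = "std_normal_density 4"
  define \<eta> where "\<eta> = 2 * (\<epsilon> + 5 * r) / ?k"
  have k: "0 < ?k" by (simp add: normal_density_pos)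
  have kn: "?k * \<eta> = 2 * (\<epsilon> + 5 * r)" using k by (simp add: \<eta>_def)
  have \<eta>: "0 < \<eta>" using k assms by (simp add: \<eta>_def)
  have zb: "1/5 < z" "z < 4" using quartile_bounds[OF z] by auto
  \<comment> \<open>With \<open>1 - \<epsilon> > 4/5\<close>: a gap of \<open>3/10\<close> gives \<open>(1 - \<epsilon>) 3/10 > 6/25\<close>, more than \<open>1/5 + 5/200\<close>.\<close>
  have e: "\<epsilon> + 5 * r < (1 - \<epsilon>) * x" if "x \<ge> 3/10 \<or> x \<ge> 2 * (\<epsilon> + 5 * r)" for x
    using that
  proof
    assume "x \<ge> 3/10"
    then have "(1 - \<epsilon>) * (3/10) \<le> (1 - \<epsilon>) * x" using assms by (intro mult_left_mono) auto
    then show ?thesis using assms by simp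
  next
    assume "x \<ge> 2 * (\<epsilon> + 5 * r)"
    then have "(4/5) * (2 * (\<epsilon> + 5 * r)) \<le> (1 - \<epsilon>) * x" using assms by (intro mult_mono) auto
    then show ?thesis using assms by simp
  qed
  have a: "1/2 - sym_mass (max (z - \<eta>) (1/5)) \<ge> 3/10 \<or> 1/2 - sym_mass (max (z - \<eta>) (1/5)) \<ge> 2 * (\<epsilon> + 5 * r)"
  proof (cases "z - \<eta> \<le> 1/5")
    case True
    then show ?thesis using sym_mass_le[of "1/5"] by simp
  next
    case False
    then have "?k * (z - (z - \<eta>)) \<le> sym_mass z - sym_mass (z - \<eta>)"
      using zb \<eta> by (intro sym_mass_growth) auto
    then show ?thesis using False kn z by simp
  qed
  have b: "sym_mass (min (z + \<eta>) 4) - 1/2 \<ge> 3/10 \<or> sym_mass (min (z + \<eta>) 4) - 1/2 \<ge> 2 * (\<epsilon> + 5 * r)"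
  proof (cases "z + \<eta> \<le> 4")
    case False
    then show ?thesis using sym_mass_4 by simp
  next
    case True
    then have "?k * ((z + \<eta>) - z) \<le> sym_mass (z + \<eta>) - sym_mass z"
      using zb \<eta> by (intro sym_mass_growth) auto
    then show ?thesis using True kn z by simp
  qed
  show ?thesis
    using e[OF a] e[OF b] zb \<eta> unfolding \<eta>_def[symmetric]
    by (intro exI[of _ "max (z - \<eta>) (1/5)"] exI[of _ "min (z + \<eta>) 4"]) auto
qed

text \<open>A sample seen along one direction: \<open>x i\<close> is the projection of the \<open>i\<close>-th observation, \<open>g i\<close> its
  clean weight, \<open>\<sigma>\<close> the clean standard deviation.  If \<open>\<sigma> = 0\<close>, then slabs carry no
  information, and the vanishing of the clean projections replaces them.\<close>

locale weighted_direction =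
  fixes n :: nat and g x :: "nat \<Rightarrow> real" and \<sigma> \<epsilon> r z a b :: real
  assumes n: "0 < n" and g: "\<And>i. 0 \<le> g i" "\<And>i. g i \<le> 1" and \<sigma>: "0 \<le> \<sigma>"
    and \<epsilon>: "0 \<le> \<epsilon>" "\<epsilon> < 1/5" and r: "0 < r" "r \<le> 1/200"
    and z: "0 \<le> z" "sym_mass z = 1/2"
    and a: "0 \<le> a" "z - 2 * (\<epsilon> + 5 * r) / std_normal_density 4 \<le> a" "\<epsilon> + 5 * r < (1 - \<epsilon>) * (1/2 - sym_mass a)"
    and b: "0 \<le> b" "b \<le> 4" "b \<le> z + 2 * (\<epsilon> + 5 * r) / std_normal_density 4" "\<epsilon> + 5 * r < (1 - \<epsilon>) * (sym_mass b - 1/2)"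
    and total: "\<bar>(\<Sum>i<n. g i) - real n * (1 - \<epsilon>)\<bar> \<le> real n * r"
    and slabs: "\<And>s. s \<in> {z, a, b} \<Longrightarrow> 0 < \<sigma> \<Longrightarrow>
      \<bar>(\<Sum>i<n. g i * of_bool (\<bar>x i\<bar> \<le> s * \<sigma>)) - real n * ((1 - \<epsilon>) * sym_mass s)\<bar> \<le> real n * r"
    and degenerate: "\<And>i. i < n \<Longrightarrow> \<sigma> = 0 \<Longrightarrow> g i \<noteq> 0 \<Longrightarrow> x i = 0"
begin

lemma abs_le_iff_square: "0 \<le> t \<Longrightarrow> (\<bar>x i\<bar>\<^sup>2 \<le> t\<^sup>2) = (\<bar>x i\<bar> \<le> t)" "0 \<le> t \<Longrightarrow> (t\<^sup>2 \<le> \<bar>x i\<bar>\<^sup>2) = (t \<le> \<bar>x i\<bar>)"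
  using abs_le_square_iff[of "x i" t] abs_le_square_iff[of t "x i"] by auto

lemma count_ge: "(\<Sum>i<n. g i * of_bool (A i)) \<le> (\<Sum>i<n. of_bool (A i))"
  using g by (intro sum_mono) auto

lemma count_le: "(\<Sum>i<n. of_bool (A i)) \<le> (\<Sum>i<n. g i * of_bool (A i)) + real n * (\<epsilon> + r)"
proof -
  have "(\<Sum>i<n. of_bool (A i)) \<le> (\<Sum>i<n. g i * of_bool (A i) + (1 - g i))"
    using g by (intro sum_mono) auto
  also have "\<dots> = (\<Sum>i<n. g i * of_bool (A i)) + (real n - (\<Sum>i<n. g i))"
    by (simp add: sum.distrib sum_subtractf)
  also have "\<dots> \<le> (\<Sum>i<n. g i * of_bool (A i)) + real n * (\<epsilon> + r)"
    using total by (simp add: algebra_simps abs_le_iff)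
  finally show ?thesis .
qed

lemma degenerate_sum:
  assumes "\<sigma> = 0" shows "(\<Sum>i<n. g i * of_bool (A (x i))) = (\<Sum>i<n. g i * of_bool (A 0))"
proof (intro sum.cong refl)
  fix i assume "i \<in> {..<n}"
  then show "g i * of_bool (A (x i)) = g i * of_bool (A 0)"
    using degenerate[of i] assms by (cases "g i = 0") auto
qed

lemma sum_g_compl: "(\<Sum>i<n. g i * of_bool (\<not> A i)) = (\<Sum>i<n. g i) - (\<Sum>i<n. g i * of_bool (A i))"
  unfolding sum_subtractf[symmetric] by (intro sum.cong refl) auto

lemma scaled:
  "real n * ((1 - \<epsilon>) / 2 - 2 * r) = real n / 2 - real n * \<epsilon> / 2 - 2 * (real n * r)"
  "real n * ((1 - \<epsilon>) * (1/2)) = real n / 2 - real n * \<epsilon> / 2"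
  "real n * (\<epsilon> + r) = real n * \<epsilon> + real n * r"
  "real n * (1 - \<epsilon>) = real n - real n * \<epsilon>"
  by (simp_all add: algebra_simps diff_divide_distrib)

lemma scaled_thresholds:
  "real n * \<epsilon> + 5 * (real n * r) < real n / 2 - real n * \<epsilon> / 2 - real n * ((1 - \<epsilon>) * sym_mass a)"
  "real n * \<epsilon> + 5 * (real n * r) < real n * ((1 - \<epsilon>) * sym_mass b) - (real n / 2 - real n * \<epsilon> / 2)"
proof -
  have "real n * (\<epsilon> + 5 * r) < real n * ((1 - \<epsilon>) * (1/2 - sym_mass a))"
    using a(3) n by (intro mult_strict_left_mono) auto
  also have "\<dots> = real n / 2 - real n * \<epsilon> / 2 - real n * ((1 - \<epsilon>) * sym_mass a)"
    by (simp add: algebra_simps diff_divide_distrib)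
  finally show "real n * \<epsilon> + 5 * (real n * r) < real n / 2 - real n * \<epsilon> / 2 - real n * ((1 - \<epsilon>) * sym_mass a)"
    by (simp add: ring_distribs)
  have "real n * (\<epsilon> + 5 * r) < real n * ((1 - \<epsilon>) * (sym_mass b - 1/2))"
    using b(4) n by (intro mult_strict_left_mono) auto
  also have "\<dots> = real n * ((1 - \<epsilon>) * sym_mass b) - (real n / 2 - real n * \<epsilon> / 2)"
    by (simp add: algebra_simps diff_divide_distrib)
  finally show "real n * \<epsilon> + 5 * (real n * r) < real n * ((1 - \<epsilon>) * sym_mass b) - (real n / 2 - real n * \<epsilon> / 2)"
    by (simp add: ring_distribs)
qed

lemma truth_depth:
  shows "real n * ((1 - \<epsilon>) / 2 - 2 * r) \<le> (\<Sum>i<n. of_bool (\<bar>x i\<bar>\<^sup>2 \<le> (z * \<sigma>)\<^sup>2))"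
    and "real n * ((1 - \<epsilon>) / 2 - 2 * r) \<le> (\<Sum>i<n. of_bool (\<bar>x i\<bar>\<^sup>2 \<ge> (z * \<sigma>)\<^sup>2))"
proof -
  have zs: "0 \<le> z * \<sigma>" using z \<sigma> by simp
  have w: "real n * (1 - \<epsilon>) - real n * r \<le> (\<Sum>i<n. g i)" using total by (simp add: abs_le_iff)
  have nr: "0 \<le> real n * r" and ne: "0 \<le> real n * (1 - \<epsilon>)" using r \<epsilon> by auto
  note facts = w[unfolded scaled] nr ne[unfolded scaled]
  have "real n * ((1 - \<epsilon>) / 2 - 2 * r) \<le> (\<Sum>i<n. g i * of_bool (\<bar>x i\<bar> \<le> z * \<sigma>))
    \<and> real n * ((1 - \<epsilon>) / 2 - 2 * r) \<le> (\<Sum>i<n. g i * of_bool (z * \<sigma> \<le> \<bar>x i\<bar>))"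
  proof (cases "\<sigma> = 0")
    case True
    have "(\<Sum>i<n. g i * of_bool (\<bar>x i\<bar> \<le> z * \<sigma>)) = (\<Sum>i<n. g i)"
      using degenerate_sum[OF True, of "\<lambda>t. \<bar>t\<bar> \<le> z * \<sigma>"] True by simp
    moreover have "(\<Sum>i<n. g i * of_bool (z * \<sigma> \<le> \<bar>x i\<bar>)) = (\<Sum>i<n. g i)"
      using True by simp
    ultimately show ?thesis unfolding scaled using facts by linarith
  next
    case False
    then have s: "\<bar>(\<Sum>i<n. g i * of_bool (\<bar>x i\<bar> \<le> z * \<sigma>)) - real n * ((1 - \<epsilon>) * (1/2))\<bar> \<le> real n * r"
      using slabs[of z] \<sigma> z by simp
    have "(\<Sum>i<n. g i) - (\<Sum>i<n. g i * of_bool (\<bar>x i\<bar> \<le> z * \<sigma>)) = (\<Sum>i<n. g i * of_bool (\<not> \<bar>x i\<bar> \<le> z * \<sigma>))"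
      by (rule sum_g_compl[symmetric])
    also have "\<dots> \<le> (\<Sum>i<n. g i * of_bool (z * \<sigma> \<le> \<bar>x i\<bar>))"
      using g by (intro sum_mono mult_left_mono) auto
    finally show ?thesis using s facts unfolding scaled by linarith
  qed
  then show "real n * ((1 - \<epsilon>) / 2 - 2 * r) \<le> (\<Sum>i<n. of_bool (\<bar>x i\<bar>\<^sup>2 \<le> (z * \<sigma>)\<^sup>2))"
    and "real n * ((1 - \<epsilon>) / 2 - 2 * r) \<le> (\<Sum>i<n. of_bool (\<bar>x i\<bar>\<^sup>2 \<ge> (z * \<sigma>)\<^sup>2))"
    unfolding abs_le_iff_square[OF zs]
    using count_ge[of "\<lambda>i. \<bar>x i\<bar> \<le> z * \<sigma>"] count_ge[of "\<lambda>i. z * \<sigma> \<le> \<bar>x i\<bar>"] by linarith+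
qed

text \<open>If \<open>sqrt q\<close> were at most \<open>a \<sigma>\<close>, then at most \<open>(1 - \<epsilon>) sym_mass a + \<epsilon>\<close> of the sample, up to the
  fluctuation \<open>r\<close>, would lie below; if it exceeded \<open>b \<sigma>\<close>, then too few would lie above.  For
  \<open>\<sigma> = 0\<close>, a positive \<open>q\<close> would have only contaminated observations above it.\<close>

lemma deep_value_close:
  assumes q: "0 \<le> q"
    and lo: "real n * ((1 - \<epsilon>) / 2 - 2 * r) \<le> (\<Sum>i<n. of_bool (\<bar>x i\<bar>\<^sup>2 \<le> q))"
    and hi: "real n * ((1 - \<epsilon>) / 2 - 2 * r) \<le> (\<Sum>i<n. of_bool (\<bar>x i\<bar>\<^sup>2 \<ge> q))"
  shows "\<bar>q / z\<^sup>2 - \<sigma>\<^sup>2\<bar> \<le> 2000 / std_normal_density 4 * (\<epsilon> + r) * \<sigma>\<^sup>2"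
proof -
  define t where "t = sqrt q"
  have t: "0 \<le> t" "q = t\<^sup>2" using q by (auto simp: t_def)
  have zb: "1/5 < z" using quartile_bounds[OF z] by simp
  have n0: "0 < real n" using n by simp
  have nr: "0 \<le> real n * r" using r by simp
  have lo': "real n * ((1 - \<epsilon>) / 2 - 2 * r) \<le> (\<Sum>i<n. g i * of_bool (\<bar>x i\<bar> \<le> t)) + real n * (\<epsilon> + r)"
    using lo count_le unfolding t(2) abs_le_iff_square[OF t(1)] by (rule order_trans)
  have hi': "real n * ((1 - \<epsilon>) / 2 - 2 * r) \<le> (\<Sum>i<n. g i * of_bool (t \<le> \<bar>x i\<bar>)) + real n * (\<epsilon> + r)"
    using hi count_le unfolding t(2) abs_le_iff_square[OF t(1)] by (rule order_trans)
  show ?thesis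
  proof (cases "\<sigma> = 0")
    case True
    have "t = 0"
    proof (rule ccontr)
      assume "t \<noteq> 0"
      then have "(\<Sum>i<n. g i * of_bool (t \<le> \<bar>x i\<bar>)) = 0"
        using degenerate_sum[OF True, of "\<lambda>y. t \<le> \<bar>y\<bar>"] t by simp
      then have "(1 - \<epsilon>) / 2 - 2 * r \<le> \<epsilon> + r" using hi' n0 by simp
      then show False using \<epsilon> r by simp
    qed
    then show ?thesis using True t by simp
  next
    case False
    then have s: "0 < \<sigma>" using \<sigma> by simp
    have slab_a: "\<bar>(\<Sum>i<n. g i * of_bool (\<bar>x i\<bar> \<le> a * \<sigma>)) - real n * ((1 - \<epsilon>) * sym_mass a)\<bar> \<le> real n * r"
      and slab_b: "\<bar>(\<Sum>i<n. g i * of_bool (\<bar>x i\<bar> \<le> b * \<sigma>)) - real n * ((1 - \<epsilon>) * sym_mass b)\<bar> \<le> real n * r"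
      by (rule slabs; use s in simp)+
    have at: "a * \<sigma> < t"
    proof (rule ccontr)
      assume "\<not> a * \<sigma> < t"
      then have "(\<Sum>i<n. g i * of_bool (\<bar>x i\<bar> \<le> t)) \<le> (\<Sum>i<n. g i * of_bool (\<bar>x i\<bar> \<le> a * \<sigma>))"
        using g by (intro sum_mono mult_left_mono) auto
      also have "\<dots> \<le> real n * ((1 - \<epsilon>) * sym_mass a) + real n * r" using slab_a by linarith
      finally show False using lo' scaled_thresholds(1) nr unfolding scaled by linarith
    qed
    have tb: "t \<le> b * \<sigma>"
    proof (rule ccontr)
      assume *: "\<not> t \<le> b * \<sigma>"
      have "(\<Sum>i<n. g i * of_bool (t \<le> \<bar>x i\<bar>)) \<le> (\<Sum>i<n. g i * of_bool (\<not> \<bar>x i\<bar> \<le> b * \<sigma>))"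
        using g * by (intro sum_mono mult_left_mono) auto
      also have "\<dots> = (\<Sum>i<n. g i) - (\<Sum>i<n. g i * of_bool (\<bar>x i\<bar> \<le> b * \<sigma>))" by (rule sum_g_compl)
      finally show False using hi' scaled_thresholds(2) total slab_b nr unfolding scaled by linarith
    qed
    define \<tau> where "\<tau> = t / \<sigma>"
    define \<eta> where "\<eta> = 2 * (\<epsilon> + 5 * r) / std_normal_density 4"
    have k: "0 < std_normal_density 4" by (simp add: normal_density_pos)
    have \<tau>: "a < \<tau>" "\<tau> \<le> b" using at tb s by (auto simp: \<tau>_def field_simps)
    then have near: "\<bar>\<tau> - z\<bar> \<le> \<eta>" using a b unfolding \<eta>_def by linarith
    have tp: "0 \<le> \<tau>" using \<tau> a by simp
    have z4: "z < 4" using quartile_bounds[OF z] by simp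
    have "\<bar>\<tau>\<^sup>2 - z\<^sup>2\<bar> = \<bar>\<tau> - z\<bar> * (\<tau> + z)"
      using tp z by (simp add: square_diff_square_factored power2_eq_square abs_mult)
    also have "\<dots> \<le> \<eta> * 8" using near \<tau> b z4 tp z by (intro mult_mono) auto
    finally have 1: "\<bar>\<tau>\<^sup>2 - z\<^sup>2\<bar> \<le> 8 * \<eta>" by simp
    \<comment> \<open>Both \<open>\<tau>\<close> and \<open>z\<close> are below \<open>4\<close>, and \<open>z > 1/5\<close>: relative errors lose the factor \<open>8 / (1/25)\<close>.\<close>
    have z2: "1/25 \<le> z\<^sup>2" using power_mono[of "1/5" z 2] zb by (simp add: power2_eq_square)
    have "q / z\<^sup>2 - \<sigma>\<^sup>2 = (\<tau>\<^sup>2 - z\<^sup>2) / z\<^sup>2 * \<sigma>\<^sup>2"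
      using s zb by (simp add: \<tau>_def t(2) field_simps)
    then have "\<bar>q / z\<^sup>2 - \<sigma>\<^sup>2\<bar> = \<bar>\<tau>\<^sup>2 - z\<^sup>2\<bar> / z\<^sup>2 * \<sigma>\<^sup>2" by (simp add: abs_mult)
    also have "\<dots> \<le> 8 * \<eta> / (1/25) * \<sigma>\<^sup>2"
      using 1 z2 by (intro mult_right_mono frac_le) auto
    also have "\<dots> = 400 / std_normal_density 4 * (\<epsilon> + 5 * r) * \<sigma>\<^sup>2" by (simp add: \<eta>_def)
    also have "\<dots> \<le> 400 / std_normal_density 4 * (5 * (\<epsilon> + r)) * \<sigma>\<^sup>2"
      using \<epsilon> k by (intro mult_right_mono mult_left_mono) auto
    also have "\<dots> = 2000 / std_normal_density 4 * (\<epsilon> + r) * \<sigma>\<^sup>2" by simp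
    finally show ?thesis .
  qed
qed

end

section \<open>Positive semidefinite matrices\<close>

lemma scalar_prod_eq_ip: "v \<in> carrier_vec p \<Longrightarrow> u \<bullet> v = ip p (vec_index u) (vec_index v)"
  by (simp add: scalar_prod_def ip_def atLeast0LessThan)

lemma mult_mat_vec_index:
  "A \<in> carrier_mat p p \<Longrightarrow> v \<in> carrier_vec p \<Longrightarrow> i < p \<Longrightarrow> (A *\<^sub>v v) $ i = (\<Sum>j<p. A $$ (i, j) * v $ j)"
  by (simp add: scalar_prod_def atLeast0LessThan)

lemma quad_form_eq_qform:
  assumes "A \<in> carrier_mat p p" "u \<in> carrier_vec p"
  shows "u \<bullet> (A *\<^sub>v u) = qform p (\<lambda>i j. A $$ (i, j)) (vec_index u)"
proof -
  have "u \<bullet> (A *\<^sub>v u) = (\<Sum>i<p. u $ i * (\<Sum>j<p. A $$ (i, j) * u $ j))"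
    using assms by (simp add: scalar_prod_eq_ip[of _ p] ip_def mult_mat_vec_index del: index_mult_mat_vec)
  then show ?thesis by (simp add: qform_def sum_distrib_left algebra_simps)
qed

lemma psd_carrier: "psd p A \<Longrightarrow> A \<in> carrier_mat p p"
  by (simp add: psd_def)

lemma psd_sym:
  assumes "psd p A" "i < p" "j < p" shows "A $$ (i, j) = A $$ (j, i)"
proof -
  have "transpose_mat A = A" "A \<in> carrier_mat p p" using assms(1) by (auto simp: psd_def)
  moreover from this(2) have "transpose_mat A $$ (i, j) = A $$ (j, i)" using assms(2,3) by simp
  ultimately show ?thesis by simp
qed

lemma psd_qform_nonneg:
  assumes "psd p A" shows "0 \<le> qform p (\<lambda>i j. A $$ (i, j)) v"
proof -
  have "0 \<le> vec p v \<bullet> (A *\<^sub>v vec p v)" using assms by (simp add: psd_def)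
  also have "\<dots> = qform p (\<lambda>i j. A $$ (i, j)) (vec_index (vec p v))"
    using assms by (intro quad_form_eq_qform psd_carrier) auto
  also have "\<dots> = qform p (\<lambda>i j. A $$ (i, j)) v" by (rule qform_cong) auto
  finally show ?thesis .
qed

lemma Gram_factor_mat:
  fixes S :: "nat \<Rightarrow> nat \<Rightarrow> real"
  assumes "\<And>i j. i < p \<Longrightarrow> j < p \<Longrightarrow> S i j = S j i" "\<And>v. 0 \<le> qform p S v"
  shows "\<exists>A\<in>carrier_mat p p. A * transpose_mat A = mat p p (\<lambda>(i, j). S i j)"
proof -
  obtain a where a: "\<forall>i<p. \<forall>j<p. S i j = ip p (a i) (a j)" using psd_Gram_factor[of p S, OF assms] by (rule exE)
  show ?thesis
  proof (intro bexI)
    show "mat p p (\<lambda>(i, j). a i j) \<in> carrier_mat p p" by simp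
    show "mat p p (\<lambda>(i, j). a i j) * transpose_mat (mat p p (\<lambda>(i, j). a i j)) = mat p p (\<lambda>(i, j). S i j)"
      using a by (intro eq_matI) (auto simp: scalar_prod_def ip_def atLeast0LessThan)
  qed
qed

lemma qform_Gram: "(\<And>i j. i < p \<Longrightarrow> j < p \<Longrightarrow> S i j = ip q (a i) (a j)) \<Longrightarrow>
    qform p S u = sq_norm q (\<lambda>x. \<Sum>i<p. u i * a i x)"
  unfolding qform_def ip_sum_left ip_sum_right ip_algebra
  by (intro sum.cong refl) (simp add: ip_sum_right ip_algebra sum_distrib_left mult.assoc)

lemma qform_scale: "qform p S (\<lambda>i. t * v i) = t\<^sup>2 * qform p S v"
  by (simp add: qform_def sum_distrib_left power2_eq_square algebra_simps)

lemma sq_norm_scale: "sq_norm p (\<lambda>i. t * v i) = t\<^sup>2 * sq_norm p v"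
  by (simp only: ip_algebra power2_eq_square mult.assoc)

lemma qform_zero_of_sq_norm_zero:
  assumes "sq_norm p v = 0" shows "qform p S v = 0"
proof -
  have "qform p S v = qform p S (\<lambda>_. 0)" using assms by (intro qform_cong) (auto simp: sq_norm_eq_0_iff)
  then show ?thesis by (simp add: qform_def)
qed

lemma qform_bound_from_unit:
  assumes "\<And>v. sq_norm p v = 1 \<Longrightarrow> \<bar>qform p S v\<bar> \<le> m"
  shows "\<bar>qform p S v\<bar> \<le> m * sq_norm p v"
proof (cases "sq_norm p v = 0")
  case True then show ?thesis by (simp add: qform_zero_of_sq_norm_zero)
next
  case False
  then have pos: "0 < sq_norm p v" by (simp add: less_le)
  define t where "t = 1 / sqrt (sq_norm p v)"
  have t: "t\<^sup>2 * sq_norm p v = 1" using pos by (simp add: t_def power_divide)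
  have "\<bar>qform p S (\<lambda>i. t * v i)\<bar> \<le> m" using t by (intro assms) (simp only: sq_norm_scale)
  then have "t\<^sup>2 * \<bar>qform p S v\<bar> \<le> m" by (simp add: qform_scale abs_mult)
  then have "(t\<^sup>2 * \<bar>qform p S v\<bar>) * sq_norm p v \<le> m * sq_norm p v" using pos by (intro mult_right_mono) auto
  moreover have "(t\<^sup>2 * \<bar>qform p S v\<bar>) * sq_norm p v = (t\<^sup>2 * sq_norm p v) * \<bar>qform p S v\<bar>" by simp
  ultimately show ?thesis using t by simp
qed

lemma sq_norm_mult_le:
  "sq_norm p (\<lambda>i. \<Sum>j<q. C i j * y j) \<le> (\<Sum>i<p. sq_norm q (C i)) * sq_norm q y"
proof -
  have "sq_norm p (\<lambda>i. \<Sum>j<q. C i j * y j) = (\<Sum>i<p. (ip q (C i) y)\<^sup>2)"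
    by (simp add: ip_def power2_eq_square)
  also have "\<dots> \<le> (\<Sum>i<p. sq_norm q (C i) * sq_norm q y)" by (intro sum_mono ip_Cauchy_Schwarz)
  finally show ?thesis by (simp add: sum_distrib_right)
qed

text \<open>If the least value of a positive semidefinite form on the sphere is zero, then the form is
  singular: otherwise a Gram factor would be invertible and bound the form from below.\<close>

lemma qform_lower_bound_of_regular:
  assumes sym: "\<And>i j. i < p \<Longrightarrow> j < p \<Longrightarrow> S i j = S j i" and psd: "\<And>v. 0 \<le> qform p S v"
    and det: "det (mat p p (\<lambda>(i, j). S i j)) \<noteq> 0"
  shows "\<exists>c>0. \<forall>v. sq_norm p v = 1 \<longrightarrow> c \<le> qform p S v"
proof -
  obtain A where A: "A \<in> carrier_mat p p" "A * transpose_mat A = mat p p (\<lambda>(i, j). S i j)"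
    by (rule bexE[OF Gram_factor_mat[of p S, OF sym psd]])
  have At: "transpose_mat A \<in> carrier_mat p p" using A by simp
  have "det A * det (transpose_mat A) \<noteq> 0" using det A det_mult[OF A(1) At] by simp
  then have "transpose_mat A \<in> Units (ring_mat TYPE(real) p ())"
    using At by (intro det_non_zero_imp_unit) auto
  then obtain C where C: "C \<in> carrier_mat p p" "C * transpose_mat A = 1\<^sub>m p"
    unfolding Units_def ring_mat_simps by blast
  define K where "K = (\<Sum>i<p. sq_norm p (\<lambda>j. C $$ (i, j))) + 1"
  have K: "0 < K" unfolding K_def by (intro add_nonneg_pos sum_nonneg) auto
  have "1 / K \<le> qform p S v" if v: "sq_norm p v = 1" for v
  proof -
    let ?y = "\<lambda>x. \<Sum>i<p. v i * A $$ (i, x)"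
    have "S i j = ip p (\<lambda>x. A $$ (i, x)) (\<lambda>x. A $$ (j, x))" if "i < p" "j < p" for i j
    proof -
      have "S i j = (A * transpose_mat A) $$ (i, j)" using A that by simp
      then show ?thesis using A(1) that by (simp add: scalar_prod_def ip_def atLeast0LessThan)
    qed
    then have q: "qform p S v = sq_norm p ?y" by (rule qform_Gram)
    have v_eq: "v i = (\<Sum>j<p. C $$ (i, j) * ?y j)" if i: "i < p" for i
    proof -
      let ?v = "vec p v"
      have "?v = (C * transpose_mat A) *\<^sub>v ?v" using C by simp
      also have "\<dots> = C *\<^sub>v (transpose_mat A *\<^sub>v ?v)" using C At by (intro assoc_mult_mat_vec) auto
      finally have "?v $ i = (C *\<^sub>v (transpose_mat A *\<^sub>v ?v)) $ i" by simp
      also have "\<dots> = (\<Sum>j<p. C $$ (i, j) * (transpose_mat A *\<^sub>v ?v) $ j)"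
        using C At i by (intro mult_mat_vec_index) auto
      also have "\<dots> = (\<Sum>j<p. C $$ (i, j) * ?y j)"
        using A(1) by (intro sum.cong refl) (auto simp: scalar_prod_def atLeast0LessThan mult.commute)
      finally show ?thesis using i by simp
    qed
    have "sq_norm p v = sq_norm p (\<lambda>i. \<Sum>j<p. C $$ (i, j) * ?y j)" by (intro ip_cong v_eq)
    also have "\<dots> \<le> (\<Sum>i<p. sq_norm p (\<lambda>j. C $$ (i, j))) * sq_norm p ?y" by (rule sq_norm_mult_le)
    also have "\<dots> \<le> K * sq_norm p ?y" by (intro mult_right_mono) (auto simp: K_def)
    finally have "1 \<le> K * qform p S v" unfolding v q .
    then show ?thesis using K by (simp add: pos_divide_le_eq mult.commute)
  qed
  then show ?thesis using K by (intro exI[of _ "1 / K"]) auto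
qed

text \<open>The supremum \<open>m\<close> of the form on the sphere is an eigenvalue of \<open>\<Sigma>\<close>, because \<open>m I - \<Sigma>\<close> is
  positive semidefinite without a positive lower bound on the sphere, hence singular.  Then \<open>m\<^sup>2\<close> is
  an eigenvalue of \<open>\<Sigma>\<^sup>T \<Sigma>\<close>.\<close>

lemma qform_le_s_max:
  assumes psd: "psd p \<Sigma>" and p: "0 < p" and M: "s_max \<Sigma> \<le> M"
  shows "qform p (\<lambda>i j. \<Sigma> $$ (i, j)) v \<le> M * sq_norm p v"
proof -
  let ?S = "\<lambda>i j. \<Sigma> $$ (i, j)"
  have car: "\<Sigma> \<in> carrier_mat p p" using psd by (rule psd_carrier)
  define V where "V = qform p ?S ` {v. sq_norm p v = 1}"
  have e0: "sq_norm p (\<lambda>i. of_bool (i = 0)) = 1"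
  proof -
    have "sq_norm p (\<lambda>i. of_bool (i = 0)) = (\<Sum>i\<in>{0::nat}. of_bool (i = 0) * of_bool (i = 0))"
      unfolding ip_def using p by (intro sum.mono_neutral_right) auto
    then show ?thesis by simp
  qed
  then have ne: "V \<noteq> {}" by (auto simp: V_def)
  have bdd: "bdd_above V"
  proof (rule bdd_aboveI)
    fix y assume "y \<in> V"
    then obtain v where v: "sq_norm p v = 1" "y = qform p ?S v" by (auto simp: V_def)
    have v1: "\<bar>v i\<bar> \<le> 1" if "i < p" for i
    proof -
      have "v i * v i \<le> sq_norm p v" unfolding ip_def using that by (intro member_le_sum[of i "{..<p}" "\<lambda>j. v j * v j"]) auto
      then show ?thesis using v by (simp add: abs_square_le_1[symmetric] power2_eq_square)
    qed
    have "y \<le> (\<Sum>i<p. \<Sum>j<p. \<bar>v i * v j * \<Sigma> $$ (i, j)\<bar>)"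
      unfolding v(2) qform_def by (intro sum_mono) (rule abs_ge_self)
    also have "\<dots> \<le> (\<Sum>i<p. \<Sum>j<p. \<bar>\<Sigma> $$ (i, j)\<bar>)"
    proof (intro sum_mono)
      fix i j assume "i \<in> {..<p}" "j \<in> {..<p}"
      then have "\<bar>v i\<bar> * \<bar>v j\<bar> \<le> 1 * 1" using v1 by (intro mult_mono) auto
      then have "\<bar>v i\<bar> * \<bar>v j\<bar> * \<bar>\<Sigma> $$ (i, j)\<bar> \<le> 1 * \<bar>\<Sigma> $$ (i, j)\<bar>" by (intro mult_right_mono) auto
      then show "\<bar>v i * v j * \<Sigma> $$ (i, j)\<bar> \<le> \<bar>\<Sigma> $$ (i, j)\<bar>" by (simp add: abs_mult)
    qed
    finally show "y \<le> (\<Sum>i<p. \<Sum>j<p. \<bar>\<Sigma> $$ (i, j)\<bar>)" .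
  qed
  define m where "m = Sup V"
  have le_m: "qform p ?S v \<le> m" if "sq_norm p v = 1" for v
    unfolding m_def using that bdd by (intro cSup_upper) (auto simp: V_def)
  have m0: "0 \<le> m" by (rule order_trans[OF psd_qform_nonneg[OF psd] le_m[OF e0]])
  have le: "qform p ?S v \<le> m * sq_norm p v" for v
    using qform_bound_from_unit[of p ?S m v] le_m psd_qform_nonneg[OF psd] by (simp add: abs_le_iff)
  define B where "B i j = m * of_bool (i = j) - \<Sigma> $$ (i, j)" for i j
  have qB: "qform p B v = m * sq_norm p v - qform p ?S v" for v
  proof -
    have "(\<Sum>i<p. \<Sum>j<p. v i * v j * (m * of_bool (i = j))) = m * sq_norm p v"
      unfolding ip_def sum_distrib_left
    proof (intro sum.cong refl)
      fix i assume "i \<in> {..<p}"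
      then have "(\<Sum>j<p. v i * v j * (m * of_bool (i = j))) = (\<Sum>j\<in>{i}. v i * v j * (m * of_bool (i = j)))"
        by (intro sum.mono_neutral_right) auto
      then show "(\<Sum>j<p. v i * v j * (m * of_bool (i = j))) = m * (v i * v i)" by simp
    qed
    then show ?thesis by (simp add: qform_def B_def right_diff_distrib sum_subtractf)
  qed
  have "det (mat p p (\<lambda>(i, j). B i j)) = 0"
  proof (rule ccontr)
    assume "det (mat p p (\<lambda>(i, j). B i j)) \<noteq> 0"
    moreover have "B i j = B j i" if "i < p" "j < p" for i j using psd_sym[OF psd that] by (auto simp: B_def)
    moreover have "0 \<le> qform p B v" for v using le[of v] by (simp add: qB)
    ultimately have "\<exists>c>0. \<forall>v. sq_norm p v = 1 \<longrightarrow> c \<le> qform p B v"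
      by (intro qform_lower_bound_of_regular)
    then obtain c where c: "0 < c" "\<forall>v. sq_norm p v = 1 \<longrightarrow> c \<le> qform p B v" by (elim exE conjE)
    have "m \<le> m - c" unfolding m_def
    proof (rule cSup_least[OF ne])
      fix y assume "y \<in> V"
      then obtain v where v: "sq_norm p v = 1" "y = qform p ?S v" by (auto simp: V_def)
      show "y \<le> Sup V - c" using c(2)[rule_format, OF v(1)] v qB[of v] by (simp add: m_def)
    qed
    then show False using c by simp
  qed
  then obtain w where w: "w \<in> carrier_vec p" "w \<noteq> 0\<^sub>v p" "mat p p (\<lambda>(i, j). B i j) *\<^sub>v w = 0\<^sub>v p"
    using det_0_iff_vec_prod_zero[of "mat p p (\<lambda>(i, j). B i j)" p] by auto
  have ev: "\<Sigma> *\<^sub>v w = m \<cdot>\<^sub>v w"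
  proof (rule eq_vecI)
    fix i assume "i < dim_vec (m \<cdot>\<^sub>v w)"
    then have i: "i < p" using w by simp
    have "0 = (mat p p (\<lambda>(i, j). B i j) *\<^sub>v w) $ i" using w(3) i by simp
    also have "\<dots> = (\<Sum>j<p. B i j * w $ j)" using i w by (subst mult_mat_vec_index[of _ p]) auto
    also have "\<dots> = (\<Sum>j<p. m * of_bool (i = j) * w $ j) - (\<Sum>j<p. \<Sigma> $$ (i, j) * w $ j)"
      by (simp only: B_def left_diff_distrib sum_subtractf)
    also have "(\<Sum>j<p. m * of_bool (i = j) * w $ j) = (\<Sum>j\<in>{i}. m * of_bool (i = j) * w $ j)"
      using i by (intro sum.mono_neutral_right) auto
    also have "(\<Sum>j<p. \<Sigma> $$ (i, j) * w $ j) = (\<Sigma> *\<^sub>v w) $ i"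
      using car w i by (subst mult_mat_vec_index[of _ p]) auto
    finally show "(\<Sigma> *\<^sub>v w) $ i = (m \<cdot>\<^sub>v w) $ i" using i w by simp
  qed (use car w in auto)
  have tr: "transpose_mat \<Sigma> = \<Sigma>" using psd by (simp add: psd_def)
  have "(transpose_mat \<Sigma> * \<Sigma>) *\<^sub>v w = \<Sigma> *\<^sub>v (\<Sigma> *\<^sub>v w)"
    unfolding tr using car w by (intro assoc_mult_mat_vec) auto
  also have "\<dots> = m \<cdot>\<^sub>v (m \<cdot>\<^sub>v w)" unfolding ev using car w ev by (simp add: mult_mat_vec)
  also have "\<dots> = (m * m) \<cdot>\<^sub>v w" by (simp add: smult_smult_assoc)
  finally have "eigenvector (transpose_mat \<Sigma> * \<Sigma>) w (m * m)"
    using car w by (simp add: eigenvector_def)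
  then have "m * m \<in> spectrum (transpose_mat \<Sigma> * \<Sigma>)" by (auto simp: spectrum_def eigenvalue_def)
  moreover have "finite (spectrum (transpose_mat \<Sigma> * \<Sigma>))" using car by (intro card_finite_spectrum[of _ p]) simp
  ultimately have "sqrt (m * m) \<le> s_max \<Sigma>" unfolding s_max_def by (intro Max_ge finite_imageI imageI)
  then have "m \<le> M" using m0 M by simp
  then have "m * sq_norm p v \<le> M * sq_norm p v" by (intro mult_right_mono) auto
  then show ?thesis using le[of v] by linarith
qed

section \<open>The operator norm and the test directions\<close>

lemma unit_sphere_nonempty: "0 < p \<Longrightarrow> unit_vec p 0 \<in> unit_sphere p"
  by (simp add: unit_sphere_def)

lemma op_norm_bounds:
  assumes B: "B \<in> carrier_mat p p" and p: "0 < p"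
    and sym: "\<And>i j. i < p \<Longrightarrow> j < p \<Longrightarrow> B $$ (i, j) = B $$ (j, i)"
    and c: "\<And>v. \<bar>qform p (\<lambda>i j. B $$ (i, j)) v\<bar> \<le> c * sq_norm p v"
  shows "0 \<le> op_norm B" "op_norm B \<le> c"
proof -
  let ?f = "\<lambda>u. sqrt ((B *\<^sub>v u) \<bullet> (B *\<^sub>v u))"
  have dim: "dim_col B = p" using B by simp
  have le: "?f u \<le> c" if "u \<in> unit_sphere p" for u
  proof -
    have u: "u \<in> carrier_vec p" "sq_norm p (vec_index u) = 1"
      using that by (auto simp: unit_sphere_def scalar_prod_eq_ip)
    have "(B *\<^sub>v u) \<bullet> (B *\<^sub>v u) = sq_norm p (vec_index (B *\<^sub>v u))" using B u by (intro scalar_prod_eq_ip mult_mat_vec_carrier)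
    also have "\<dots> = sq_norm p (\<lambda>i. \<Sum>j<p. B $$ (i, j) * u $ j)"
      using B u by (intro ip_cong mult_mat_vec_index) auto
    finally show ?thesis using symmetric_image_norm_le[of p "\<lambda>i j. B $$ (i, j)" c "vec_index u"] sym c u by simp
  qed
  have bdd: "bdd_above (?f ` unit_sphere p)" using le by (intro bdd_aboveI2) auto
  show "op_norm B \<le> c" unfolding op_norm_def dim
    using unit_sphere_nonempty[OF p] le by (intro cSUP_least) auto
  have "0 \<le> ?f (unit_vec p 0)" using B by (auto simp: scalar_prod_eq_ip[of _ p])
  also have "\<dots> \<le> op_norm B" unfolding op_norm_def dim
    using unit_sphere_nonempty[OF p] bdd by (intro cSUP_upper)
  finally show "0 \<le> op_norm B" .
qed

text \<open>A window that overlaps an end of the index range is moved inside; the support of the vector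
  stays in it.\<close>

lemma window_direction_in_U_dirs:
  assumes p: "0 < p" and w: "sq_norm p (window l (2 * k) v) = 1"
  shows "vec p (window l (2 * k) v) \<in> U_dirs p k"
proof -
  let ?u = "vec p (window l (2 * k) v)"
  have sph: "?u \<in> unit_sphere p"
  proof -
    have "?u \<bullet> ?u = sq_norm p (vec_index ?u)" by (rule scalar_prod_eq_ip) simp
    also have "\<dots> = sq_norm p (window l (2 * k) v)" by (rule ip_cong) auto
    finally show ?thesis using w by (simp add: unit_sphere_def)
  qed
  show ?thesis
  proof (cases "2 * k \<le> p")
    case False then show ?thesis using sph by (simp add: U_dirs_def)
  next
    case True
    define l' where "l' = nat (min (max l 0) (int p - int (2 * k)))"
    have "l' \<in> {0..p - 2 * k}" using True unfolding l'_def by auto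
    moreover have "?u \<in> V_dirs p {l'..<l' + 2 * k}"
    proof -
      have "window l (2 * k) v i = 0" if "i < p" "i \<notin> {l'..<l' + 2 * k}" for i
        using that True unfolding window_def l'_def by auto
      then show ?thesis using sph by (auto simp: V_dirs_def)
    qed
    ultimately show ?thesis using True by (auto simp: U_dirs_def)
  qed
qed

lemma op_norm_le_U_dirs:
  assumes B: "B \<in> carrier_mat p p" and p: "0 < p" and k: "0 < k"
    and sym: "\<And>i j. i < p \<Longrightarrow> j < p \<Longrightarrow> B $$ (i, j) = B $$ (j, i)"
    and band: "\<And>i j. i < p \<Longrightarrow> j < p \<Longrightarrow> \<bar>int i - int j\<bar> > int k \<Longrightarrow> B $$ (i, j) = 0"
    and m: "\<And>u. u \<in> U_dirs p k \<Longrightarrow> \<bar>qform p (\<lambda>i j. B $$ (i, j)) (vec_index u)\<bar> \<le> m"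
  shows "0 \<le> op_norm B" "op_norm B \<le> 3 * m"
proof -
  let ?S = "\<lambda>i j. B $$ (i, j)"
  have win: "\<bar>qform p ?S (window l (2 * k) u)\<bar> \<le> m * sq_norm p (window l (2 * k) u)" for l u
  proof (cases "sq_norm p (window l (2 * k) u) = 0")
    case True then show ?thesis by (simp add: qform_zero_of_sq_norm_zero)
  next
    case False
    let ?w = "window l (2 * k) u"
    have pos: "0 < sq_norm p ?w" using False by (simp add: less_le)
    define t where "t = 1 / sqrt (sq_norm p ?w)"
    have t: "t\<^sup>2 * sq_norm p ?w = 1" using pos by (simp add: t_def power_divide)
    have tw: "window l (2 * k) (\<lambda>i. t * u i) = (\<lambda>i. t * ?w i)" by (auto simp: window_def)
    have "vec p (\<lambda>i. t * ?w i) \<in> U_dirs p k"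
      unfolding tw[symmetric] using p by (rule window_direction_in_U_dirs) (simp only: tw sq_norm_scale t)
    then have "\<bar>qform p ?S (vec_index (vec p (\<lambda>i. t * ?w i)))\<bar> \<le> m" by (rule m)
    also have "qform p ?S (vec_index (vec p (\<lambda>i. t * ?w i))) = qform p ?S (\<lambda>i. t * ?w i)" by (rule qform_cong) auto
    finally have "t\<^sup>2 * \<bar>qform p ?S ?w\<bar> \<le> m" by (simp add: qform_scale abs_mult)
    then have "(t\<^sup>2 * \<bar>qform p ?S ?w\<bar>) * sq_norm p ?w \<le> m * sq_norm p ?w" using pos by (intro mult_right_mono) auto
    moreover have "(t\<^sup>2 * \<bar>qform p ?S ?w\<bar>) * sq_norm p ?w = (t\<^sup>2 * sq_norm p ?w) * \<bar>qform p ?S ?w\<bar>" by simp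
    ultimately show ?thesis using t by simp
  qed
  have c: "\<bar>qform p ?S v\<bar> \<le> 3 * m * sq_norm p v" for v
    by (rule banded_qform_bound[OF band k win])
  show "0 \<le> op_norm B" "op_norm B \<le> 3 * m" using op_norm_bounds[OF B p sym c] by auto
qed

lemma U_dirs_nonempty: "0 < p \<Longrightarrow> 0 < k \<Longrightarrow> U_dirs p k \<noteq> {}"
proof -
  assume pk: "0 < p" "0 < k"
  have w: "window 0 (2 * k) (\<lambda>i. of_bool (i = 0)) i = of_bool (i = 0)" for i using pk by (auto simp: window_def)
  have "sq_norm p (window 0 (2 * k) (\<lambda>i. of_bool (i = 0))) = (\<Sum>i\<in>{0::nat}. of_bool (i = 0) * of_bool (i = 0))"
    unfolding ip_def w using pk by (intro sum.mono_neutral_right) auto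
  then have "vec p (window 0 (2 * k) (\<lambda>i. of_bool (i = 0))) \<in> U_dirs p k"
    using pk by (intro window_direction_in_U_dirs) auto
  then show ?thesis by blast
qed

section \<open>Matrix depth as a pair of counts\<close>

definition count_below :: "nat \<Rightarrow> real mat \<Rightarrow> (nat \<Rightarrow> real vec) \<Rightarrow> real vec \<Rightarrow> real" where
  "count_below n \<Gamma> X u = (\<Sum>i<n. of_bool (\<bar>u \<bullet> X i\<bar>\<^sup>2 \<le> u \<bullet> (\<Gamma> *\<^sub>v u)))"

definition count_above :: "nat \<Rightarrow> real mat \<Rightarrow> (nat \<Rightarrow> real vec) \<Rightarrow> real vec \<Rightarrow> real" where
  "count_above n \<Gamma> X u = (\<Sum>i<n. of_bool (\<bar>u \<bullet> X i\<bar>\<^sup>2 \<ge> u \<bullet> (\<Gamma> *\<^sub>v u)))"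

lemma sum_of_bool_in_range: "(\<Sum>i<n. of_bool (A i) :: real) \<in> real ` {..n}"
proof -
  have "(\<Sum>i<n. of_bool (A i) :: real) = real (card {i\<in>{..<n}. A i})"
    by (simp add: of_bool_def sum.If_cases Int_def)
  moreover have "card {i\<in>{..<n}. A i} \<le> n" using card_mono[of "{..<n}" "{i\<in>{..<n}. A i}"] by fastforce
  ultimately show ?thesis by blast
qed

lemma finite_depth_values:
  "finite ((\<lambda>u. min (1 / real n * count_below n \<Gamma> X u) (1 / real n * count_above n \<Gamma> X u)) ` U)"
proof (rule finite_subset)
  let ?V = "(\<lambda>c. 1 / real n * c) ` (real ` {..n})"
  have "1 / real n * count_below n \<Gamma> X u \<in> ?V" "1 / real n * count_above n \<Gamma> X u \<in> ?V" for u
    unfolding count_below_def count_above_def by (intro imageI sum_of_bool_in_range)+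
  then show "(\<lambda>u. min (1 / real n * count_below n \<Gamma> X u) (1 / real n * count_above n \<Gamma> X u)) ` U \<subseteq> ?V"
    unfolding min_def by (intro image_subsetI) (rule if_split[THEN iffD2], blast)
qed simp

lemma matrix_depth_eq: "matrix_depth U n \<Gamma> X =
    Min ((\<lambda>u. min (1 / real n * count_below n \<Gamma> X u) (1 / real n * count_above n \<Gamma> X u)) ` U)"
  by (simp add: matrix_depth_def count_below_def count_above_def)

lemma matrix_depth_geI:
  assumes "0 < n" "U \<noteq> {}" "\<And>u. u \<in> U \<Longrightarrow> real n * c \<le> count_below n \<Gamma> X u" "\<And>u. u \<in> U \<Longrightarrow> real n * c \<le> count_above n \<Gamma> X u"
  shows "c \<le> matrix_depth U n \<Gamma> X"
  unfolding matrix_depth_eq using assms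
  by (intro Min.boundedI finite_depth_values) (auto simp: field_simps)

lemma matrix_depth_le:
  assumes "0 < n" "u \<in> U" "c \<le> matrix_depth U n \<Gamma> X"
  shows "real n * c \<le> count_below n \<Gamma> X u" "real n * c \<le> count_above n \<Gamma> X u"
proof -
  have "matrix_depth U n \<Gamma> X \<le> min (1 / real n * count_below n \<Gamma> X u) (1 / real n * count_above n \<Gamma> X u)"
    unfolding matrix_depth_eq using assms by (intro Min_le finite_depth_values) auto
  then have "c \<le> 1 / real n * count_below n \<Gamma> X u" "c \<le> 1 / real n * count_above n \<Gamma> X u"
    using assms(3) by auto
  then show "real n * c \<le> count_below n \<Gamma> X u" "real n * c \<le> count_above n \<Gamma> X u"
    using assms(1) by (auto simp: field_simps)
qed

section \<open>Gaussian vectors\<close>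

lemma space_borel_vec [simp]: "space (borel_vec p) = carrier_vec p"
  by (simp add: borel_vec_def)

lemma meas_vec_index: "i < p \<Longrightarrow> (\<lambda>v. v $ i) \<in> borel_measurable (borel_vec p)"
proof -
  assume i: "i < p"
  have 1: "(\<lambda>v. \<lambda>i\<in>{..<p}. v $ i) \<in> borel_vec p \<rightarrow>\<^sub>M (\<Pi>\<^sub>M i\<in>{..<p}. (borel :: real measure))"
    unfolding borel_vec_def by (rule measurable_vimage_algebra1) (auto simp: space_PiM)
  have 2: "(\<lambda>x. x i) \<in> (\<Pi>\<^sub>M i\<in>{..<p}. (borel :: real measure)) \<rightarrow>\<^sub>M borel"
    using i by (intro measurable_component_singleton) simp
  from measurable_compose[OF 1 2] show ?thesis using i by simp
qed

lemma meas_into_borel_vec: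
  assumes "\<And>x. x \<in> space M \<Longrightarrow> f x \<in> carrier_vec p" "\<And>i. i < p \<Longrightarrow> (\<lambda>x. f x $ i) \<in> borel_measurable M"
  shows "f \<in> M \<rightarrow>\<^sub>M borel_vec p"
  unfolding borel_vec_def using assms
  by (intro measurable_vimage_algebra2 measurable_restrict) auto

lemma gaussian_vec_factor:
  assumes "psd p \<Sigma>"
  obtains A where "A \<in> carrier_mat p p" "A * transpose_mat A = \<Sigma>"
    "gaussian_vec p \<Sigma> = distr (std_gaussian p) (borel_vec p) (\<lambda>z. A *\<^sub>v vec p z)"
proof -
  have "\<exists>A\<in>carrier_mat p p. A * transpose_mat A = mat p p (\<lambda>(i, j). \<Sigma> $$ (i, j))"
    by (rule Gram_factor_mat) (auto intro: psd_sym[OF assms] psd_qform_nonneg[OF assms])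
  moreover have "mat p p (\<lambda>(i, j). \<Sigma> $$ (i, j)) = \<Sigma>" using psd_carrier[OF assms] by (intro eq_matI) auto
  ultimately have ex: "\<exists>A. A \<in> carrier_mat p p \<and> A * transpose_mat A = \<Sigma>" by auto
  let ?A = "SOME A. A \<in> carrier_mat p p \<and> A * transpose_mat A = \<Sigma>"
  show thesis
    by (rule that[of ?A]) (use someI_ex[OF ex] in \<open>auto simp: gaussian_vec_def Let_def\<close>)
qed

lemma meas_linear_image:
  assumes "A \<in> carrier_mat p p"
  shows "(\<lambda>z. A *\<^sub>v vec p z) \<in> std_gaussian p \<rightarrow>\<^sub>M borel_vec p"
proof (rule meas_into_borel_vec)
  fix i assume i: "i < p"
  have "(A *\<^sub>v vec p z) $ i = ip p (\<lambda>j. A $$ (i, j)) z" for z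
    using assms i by (subst mult_mat_vec_index[of _ p]) (auto simp: ip_def)
  then show "(\<lambda>z. (A *\<^sub>v vec p z) $ i) \<in> borel_measurable (std_gaussian p)"
    using meas_ip_std_gaussian by simp
qed (use assms in auto)

section \<open>The clean weight of a contaminated law\<close>

lemma space_mixture [simp]: "space (mixture \<epsilon> N Q) = space N"
  by (simp add: mixture_def)

lemma sets_mixture [simp]: "sets (mixture \<epsilon> N Q) = sets N"
  by (simp add: mixture_def)

lemma emeasure_mixture:
  assumes "sets Q = sets N" "A \<in> sets N"
  shows "emeasure (mixture \<epsilon> N Q) A = ennreal (1 - \<epsilon>) * emeasure N A + ennreal \<epsilon> * emeasure Q A"
  unfolding mixture_def
proof (rule emeasure_measure_of_sigma)
  show "sigma_algebra (space N) (sets N)" by (rule sets.sigma_algebra_axioms)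
  show "positive (sets N) (\<lambda>S. ennreal (1 - \<epsilon>) * emeasure N S + ennreal \<epsilon> * emeasure Q S)"
    by (simp add: positive_def)
  show "countably_additive (sets N) (\<lambda>S. ennreal (1 - \<epsilon>) * emeasure N S + ennreal \<epsilon> * emeasure Q S)"
  proof (rule countably_additiveI)
    fix F :: "nat \<Rightarrow> _ set" assume F: "range F \<subseteq> sets N" "disjoint_family F" "(\<Union>i. F i) \<in> sets N"
    have N: "(\<Sum>i. emeasure N (F i)) = emeasure N (\<Union>i. F i)" using F by (intro suminf_emeasure)
    have Q: "(\<Sum>i. emeasure Q (F i)) = emeasure Q (\<Union>i. F i)" using F assms by (intro suminf_emeasure) auto
    have "(\<Sum>i. ennreal (1 - \<epsilon>) * emeasure N (F i) + ennreal \<epsilon> * emeasure Q (F i))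
        = (\<Sum>i. ennreal (1 - \<epsilon>) * emeasure N (F i)) + (\<Sum>i. ennreal \<epsilon> * emeasure Q (F i))"
      by (rule suminf_add[symmetric]) auto
    then show "(\<Sum>i. ennreal (1 - \<epsilon>) * emeasure N (F i) + ennreal \<epsilon> * emeasure Q (F i))
        = ennreal (1 - \<epsilon>) * emeasure N (\<Union>i. F i) + ennreal \<epsilon> * emeasure Q (\<Union>i. F i)"
      using N Q by simp
  qed
qed (use assms in auto)

lemma prob_space_mixture:
  assumes "prob_space N" "prob_space Q" "sets Q = sets N" "0 \<le> \<epsilon>" "\<epsilon> \<le> 1"
  shows "prob_space (mixture \<epsilon> N Q)"
proof (rule prob_spaceI)
  have "emeasure Q (space N) = 1"
    using prob_space.emeasure_space_1[OF assms(2)] sets_eq_imp_space_eq[OF assms(3)] by simp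
  then have "emeasure (mixture \<epsilon> N Q) (space N) = ennreal (1 - \<epsilon>) + ennreal \<epsilon>"
    using assms(1,3) by (simp add: emeasure_mixture prob_space.emeasure_space_1)
  also have "\<dots> = ennreal 1" using assms by (subst ennreal_plus[symmetric]) auto
  finally show "emeasure (mixture \<epsilon> N Q) (space (mixture \<epsilon> N Q)) = 1" by simp
qed

text \<open>On \<open>{g > 1}\<close> the hypothesis forces the integral of \<open>g - 1\<close> to vanish; finiteness of \<open>P\<close> allows
  the cancellation.\<close>

lemma density_le_1_AE:
  assumes P: "prob_space P" and g[measurable]: "g \<in> borel_measurable P"
    and le: "\<And>A. A \<in> sets P \<Longrightarrow> (\<integral>\<^sup>+x. g x * indicator A x \<partial>P) \<le> emeasure P A"
  shows "AE x in P. g x \<le> (1::ennreal)"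
proof -
  interpret P: prob_space P by fact
  define A where "A = {x \<in> space P. 1 < g x}"
  have A[measurable]: "A \<in> sets P" unfolding A_def by measurable
  have "(\<integral>\<^sup>+x. (g x - 1) * indicator A x \<partial>P) + emeasure P A = (\<integral>\<^sup>+x. (g x - 1) * indicator A x + indicator A x \<partial>P)"
    by (subst nn_integral_add) auto
  also have "\<dots> = (\<integral>\<^sup>+x. g x * indicator A x \<partial>P)"
    by (intro nn_integral_cong) (auto simp: indicator_def A_def diff_add_cancel_ennreal less_imp_le)
  also have "\<dots> \<le> 0 + emeasure P A" using le[OF A] by simp
  finally have "(\<integral>\<^sup>+x. (g x - 1) * indicator A x \<partial>P) = 0"
    by (subst (asm) (1 2) add.commute) (simp add: ennreal_add_left_cancel_le)
  then have "AE x in P. (g x - 1) * indicator A x = 0"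
    by (subst (asm) nn_integral_0_iff_AE) auto
  then show ?thesis
  proof (rule AE_mp, intro AE_I2 impI)
    fix x assume x: "x \<in> space P" "(g x - 1) * indicator A x = 0"
    show "g x \<le> 1"
    proof (rule ccontr)
      assume "\<not> g x \<le> 1"
      then have "x \<in> A" "1 < g x" using x by (auto simp: A_def)
      then have "g x - 1 = 0" using x by simp
      then have "g x \<le> 1" by (simp add: diff_eq_0_iff_ennreal)
      then show False using \<open>1 < g x\<close> by simp
    qed
  qed
qed

text \<open>The conditional probability that an observation is clean, given its value: the Radon--Nikodym
  density of \<open>(1 - \<epsilon>) N\<close> with respect to the mixture.  It may be set to zero off any set \<open>G\<close> that
  carries \<open>N\<close>; below, \<open>G\<close> is the set where the linear relations between the coordinates hold that a
  singular covariance matrix imposes.\<close>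

lemma mixture_weight:
  assumes N: "prob_space N" and Q: "prob_space Q" "sets Q = sets N" and \<epsilon>: "0 \<le> \<epsilon>" "\<epsilon> \<le> 1"
    and G: "G \<in> sets N" "AE x in N. x \<in> G"
  shows "\<exists>\<gamma>\<in>borel_measurable N. (\<forall>x. 0 \<le> \<gamma> x \<and> \<gamma> x \<le> (1::real)) \<and> (\<forall>x. x \<notin> G \<longrightarrow> \<gamma> x = 0) \<and>
    (\<forall>f\<in>borel_measurable N. (\<integral>\<^sup>+x. ennreal (\<gamma> x) * f x \<partial>mixture \<epsilon> N Q) = ennreal (1 - \<epsilon>) * (\<integral>\<^sup>+x. f x \<partial>N))"
proof -
  let ?P = "mixture \<epsilon> N Q"
  interpret P: prob_space ?P by (rule prob_space_mixture[OF N Q \<epsilon>])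
  define N1 where "N1 = scale_measure (ennreal (1 - \<epsilon>)) N"
  have le: "emeasure N1 A \<le> emeasure ?P A" if "A \<in> sets N" for A
    using that by (simp add: N1_def emeasure_mixture[OF Q(2)])
  have "absolutely_continuous ?P N1"
  proof (unfold absolutely_continuous_def, rule subsetI)
    fix A assume "A \<in> null_sets ?P"
    then have "A \<in> sets N" "emeasure ?P A = 0" by auto
    then show "A \<in> null_sets N1" using le[of A] by (auto simp: null_sets_def N1_def)
  qed
  then obtain g where g: "g \<in> borel_measurable ?P" and dens: "density ?P g = N1"
    using P.Radon_Nikodym[of N1] by (auto simp: N1_def)
  have gN[measurable]: "g \<in> borel_measurable N" using g unfolding measurable_cong_sets[OF sets_mixture refl] .
  have g1: "AE x in ?P. g x \<le> 1"
  proof (rule density_le_1_AE[OF P.prob_space_axioms g])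
    fix A assume A: "A \<in> sets ?P"
    have "(\<integral>\<^sup>+x. g x * indicator A x \<partial>?P) = emeasure (density ?P g) A"
      using A g by (simp add: emeasure_density)
    then show "(\<integral>\<^sup>+x. g x * indicator A x \<partial>?P) \<le> emeasure ?P A" using le[of A] A dens by simp
  qed
  define \<gamma> where "\<gamma> x = enn2real (min 1 (g x)) * indicator G x" for x
  have \<gamma>1: "enn2real (min 1 (g x)) \<le> 1" for x
  proof -
    have "enn2real (min 1 (g x)) \<le> enn2real 1" by (intro enn2real_mono) auto
    then show ?thesis by simp
  qed
  have int: "(\<integral>\<^sup>+x. ennreal (\<gamma> x) * f x \<partial>?P) = ennreal (1 - \<epsilon>) * (\<integral>\<^sup>+x. f x \<partial>N)"
    if f[measurable]: "f \<in> borel_measurable N" for f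
  proof -
    have "(\<integral>\<^sup>+x. ennreal (\<gamma> x) * f x \<partial>?P) = (\<integral>\<^sup>+x. g x * (f x * indicator G x) \<partial>?P)"
    proof (rule nn_integral_cong_AE, use g1 in eventually_elim)
      fix x assume "g x \<le> 1"
      moreover from this have "ennreal (enn2real (g x)) = g x" by (intro ennreal_enn2real) (auto intro: le_less_trans)
      ultimately show "ennreal (\<gamma> x) * f x = g x * (f x * indicator G x)"
        by (auto simp: \<gamma>_def indicator_def min_absorb2)
    qed
    also have "\<dots> = (\<integral>\<^sup>+x. f x * indicator G x \<partial>density ?P g)"
    proof (rule nn_integral_density[symmetric, OF g])
      show "(\<lambda>x. f x * indicator G x) \<in> borel_measurable ?P"
        unfolding measurable_cong_sets[OF sets_mixture refl] using G(1) by measurable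
    qed
    also have "\<dots> = ennreal (1 - \<epsilon>) * (\<integral>\<^sup>+x. f x * indicator G x \<partial>N)"
      unfolding dens N1_def using G(1) by (subst nn_integral_scale_measure) auto
    also have "(\<integral>\<^sup>+x. f x * indicator G x \<partial>N) = (\<integral>\<^sup>+x. f x \<partial>N)"
      by (rule nn_integral_cong_AE, use G(2) in eventually_elim) auto
    finally show ?thesis .
  qed
  show ?thesis
  proof (intro bexI[of _ \<gamma>] conjI allI impI ballI)
    show "\<gamma> \<in> borel_measurable N" unfolding \<gamma>_def using G(1) by measurable
    show "0 \<le> \<gamma> x" "\<gamma> x \<le> 1" for x using \<gamma>1[of x] by (auto simp: \<gamma>_def indicator_def)
    show "\<gamma> x = 0" if "x \<notin> G" for x using that by (simp add: \<gamma>_def)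
  qed (rule int)
qed

section \<open>The depth constant\<close>

lemma cdf_quartile_iff:
  assumes "0 \<le> s" shows "cdf std_normal_distribution s = 3 / 4 \<longleftrightarrow> sym_mass s = 1 / 2"
  unfolding cdf_N_eq_sym_mass[OF assms] by (simp add: field_simps)

lemma depth_const_quartile: "0 \<le> depth_const" "sym_mass (sqrt depth_const) = 1 / 2"
proof -
  obtain s where s: "0 \<le> s" "sym_mass s = 1 / 2" using ex_quartile by blast
  have sq: "sqrt (s\<^sup>2) = s" using s(1) by simp
  have "\<exists>!b. b \<ge> 0 \<and> cdf std_normal_distribution (sqrt b) = 3 / 4"
  proof (rule ex1I[of _ "s\<^sup>2"])
    show "s\<^sup>2 \<ge> 0 \<and> cdf std_normal_distribution (sqrt (s\<^sup>2)) = 3 / 4"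
      unfolding sq using cdf_quartile_iff[OF s(1)] s(2) by simp
    fix b assume b: "b \<ge> 0 \<and> cdf std_normal_distribution (sqrt b) = 3 / 4"
    then have "0 \<le> sqrt b" by simp
    then have "sqrt b = s"
      using cdf_quartile_iff[of "sqrt b"] b by (intro quartile_unique[OF _ s(1) _ s(2)]) blast+
    then have "(sqrt b)\<^sup>2 = s\<^sup>2" by (rule arg_cong)
    then show "b = s\<^sup>2" using b by (simp only: real_sqrt_pow2)
  qed
  from theI'[OF this] have D: "0 \<le> depth_const" "cdf std_normal_distribution (sqrt depth_const) = 3 / 4"
    unfolding depth_const_def by blast+
  then have "0 \<le> sqrt depth_const" by simp
  with D show "0 \<le> depth_const" "sym_mass (sqrt depth_const) = 1 / 2"
    using cdf_quartile_iff by blast+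
qed

lemma depth_const_pos: "0 < depth_const"
proof -
  have "0 \<le> sqrt depth_const" using depth_const_quartile(1) by simp
  then have "1 / 5 < sqrt depth_const" using depth_const_quartile(2) by (rule quartile_bounds(1))
  then have "0 < sqrt depth_const" by linarith
  then show ?thesis by simp
qed

section \<open>One window of coordinates\<close>

text \<open>The clean part of the contaminated sample, seen through an orthonormal frame \<open>e\<close> of the span
  of the rows of the factor of \<open>\<Sigma>\<close> that belong to a window of coordinates.\<close>

locale clean_window =
  fixes p :: nat and \<epsilon> :: real and \<Sigma> :: "real mat" and Q :: "real vec measure" and I :: "nat set"
    and A :: "real mat" and m :: nat and e :: "nat \<Rightarrow> nat \<Rightarrow> real" and T R :: "nat \<Rightarrow> nat \<Rightarrow> real"
    and \<gamma> :: "real vec \<Rightarrow> real"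
  assumes \<epsilon>: "0 \<le> \<epsilon>" "\<epsilon> \<le> 1" and Q: "prob_space Q" "sets Q = sets (borel_vec p)" and psd: "psd p \<Sigma>"
    and I: "I \<subseteq> {..<p}"
    and A: "A \<in> carrier_mat p p" "A * transpose_mat A = \<Sigma>"
      "gaussian_vec p \<Sigma> = distr (std_gaussian p) (borel_vec p) (\<lambda>z. A *\<^sub>v vec p z)"
    and orth: "\<And>j l. j < m \<Longrightarrow> l < m \<Longrightarrow> ip p (e j) (e l) = of_bool (j = l)"
    and R: "\<And>i x. i \<in> I \<Longrightarrow> x < p \<Longrightarrow> A $$ (i, x) = (\<Sum>j<m. R i j * e j x)"
    and T: "\<And>j x. j < m \<Longrightarrow> x < p \<Longrightarrow> e j x = (\<Sum>i\<in>I. T j i * A $$ (i, x))"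
    and \<gamma>_meas: "\<gamma> \<in> borel_measurable (borel_vec p)"
    and \<gamma>_bounds: "\<And>x. 0 \<le> \<gamma> x" "\<And>x. \<gamma> x \<le> 1"
    and \<gamma>_support: "\<And>x i. \<gamma> x \<noteq> 0 \<Longrightarrow> i \<in> I \<Longrightarrow> x $ i = (\<Sum>j<m. R i j * (\<Sum>l\<in>I. T j l * x $ l))"
    and \<gamma>_int: "\<And>f. f \<in> borel_measurable (borel_vec p) \<Longrightarrow>
      (\<integral>\<^sup>+x. ennreal (\<gamma> x) * f x \<partial>contaminated p \<epsilon> \<Sigma> Q) = ennreal (1 - \<epsilon>) * (\<integral>\<^sup>+x. f x \<partial>gaussian_vec p \<Sigma>)"
begin

abbreviation "P \<equiv> contaminated p \<epsilon> \<Sigma> Q"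
abbreviation "G \<equiv> gaussian_vec p \<Sigma>"

definition Y :: "nat \<Rightarrow> real vec \<Rightarrow> real" where "Y j x = (\<Sum>i\<in>I. T j i * x $ i)"

lemma sets_G: "sets G = sets (borel_vec p)" by (simp add: A(3))

lemma sets_P: "sets P = sets (borel_vec p)" by (simp add: contaminated_def sets_G)

lemma meas_P_iff: "f \<in> borel_measurable P \<longleftrightarrow> f \<in> borel_measurable (borel_vec p)" for f :: "_ \<Rightarrow> real"
  by (rule arg_cong2[where f="(\<in>)", OF refl measurable_cong_sets[OF sets_P refl]])

lemma prob_space_G: "prob_space G"
  unfolding A(3) by (rule prob_space.prob_space_distr[OF prob_space_std_gaussian meas_linear_image[OF A(1)]])

lemma prob_space_P: "prob_space P"
  unfolding contaminated_def using prob_space_G Q \<epsilon> sets_G by (intro prob_space_mixture) auto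

lemma meas_Y: "Y j \<in> borel_measurable (borel_vec p)"
  unfolding Y_def using I by (intro borel_measurable_sum borel_measurable_times meas_vec_index) auto

lemma meas_ip_Y: "(\<lambda>x. ip m c (\<lambda>j. Y j x)) \<in> borel_measurable (borel_vec p)"
  unfolding ip_def using meas_Y by (intro borel_measurable_sum borel_measurable_times) auto

definition comb :: "(nat \<Rightarrow> real) \<Rightarrow> nat \<Rightarrow> real" where "comb c x = (\<Sum>j<m. c j * e j x)"

lemma sq_norm_comb: "sq_norm p (comb c) = sq_norm m c"
proof -
  have "sq_norm p (comb c) = (\<Sum>j<m. \<Sum>l<m. c j * (c l * ip p (e j) (e l)))"
    unfolding comb_def ip_sum_left ip_sum_right ip_algebra
    by (simp add: ip_sum_right ip_algebra sum_distrib_left)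
  also have "\<dots> = (\<Sum>j<m. c j * c j)"
  proof (intro sum.cong refl)
    fix j assume j: "j \<in> {..<m}"
    have "(\<Sum>l<m. c j * (c l * ip p (e j) (e l))) = (\<Sum>l<m. if l = j then c j * c j else 0)"
      using j orth by (intro sum.cong) auto
    then show "(\<Sum>l<m. c j * (c l * ip p (e j) (e l))) = c j * c j" using j by simp
  qed
  finally show ?thesis by (simp add: ip_def)
qed

lemma ip_Y_linear_image: "ip m c (\<lambda>j. Y j (A *\<^sub>v vec p z)) = ip p (comb c) z"
proof -
  have "Y j (A *\<^sub>v vec p z) = ip p (e j) z" if j: "j < m" for j
  proof -
    have "Y j (A *\<^sub>v vec p z) = (\<Sum>i\<in>I. \<Sum>x<p. T j i * A $$ (i, x) * z x)"
      unfolding Y_def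
    proof (intro sum.cong refl)
      fix i assume "i \<in> I"
      then have "(A *\<^sub>v vec p z) $ i = (\<Sum>x<p. A $$ (i, x) * vec p z $ x)"
        using A(1) I by (intro mult_mat_vec_index) auto
      then show "T j i * (A *\<^sub>v vec p z) $ i = (\<Sum>x<p. T j i * A $$ (i, x) * z x)"
        by (simp add: sum_distrib_left mult.assoc)
    qed
    also have "\<dots> = (\<Sum>x<p. (\<Sum>i\<in>I. T j i * A $$ (i, x)) * z x)"
      by (subst sum.swap) (simp add: sum_distrib_right)
    also have "\<dots> = ip p (e j) z" unfolding ip_def using T[OF j] by (intro sum.cong) auto
    finally show ?thesis .
  qed
  then have "ip m c (\<lambda>j. Y j (A *\<^sub>v vec p z)) = (\<Sum>j<m. c j * ip p (e j) z)"
    by (simp add: ip_def)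
  also have "\<dots> = ip p (comb c) z"
    unfolding comb_def ip_sum_left ip_algebra ..
  finally show ?thesis .
qed

lemma nn_integral_ip_Y:
  assumes f: "f \<in> borel_measurable borel"
  shows "(\<integral>\<^sup>+x. f (ip m c (\<lambda>j. Y j x)) \<partial>G) = (\<integral>\<^sup>+z. f (ip p (comb c) z) \<partial>std_gaussian p)"
  unfolding A(3) using f meas_ip_Y
  by (subst nn_integral_distr[OF meas_linear_image[OF A(1)]]) (auto simp: ip_Y_linear_image)

lemma nn_integral_ip_Y_unit:
  assumes f: "f \<in> borel_measurable borel" and c: "sq_norm m c = 1"
  shows "(\<integral>\<^sup>+x. f (ip m c (\<lambda>j. Y j x)) \<partial>G) = (\<integral>\<^sup>+t. f t \<partial>std_normal_distribution)"
proof -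
  have "(\<integral>\<^sup>+t. f t \<partial>std_normal_distribution) = (\<integral>\<^sup>+t. f t \<partial>distr (std_gaussian p) borel (\<lambda>z. ip p (comb c) z))"
    using c by (subst distr_ip_std_gaussian) (simp_all add: sq_norm_comb)
  also have "\<dots> = (\<integral>\<^sup>+z. f (ip p (comb c) z) \<partial>std_gaussian p)"
    using f by (intro nn_integral_distr meas_ip_std_gaussian) auto
  finally show ?thesis using nn_integral_ip_Y[OF f] by simp
qed

text \<open>Integrals against the weight reduce to the Gaussian law, and a unit combination of the frame
  coordinates is a unit projection of the underlying standard Gaussian vector.\<close>

lemma weighted_prob:
  assumes c: "sq_norm m c = 1" and B: "B \<in> sets borel"
  shows "(\<integral>x. \<gamma> x * indicator B (ip m c (\<lambda>j. Y j x)) \<partial>P) = (1 - \<epsilon>) * N.prob B"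
proof -
  have meas: "(\<lambda>x. indicator B (ip m c (\<lambda>j. Y j x)) :: real) \<in> borel_measurable (borel_vec p)"
    by (rule measurable_compose[OF meas_ip_Y]) (use B in simp)
  have measP: "(\<lambda>x. \<gamma> x * indicator B (ip m c (\<lambda>j. Y j x))) \<in> borel_measurable P"
    unfolding meas_P_iff using \<gamma>_meas meas by (rule borel_measurable_times)
  have "(\<integral>\<^sup>+x. ennreal (\<gamma> x * indicator B (ip m c (\<lambda>j. Y j x))) \<partial>P)
      = (\<integral>\<^sup>+x. ennreal (\<gamma> x) * ennreal (indicator B (ip m c (\<lambda>j. Y j x))) \<partial>P)"
    using \<gamma>_bounds by (intro nn_integral_cong ennreal_mult) auto
  also have "\<dots> = ennreal (1 - \<epsilon>) * (\<integral>\<^sup>+x. ennreal (indicator B (ip m c (\<lambda>j. Y j x))) \<partial>G)"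
    by (intro \<gamma>_int measurable_compose[OF meas]) simp
  also have "(\<integral>\<^sup>+x. ennreal (indicator B (ip m c (\<lambda>j. Y j x))) \<partial>G) = (\<integral>\<^sup>+t. ennreal (indicator B t) \<partial>std_normal_distribution)"
    by (rule nn_integral_ip_Y_unit[OF _ c]) (use B in simp)
  also have "\<dots> = ennreal (N.prob B)" using B by (simp add: ennreal_indicator N.emeasure_eq_measure)
  also have "ennreal (1 - \<epsilon>) * ennreal (N.prob B) = ennreal ((1 - \<epsilon>) * N.prob B)"
    using \<epsilon> by (intro ennreal_mult[symmetric]) auto
  finally have *: "(\<integral>\<^sup>+x. ennreal (\<gamma> x * indicator B (ip m c (\<lambda>j. Y j x))) \<partial>P) = ennreal ((1 - \<epsilon>) * N.prob B)" .
  show ?thesis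
  proof (rule integral_eq_nn_integral[OF measP, THEN trans])
    show "AE x in P. 0 \<le> \<gamma> x * indicator B (ip m c (\<lambda>j. Y j x))" using \<gamma>_bounds by (intro AE_I2) simp
    show "enn2real (\<integral>\<^sup>+x. ennreal (\<gamma> x * indicator B (ip m c (\<lambda>j. Y j x))) \<partial>P) = (1 - \<epsilon>) * N.prob B"
      unfolding * using \<epsilon> by simp
  qed
qed

lemma weight_total: "(\<integral>x. \<gamma> x \<partial>P) = 1 - \<epsilon>"
proof -
  have "(\<integral>\<^sup>+x. ennreal (\<gamma> x) \<partial>P) = (\<integral>\<^sup>+x. ennreal (\<gamma> x) * 1 \<partial>P)" by simp
  also have "\<dots> = ennreal (1 - \<epsilon>) * (\<integral>\<^sup>+x. 1 \<partial>G)" by (rule \<gamma>_int) simp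
  also have "(\<integral>\<^sup>+x. 1 \<partial>G) = 1" using prob_space.emeasure_space_1[OF prob_space_G] by simp
  finally have *: "(\<integral>\<^sup>+x. ennreal (\<gamma> x) \<partial>P) = ennreal (1 - \<epsilon>)" by simp
  show ?thesis
    by (rule integral_eq_nn_integral[THEN trans]) (use \<gamma>_meas \<gamma>_bounds \<epsilon> * in \<open>auto simp: meas_P_iff\<close>)
qed

lemma exp_square_bound:
  assumes h: "sq_norm m h \<le> 1"
  shows "(\<integral>\<^sup>+x. ennreal (\<gamma> x * (exp ((ip m h (\<lambda>j. Y j x))\<^sup>2 / 4) - 1)) \<partial>P) \<le> 1"
proof -
  let ?f = "\<lambda>t::real. ennreal (exp (t\<^sup>2 / 4) - 1)"
  have fm: "?f \<in> borel_measurable borel" by measurable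
  have "(\<integral>\<^sup>+x. ennreal (\<gamma> x * (exp ((ip m h (\<lambda>j. Y j x))\<^sup>2 / 4) - 1)) \<partial>P)
      = (\<integral>\<^sup>+x. ennreal (\<gamma> x) * ?f (ip m h (\<lambda>j. Y j x)) \<partial>P)"
    using \<gamma>_bounds by (intro nn_integral_cong ennreal_mult) auto
  also have "\<dots> = ennreal (1 - \<epsilon>) * (\<integral>\<^sup>+x. ?f (ip m h (\<lambda>j. Y j x)) \<partial>G)"
    by (rule \<gamma>_int) (rule measurable_compose[OF meas_ip_Y fm])
  also have "\<dots> \<le> 1 * 1"
  proof (rule mult_mono)
    show "ennreal (1 - \<epsilon>) \<le> 1" using \<epsilon> by (simp add: ennreal_le_1)
    show "(\<integral>\<^sup>+x. ?f (ip m h (\<lambda>j. Y j x)) \<partial>G) \<le> 1"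
    proof (cases "sq_norm m h = 0")
      case True
      then have "\<forall>j<m. h j = 0" by (simp only: sq_norm_eq_0_iff)
      then have "ip m h (\<lambda>j. Y j x) = 0" for x by (simp add: ip_def)
      then show ?thesis by simp
    next
      case False
      then have pos: "0 < sq_norm m h" by (simp add: less_le)
      define t where "t = 1 / sqrt (sq_norm m h)"
      let ?h = "\<lambda>j. t * h j"
      have t2: "t\<^sup>2 * sq_norm m h = 1" using pos by (simp add: t_def power_divide)
      have unit: "sq_norm m ?h = 1" unfolding sq_norm_scale by (rule t2)
      have t1: "1 \<le> t\<^sup>2" using pos h by (simp add: t_def power_divide)
      have "(\<integral>\<^sup>+x. ?f (ip m h (\<lambda>j. Y j x)) \<partial>G) \<le> (\<integral>\<^sup>+x. ?f (ip m ?h (\<lambda>j. Y j x)) \<partial>G)"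
      proof (intro nn_integral_mono ennreal_leI)
        fix x
        have "(ip m ?h (\<lambda>j. Y j x))\<^sup>2 = t\<^sup>2 * (ip m h (\<lambda>j. Y j x))\<^sup>2"
          by (simp only: ip_algebra power_mult_distrib)
        moreover have "1 * (ip m h (\<lambda>j. Y j x))\<^sup>2 \<le> t\<^sup>2 * (ip m h (\<lambda>j. Y j x))\<^sup>2"
          using t1 by (intro mult_right_mono) auto
        ultimately show "exp ((ip m h (\<lambda>j. Y j x))\<^sup>2 / 4) - 1 \<le> exp ((ip m ?h (\<lambda>j. Y j x))\<^sup>2 / 4) - 1"
          by simp
      qed
      also have "\<dots> = (\<integral>\<^sup>+t. ?f t \<partial>std_normal_distribution)" by (rule nn_integral_ip_Y_unit[OF fm unit])
      also have "\<dots> \<le> 1" by (rule N_exp_square)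
      finally show ?thesis .
    qed
  qed auto
  finally show ?thesis by simp
qed

lemma weighted_projections: "weighted_projections P \<gamma> m Y"
proof -
  interpret prob_space P by (rule prob_space_P)
  show ?thesis
  proof
    show "\<gamma> \<in> borel_measurable P" using \<gamma>_meas by (simp only: meas_P_iff)
    show "0 \<le> \<gamma> x" "\<gamma> x \<le> 1" for x by (rule \<gamma>_bounds)+
    show "Y j \<in> borel_measurable P" for j using meas_Y by (simp only: meas_P_iff)
    show "(\<integral>\<^sup>+x. ennreal (\<gamma> x * (exp ((ip m h (\<lambda>j. Y j x))\<^sup>2 / 4) - 1)) \<partial>P) \<le> 1" if "sq_norm m h \<le> 1" for h
      using that by (rule exp_square_bound)
    show "(\<integral>x. \<gamma> x * of_bool (\<bar>\<bar>ip m c (\<lambda>j. Y j x)\<bar> - s\<bar> \<le> t) \<partial>P) \<le> 2 * t"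
      if c: "sq_norm m c = 1" and t: "0 \<le> t" for c s t
    proof -
      let ?B = "{y. \<bar>\<bar>y\<bar> - s\<bar> \<le> t}"
      have "(\<integral>x. \<gamma> x * of_bool (\<bar>\<bar>ip m c (\<lambda>j. Y j x)\<bar> - s\<bar> \<le> t) \<partial>P) = (\<integral>x. \<gamma> x * indicator ?B (ip m c (\<lambda>j. Y j x)) \<partial>P)"
        by (intro Bochner_Integration.integral_cong refl) (simp add: indicator_def)
      also have "\<dots> = (1 - \<epsilon>) * N.prob ?B" by (rule weighted_prob[OF c]) measurable
      also have "\<dots> \<le> 1 * N.prob ?B" using \<epsilon> by (intro mult_right_mono) auto
      also have "\<dots> \<le> 2 * t" using N_shell_le[OF t] by simp
      finally show ?thesis .
    qed
  qed
qed

sublocale W: weighted_projections P \<gamma> m Y by (rule weighted_projections)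

lemma slab_mean:
  assumes c: "sq_norm m c = 1"
  shows "(\<integral>x. W.slab s c x \<partial>P) = (1 - \<epsilon>) * sym_mass s"
proof -
  have "(\<integral>x. W.slab s c x \<partial>P) = (\<integral>x. \<gamma> x * indicator {y. \<bar>y\<bar> \<le> s} (ip m c (\<lambda>j. Y j x)) \<partial>P)"
    by (intro Bochner_Integration.integral_cong refl) (simp add: indicator_def W.slab_def W.proj_def)
  also have "\<dots> = (1 - \<epsilon>) * sym_mass s" unfolding sym_mass_def by (rule weighted_prob[OF c]) measurable
  finally show ?thesis .
qed

definition coord :: "real vec \<Rightarrow> nat \<Rightarrow> real" where "coord u j = (\<Sum>i\<in>I. u $ i * R i j)"

text \<open>Where the weight is positive, every direction supported in the window is a linear function of
  the frame coordinates.  Its coefficient vector has squared norm \<open>u\<^sup>T \<Sigma> u\<close>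
  (\<open>variance_eq_coord\<close>), so that after division by the standard deviation it lies on the sphere to which
  the chaining bound applies.\<close>

lemma projection_on_support:
  assumes u: "u \<in> carrier_vec p" "\<And>i. i < p \<Longrightarrow> i \<notin> I \<Longrightarrow> u $ i = 0" and x: "x \<in> carrier_vec p" "\<gamma> x \<noteq> 0"
  shows "u \<bullet> x = ip m (coord u) (\<lambda>j. Y j x)"
proof -
  have "u \<bullet> x = (\<Sum>i<p. u $ i * x $ i)" using x by (simp add: scalar_prod_eq_ip ip_def)
  also have "\<dots> = (\<Sum>i\<in>I. u $ i * x $ i)" using I u by (intro sum.mono_neutral_right) auto
  also have "\<dots> = (\<Sum>i\<in>I. u $ i * (\<Sum>j<m. R i j * Y j x))"
    using \<gamma>_support[OF x(2)] unfolding Y_def by (intro sum.cong refl) metis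
  also have "\<dots> = (\<Sum>i\<in>I. \<Sum>j<m. u $ i * R i j * Y j x)" by (simp add: sum_distrib_left mult.assoc)
  also have "\<dots> = ip m (coord u) (\<lambda>j. Y j x)"
    unfolding ip_def coord_def sum_distrib_right by (rule sum.swap)
  finally show ?thesis .
qed

lemma variance_eq_coord:
  assumes u: "u \<in> carrier_vec p" "\<And>i. i < p \<Longrightarrow> i \<notin> I \<Longrightarrow> u $ i = 0"
  shows "u \<bullet> (\<Sigma> *\<^sub>v u) = sq_norm m (coord u)"
proof -
  have "\<Sigma> $$ (i, j) = ip p (\<lambda>x. A $$ (i, x)) (\<lambda>x. A $$ (j, x))" if "i < p" "j < p" for i j
    using A(1) that unfolding A(2)[symmetric] by (simp add: scalar_prod_def ip_def atLeast0LessThan)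
  then have "qform p (\<lambda>i j. \<Sigma> $$ (i, j)) (vec_index u) = sq_norm p (\<lambda>x. \<Sum>i<p. u $ i * A $$ (i, x))"
    by (rule qform_Gram)
  also have "\<dots> = sq_norm p (comb (coord u))"
  proof (intro ip_cong)
    fix x assume x: "x < p"
    have "(\<Sum>i<p. u $ i * A $$ (i, x)) = (\<Sum>i\<in>I. u $ i * A $$ (i, x))"
      using I u by (intro sum.mono_neutral_right) auto
    also have "\<dots> = (\<Sum>i\<in>I. \<Sum>j<m. u $ i * R i j * e j x)"
      using R x by (intro sum.cong refl) (simp add: sum_distrib_left mult.assoc)
    also have "\<dots> = comb (coord u) x" unfolding comb_def coord_def sum_distrib_right by (rule sum.swap)
    finally show "(\<Sum>i<p. u $ i * A $$ (i, x)) = comb (coord u) x" .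
    then show "(\<Sum>i<p. u $ i * A $$ (i, x)) = comb (coord u) x" .
  qed
  finally show ?thesis using u(1) psd_carrier[OF psd] by (simp add: quad_form_eq_qform sq_norm_comb)
qed

end

text \<open>The frame comes from Gram--Schmidt applied to the rows of the factor \<open>A\<close> that belong to the window,
  the weight from \<open>mixture_weight\<close> with the set \<open>H\<close> of vectors whose window coordinates are
  reproduced by the frame; \<open>H\<close> contains the range of \<open>A\<close>.\<close>

lemma clean_window_exists:
  assumes \<epsilon>: "0 \<le> \<epsilon>" "\<epsilon> \<le> 1" and Q: "prob_space Q" "sets Q = sets (borel_vec p)" and psd: "psd p \<Sigma>"
    and I: "I \<subseteq> {..<p}"
  shows "\<exists>A m e T R \<gamma>. m \<le> card I \<and> clean_window p \<epsilon> \<Sigma> Q I A m e T R \<gamma>"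
proof -
  obtain A where A: "A \<in> carrier_mat p p" "A * transpose_mat A = \<Sigma>"
    "gaussian_vec p \<Sigma> = distr (std_gaussian p) (borel_vec p) (\<lambda>z. A *\<^sub>v vec p z)"
    using gaussian_vec_factor[OF psd] by metis
  have fin: "finite I" using I finite_subset by blast
  from Gram_Schmidt_family[OF fin, of p "\<lambda>i x. A $$ (i, x)"]
  obtain m e T R where m: "m \<le> card I"
    and orth: "\<forall>j<m. \<forall>l<m. ip p (e j) (e l) = of_bool (j = l)"
    and R: "\<forall>i\<in>I. \<forall>x<p. A $$ (i, x) = (\<Sum>j<m. R i j * e j x)"
    and T: "\<forall>j<m. \<forall>x<p. e j x = (\<Sum>i\<in>I. T j i * A $$ (i, x))"
    by (elim exE conjE)
  let ?N = "gaussian_vec p \<Sigma>"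
  define H where "H = {x \<in> space ?N. \<forall>i\<in>I. x $ i = (\<Sum>j<m. R i j * (\<Sum>l\<in>I. T j l * x $ l))}"
  have sN: "sets ?N = sets (borel_vec p)" by (simp add: A(3))
  have idx: "(\<lambda>x. x $ i) \<in> borel_measurable ?N" if "i \<in> I" for i
    unfolding measurable_cong_sets[OF sN refl] using that I by (intro meas_vec_index) auto
  have H: "H \<in> sets ?N"
    unfolding H_def using idx fin
    by (intro sets.sets_Collect_finite_All borel_measurable_eq borel_measurable_sum borel_measurable_times) auto
  have mem: "A *\<^sub>v vec p z \<in> H" for z
  proof -
    have row: "(A *\<^sub>v vec p z) $ i = ip p (\<lambda>x. A $$ (i, x)) z" if "i \<in> I" for i
      using A(1) I that by (subst mult_mat_vec_index[of _ p]) (auto simp: ip_def)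
    have eY: "(\<Sum>l\<in>I. T j l * (A *\<^sub>v vec p z) $ l) = ip p (e j) z" if j: "j < m" for j
    proof -
      have "(\<Sum>l\<in>I. T j l * (A *\<^sub>v vec p z) $ l) = ip p (\<lambda>x. \<Sum>l\<in>I. T j l * A $$ (l, x)) z"
        unfolding ip_sum_left ip_algebra using row by (intro sum.cong) auto
      also have "\<dots> = ip p (e j) z" using T j by (intro ip_cong) auto
      finally show ?thesis .
    qed
    have "(A *\<^sub>v vec p z) $ i = (\<Sum>j<m. R i j * (\<Sum>l\<in>I. T j l * (A *\<^sub>v vec p z) $ l))" if i: "i \<in> I" for i
    proof -
      have "(A *\<^sub>v vec p z) $ i = ip p (\<lambda>x. \<Sum>j<m. R i j * e j x) z"
        unfolding row[OF i] using R i by (intro ip_cong) auto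
      also have "\<dots> = (\<Sum>j<m. R i j * ip p (e j) z)" unfolding ip_sum_left ip_algebra ..
      also have "\<dots> = (\<Sum>j<m. R i j * (\<Sum>l\<in>I. T j l * (A *\<^sub>v vec p z) $ l))"
        using eY by (intro sum.cong) auto
      finally show ?thesis .
    qed
    moreover have "A *\<^sub>v vec p z \<in> space ?N" using A by auto
    ultimately show ?thesis unfolding H_def by blast
  qed
  have AE: "AE x in ?N. x \<in> H"
  proof -
    have "{x \<in> space (borel_vec p). x \<in> H} = H" unfolding H_def by (auto simp: A(3))
    then have "{x \<in> space (borel_vec p). x \<in> H} \<in> sets (borel_vec p)" using H sN by simp
    then show ?thesis
      unfolding A(3) by (subst AE_distr_iff[OF meas_linear_image[OF A(1)]]) (auto simp: mem)
  qed
  have pN: "prob_space ?N"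
    unfolding A(3) by (rule prob_space.prob_space_distr[OF prob_space_std_gaussian meas_linear_image[OF A(1)]])
  from mixture_weight[OF pN Q(1) _ \<epsilon> H AE] Q(2) sN
  obtain \<gamma> where \<gamma>: "\<gamma> \<in> borel_measurable ?N" "\<forall>x. 0 \<le> \<gamma> x \<and> \<gamma> x \<le> 1" "\<forall>x. x \<notin> H \<longrightarrow> \<gamma> x = 0"
    "\<forall>f\<in>borel_measurable ?N. (\<integral>\<^sup>+x. ennreal (\<gamma> x) * f x \<partial>mixture \<epsilon> ?N Q) = ennreal (1 - \<epsilon>) * (\<integral>\<^sup>+x. f x \<partial>?N)"
    by auto
  have "clean_window p \<epsilon> \<Sigma> Q I A m e T R \<gamma>"
  proof (rule clean_window.intro)
    show "ip p (e j) (e l) = of_bool (j = l)" if "j < m" "l < m" for j l using orth that by blast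
    show "A $$ (i, x) = (\<Sum>j<m. R i j * e j x)" if "i \<in> I" "x < p" for i x using R that by blast
    show "e j x = (\<Sum>i\<in>I. T j i * A $$ (i, x))" if "j < m" "x < p" for j x using T that by blast
    show "\<gamma> \<in> borel_measurable (borel_vec p)" using \<gamma>(1) unfolding measurable_cong_sets[OF sN refl] .
    show "0 \<le> \<gamma> x" "\<gamma> x \<le> 1" for x using \<gamma>(2) by blast+
    show "x $ i = (\<Sum>j<m. R i j * (\<Sum>l\<in>I. T j l * x $ l))" if "\<gamma> x \<noteq> 0" "i \<in> I" for x i
    proof -
      have "x \<in> H" using \<gamma>(3) that(1) by blast
      then show ?thesis using that(2) unfolding H_def by blast
    qed
    show "(\<integral>\<^sup>+x. ennreal (\<gamma> x) * f x \<partial>contaminated p \<epsilon> \<Sigma> Q) = ennreal (1 - \<epsilon>) * (\<integral>\<^sup>+x. f x \<partial>?N)"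
      if "f \<in> borel_measurable (borel_vec p)" for f
    proof -
      have "f \<in> borel_measurable ?N" using that unfolding measurable_cong_sets[OF sN refl] .
      with \<gamma>(4) show ?thesis unfolding contaminated_def by blast
    qed
  qed (fact \<epsilon> Q psd I A)+
  with m show ?thesis by blast
qed

text \<open>The outcome of the probabilistic part at one direction: the level \<open>(1 - \<epsilon>) / 2 - 2 r\<close> is reached
  by the scaled truth, and only by matrices whose quadratic form is close to the true one.\<close>

definition depth_controlled ::
    "nat \<Rightarrow> nat \<Rightarrow> real \<Rightarrow> real \<Rightarrow> real mat \<Rightarrow> (nat \<Rightarrow> real vec) \<Rightarrow> real vec \<Rightarrow> bool" where
  "depth_controlled p n \<epsilon> r \<Sigma> X u \<longleftrightarrow>
     real n * ((1 - \<epsilon>) / 2 - 2 * r) \<le> count_below n (depth_const \<cdot>\<^sub>m \<Sigma>) X u \<and>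
     real n * ((1 - \<epsilon>) / 2 - 2 * r) \<le> count_above n (depth_const \<cdot>\<^sub>m \<Sigma>) X u \<and>
     (\<forall>\<Gamma>. psd p \<Gamma> \<longrightarrow>
        real n * ((1 - \<epsilon>) / 2 - 2 * r) \<le> count_below n \<Gamma> X u \<longrightarrow>
        real n * ((1 - \<epsilon>) / 2 - 2 * r) \<le> count_above n \<Gamma> X u \<longrightarrow>
        \<bar>u \<bullet> (\<Gamma> *\<^sub>v u) / depth_const - u \<bullet> (\<Sigma> *\<^sub>v u)\<bar>
          \<le> 2000 / std_normal_density 4 * (\<epsilon> + r) * (u \<bullet> (\<Sigma> *\<^sub>v u)))"

lemma (in prob_space) prob_Int_ge:
  assumes "A \<in> events" "B \<in> events" "1 - a \<le> prob A" "1 - b \<le> prob B"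
  shows "1 - (a + b) \<le> prob (A \<inter> B)"
proof -
  have "prob (A \<union> B) + prob (A \<inter> B) = prob A + prob B"
    using finite_measure_Union'[of A "B"] measure_Un3[of A M B] assms by (simp add: fmeasurable_eq_sets)
  then show ?thesis using prob_le_1[of "A \<union> B"] assms by linarith
qed

lemma (in prob_space) prob_finite_INT_ge:
  assumes "finite F" "F \<noteq> {}" "\<And>i. i \<in> F \<Longrightarrow> E i \<in> events" "\<And>i. i \<in> F \<Longrightarrow> 1 - a \<le> prob (E i)"
  shows "1 - real (card F) * a \<le> prob (\<Inter>i\<in>F. E i)"
  using assms
proof (induction F rule: finite_ne_induct)
  case (singleton i) then show ?case by simp
next
  case (insert i F)
  have "1 - (a + real (card F) * a) \<le> prob (E i \<inter> (\<Inter>i\<in>F. E i))"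
    using insert by (intro prob_Int_ge sets.finite_INT) auto
  then show ?case using insert.hyps by (simp add: algebra_simps)
qed

context clean_window
begin

text \<open>The chaining bound is applied at three thresholds and Bernstein's inequality to the sum of the
  weights; the failure probabilities add up to \<open>(3 \<cdot> 8 + 2) exp (- D)\<close>.\<close>

lemma directional_control:
  fixes n :: nat and D r :: real
  assumes n: "0 < n" and D: "1 \<le> D" "real m \<le> D" "D \<le> real n" and \<epsilon>5: "\<epsilon> < 1/5"
    and r: "r = 300 * sqrt (D / real n)" "r \<le> 1 / 200"
  shows "\<exists>E\<in>sets (sample n P). 1 - 26 * exp (- D) \<le> measure (sample n P) E \<and>
     (\<forall>X\<in>E. \<forall>u\<in>V_dirs p I. depth_controlled p n \<epsilon> r \<Sigma> X u)"
proof -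
  let ?M = "sample n P"
  interpret S: prob_space ?M by (rule prob_space_sample[OF prob_space_P])
  define z where "z = sqrt depth_const"
  have z: "0 \<le> z" "sym_mass z = 1 / 2" using depth_const_quartile by (auto simp: z_def)
  have z2: "z\<^sup>2 = depth_const" using depth_const_pos by (simp add: z_def)
  have r0: "0 < r" using D n by (simp add: r)
  have nr: "real n * r = 300 * sqrt (real n * D)"
  proof -
    have "real n * sqrt (D / real n) = sqrt ((real n)\<^sup>2 * (D / real n))" by (subst real_sqrt_mult) simp
    also have "(real n)\<^sup>2 * (D / real n) = real n * D" using n by (simp add: power2_eq_square)
    finally show ?thesis by (simp add: r)
  qed
  from thresholds_exist[OF \<epsilon>(1) \<epsilon>5 r0 r(2) z] obtain a b where
    a: "0 \<le> a" "z - 2 * (\<epsilon> + 5 * r) / std_normal_density 4 \<le> a" "\<epsilon> + 5 * r < (1 - \<epsilon>) * (1/2 - sym_mass a)" and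
    b: "0 \<le> b" "b \<le> 4" "b \<le> z + 2 * (\<epsilon> + 5 * r) / std_normal_density 4" "\<epsilon> + 5 * r < (1 - \<epsilon>) * (sym_mass b - 1/2)"
    by (elim exE conjE)
  define slab_event where "slab_event s E \<longleftrightarrow> E \<in> sets ?M \<and> 1 - 8 * exp (- D) \<le> measure ?M E \<and>
     (\<forall>X\<in>E. \<forall>c. sq_norm m c = 1 \<longrightarrow> \<bar>(\<Sum>i<n. W.slab s c (X i)) - real n * ((1 - \<epsilon>) * sym_mass s)\<bar> \<le> real n * r)" for s E
  have "\<exists>E. slab_event s E" if "0 \<le> s" for s
    using W.slab_deviation[OF D that] unfolding slab_event_def nr by (auto simp: slab_mean)
  with z a b obtain Ez Ea Eb where E: "slab_event z Ez" "slab_event a Ea" "slab_event b Eb" by metis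
  define Ew where "Ew = {X \<in> space ?M. \<not> 2 * sqrt (real n * 1 * D) < \<bar>(\<Sum>i<n. \<gamma> (X i)) - real n * (\<integral>x. \<gamma> x \<partial>P)\<bar>}"
  have meas_\<gamma>: "\<gamma> \<in> borel_measurable P" using \<gamma>_meas by (simp only: meas_P_iff)
  have Ew_meas: "Ew \<in> sets ?M" unfolding Ew_def using meas_\<gamma> by measurable
  have "1 - 2 * exp (- D) \<le> measure ?M Ew"
  proof -
    have "(\<integral>x. (\<gamma> x)\<^sup>2 \<partial>P) \<le> (\<integral>x. 1 \<partial>P)"
      using \<gamma>_bounds meas_\<gamma> by (intro integral_mono W.integrable_bounded) (auto simp: power_le_one)
    then have v: "(\<integral>x. (\<gamma> x)\<^sup>2 \<partial>P) \<le> 1" using prob_space.prob_space[OF prob_space_P] by simp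
    let ?Bad = "{X \<in> space ?M. 2 * sqrt (real n * 1 * D) < \<bar>(\<Sum>i<n. \<gamma> (X i)) - real n * (\<integral>x. \<gamma> x \<partial>P)\<bar>}"
    have Bad: "measure ?M ?Bad \<le> 2 * exp (- D)"
      using \<gamma>_bounds D by (intro Bernstein_sample prob_space_P meas_\<gamma> v) auto
    have "Ew = space ?M - ?Bad" unfolding Ew_def by auto
    moreover have "?Bad \<in> sets ?M" using meas_\<gamma> by measurable
    ultimately have "measure ?M Ew = 1 - measure ?M ?Bad" using S.prob_compl by simp
    then show ?thesis using Bad by linarith
  qed
  then have "1 - ((8 * exp (- D) + 8 * exp (- D)) + (8 * exp (- D) + 2 * exp (- D))) \<le> measure ?M ((Ez \<inter> Ea) \<inter> (Eb \<inter> Ew))"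
    using E Ew_meas unfolding slab_event_def by (intro S.prob_Int_ge sets.Int) auto
  then have prob: "1 - 26 * exp (- D) \<le> measure ?M ((Ez \<inter> Ea) \<inter> (Eb \<inter> Ew))" by simp
  have meas: "(Ez \<inter> Ea) \<inter> (Eb \<inter> Ew) \<in> sets ?M" using E Ew_meas unfolding slab_event_def by auto
  have "depth_controlled p n \<epsilon> r \<Sigma> X u" if X: "X \<in> (Ez \<inter> Ea) \<inter> (Eb \<inter> Ew)" and u: "u \<in> V_dirs p I" for X u
  proof -
    have uc: "u \<in> carrier_vec p" and uI: "\<And>i. i < p \<Longrightarrow> i \<notin> I \<Longrightarrow> u $ i = 0"
      using u by (auto simp: V_dirs_def unit_sphere_def)
    have XM: "X \<in> space ?M" using X Ew_def by auto
    have Xc: "X i \<in> carrier_vec p" if "i < n" for i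
      using XM that sets_eq_imp_space_eq[OF sets_P] by (auto simp: space_PiM)
    define \<sigma> where "\<sigma> = sqrt (sq_norm m (coord u))"
    have \<sigma>0: "0 \<le> \<sigma>" by (simp add: \<sigma>_def)
    have \<sigma>2: "u \<bullet> (\<Sigma> *\<^sub>v u) = \<sigma>\<^sup>2" using variance_eq_coord[OF uc uI] by (simp add: \<sigma>_def)
    interpret dir: weighted_direction n "\<lambda>i. \<gamma> (X i)" "\<lambda>i. u \<bullet> X i" \<sigma> \<epsilon> r z a b
    proof
      have "\<bar>(\<Sum>i<n. \<gamma> (X i)) - real n * (1 - \<epsilon>)\<bar> \<le> 2 * sqrt (real n * 1 * D)"
        using X unfolding Ew_def weight_total by auto
      also have "\<dots> \<le> real n * r" using D by (simp add: nr)
      finally show "\<bar>(\<Sum>i<n. \<gamma> (X i)) - real n * (1 - \<epsilon>)\<bar> \<le> real n * r" .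
      show "u \<bullet> X i = 0" if "i < n" "\<sigma> = 0" "\<gamma> (X i) \<noteq> 0" for i
      proof -
        have "\<forall>j<m. coord u j = 0" using that(2) by (simp add: \<sigma>_def sq_norm_eq_0_iff)
        then show ?thesis using projection_on_support[OF uc uI Xc[OF that(1)] that(3)] by (simp add: ip_def)
      qed
      show "\<bar>(\<Sum>i<n. \<gamma> (X i) * of_bool (\<bar>u \<bullet> X i\<bar> \<le> s * \<sigma>)) - real n * ((1 - \<epsilon>) * sym_mass s)\<bar> \<le> real n * r"
        if s: "s \<in> {z, a, b}" and pos: "0 < \<sigma>" for s
      proof -
        let ?c = "\<lambda>j. (1 / \<sigma>) * coord u j"
        have unit: "sq_norm m ?c = 1"
          unfolding sq_norm_scale using pos by (simp add: \<sigma>_def power_divide)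
        have "\<gamma> (X i) * of_bool (\<bar>u \<bullet> X i\<bar> \<le> s * \<sigma>) = W.slab s ?c (X i)" if i: "i < n" for i
        proof (cases "\<gamma> (X i) = 0")
          case True then show ?thesis by (simp add: W.slab_def)
        next
          case False
          have "W.proj ?c (X i) = (1 / \<sigma>) * (u \<bullet> X i)"
            unfolding W.proj_def ip_algebra using projection_on_support[OF uc uI Xc[OF i] False] by simp
          then have "(\<bar>W.proj ?c (X i)\<bar> \<le> s) = (\<bar>u \<bullet> X i\<bar> \<le> s * \<sigma>)"
            using pos by (simp add: abs_mult pos_divide_le_eq)
          then show ?thesis by (simp add: W.slab_def)
        qed
        then have eq: "(\<Sum>i<n. \<gamma> (X i) * of_bool (\<bar>u \<bullet> X i\<bar> \<le> s * \<sigma>)) = (\<Sum>i<n. W.slab s ?c (X i))"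
          by (intro sum.cong) auto
        show ?thesis unfolding eq using s E X unit unfolding slab_event_def by blast
      qed
    qed (use n \<gamma>_bounds \<epsilon> \<epsilon>5 r0 r(2) z a b \<sigma>0 in auto)
    have zs: "u \<bullet> ((depth_const \<cdot>\<^sub>m \<Sigma>) *\<^sub>v u) = (z * \<sigma>)\<^sup>2"
    proof -
      have "u \<bullet> ((depth_const \<cdot>\<^sub>m \<Sigma>) *\<^sub>v u) = depth_const * (u \<bullet> (\<Sigma> *\<^sub>v u))"
      proof -
        have "qform p (\<lambda>i j. (depth_const \<cdot>\<^sub>m \<Sigma>) $$ (i, j)) (vec_index u) = depth_const * qform p (\<lambda>i j. \<Sigma> $$ (i, j)) (vec_index u)"
          unfolding qform_def sum_distrib_left using psd_carrier[OF psd] by (intro sum.cong refl) auto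
        then show ?thesis using uc psd_carrier[OF psd] by (simp add: quad_form_eq_qform[of _ p])
      qed
      then show ?thesis by (simp add: \<sigma>2 z2 power_mult_distrib)
    qed
    have close: "\<bar>u \<bullet> (\<Gamma> *\<^sub>v u) / depth_const - u \<bullet> (\<Sigma> *\<^sub>v u)\<bar> \<le> 2000 / std_normal_density 4 * (\<epsilon> + r) * (u \<bullet> (\<Sigma> *\<^sub>v u))"
      if \<Gamma>: "psd p \<Gamma>" and below: "real n * ((1 - \<epsilon>) / 2 - 2 * r) \<le> count_below n \<Gamma> X u"
        and above: "real n * ((1 - \<epsilon>) / 2 - 2 * r) \<le> count_above n \<Gamma> X u" for \<Gamma>
    proof -
      have "0 \<le> u \<bullet> (\<Gamma> *\<^sub>v u)" using \<Gamma> uc by (simp add: psd_def)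
      from dir.deep_value_close[OF this below[unfolded count_below_def] above[unfolded count_above_def]]
      show ?thesis unfolding z2 \<sigma>2 .
    qed
    show ?thesis
      unfolding depth_controlled_def count_below_def[of n "depth_const \<cdot>\<^sub>m \<Sigma>"] count_above_def[of n "depth_const \<cdot>\<^sub>m \<Sigma>"] zs
      using dir.truth_depth close by blast
  qed
  with meas prob show ?thesis by blast
qed

end

section \<open>All windows and the rate\<close>

definition windows :: "nat \<Rightarrow> nat \<Rightarrow> nat set set" where
  "windows p k = (if 2 * k \<le> p then (\<lambda>l. {l..<l + 2 * k}) ` {0..p - 2 * k} else {{..<p}})"

lemma windows_properties:
  assumes "0 < p" "0 < k"
  shows "finite (windows p k)" "windows p k \<noteq> {}" "card (windows p k) \<le> p"
    and "J \<in> windows p k \<Longrightarrow> J \<subseteq> {..<p} \<and> card J \<le> 2 * k"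
proof -
  show "finite (windows p k)" "windows p k \<noteq> {}" by (auto simp: windows_def)
  show "card (windows p k) \<le> p"
  proof (cases "2 * k \<le> p")
    case True
    then have "card (windows p k) \<le> card {0..p - 2 * k}" by (simp add: windows_def card_image_le del: card_atLeastAtMost)
    then show ?thesis using assms True by simp
  qed (use assms in \<open>simp add: windows_def\<close>)
  show "J \<subseteq> {..<p} \<and> card J \<le> 2 * k" if "J \<in> windows p k"
    using that by (auto simp: windows_def split: if_splits)
qed

lemma U_dirs_eq_windows: "U_dirs p k = (\<Union>J\<in>windows p k. V_dirs p J)"
  by (auto simp: U_dirs_def windows_def V_dirs_def)

text \<open>The scaled truth \<open>\<beta> \<Sigma>\<close> competes in the maximisation, so the depth of the maximizer is at least
  that of \<open>\<beta> \<Sigma>\<close>.\<close>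

lemma depth_controlled_op_norm:
  assumes n: "0 < n" and p: "0 < p" and k: "0 < k" and \<Sigma>: "\<Sigma> \<in> F_band_bounded p k M" and \<epsilon>: "0 \<le> \<epsilon>" and r: "0 \<le> r"
    and ctrl: "\<And>u. u \<in> U_dirs p k \<Longrightarrow> depth_controlled p n \<epsilon> r \<Sigma> X u"
    and max: "is_arg_max (\<lambda>\<Gamma>. matrix_depth (U_dirs p k) n \<Gamma> X) (\<lambda>\<Gamma>. \<Gamma> \<in> F_band p k) \<Gamma>"
  shows "0 \<le> op_norm ((1 / depth_const) \<cdot>\<^sub>m \<Gamma> - \<Sigma>)"
    and "op_norm ((1 / depth_const) \<cdot>\<^sub>m \<Gamma> - \<Sigma>) \<le> 3 * (2000 / std_normal_density 4 * (\<epsilon> + r) * M)"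
proof -
  let ?\<kappa> = "(1 - \<epsilon>) / 2 - 2 * r"
  have \<Sigma>_psd: "psd p \<Sigma>" and \<Sigma>_band: "\<And>i j. i < p \<Longrightarrow> j < p \<Longrightarrow> \<bar>int i - int j\<bar> > int k \<Longrightarrow> \<Sigma> $$ (i, j) = 0"
    and \<Sigma>_M: "s_max \<Sigma> \<le> M"
    using \<Sigma> by (auto simp: F_band_bounded_def F_band_def F_bounded_def)
  have \<Gamma>: "\<Gamma> \<in> F_band p k" and opt: "\<And>\<Gamma>'. \<Gamma>' \<in> F_band p k \<Longrightarrow> matrix_depth (U_dirs p k) n \<Gamma>' X \<le> matrix_depth (U_dirs p k) n \<Gamma> X"
    using max by (auto simp: is_arg_max_linorder)
  have \<Gamma>_psd: "psd p \<Gamma>" and \<Gamma>_band: "\<And>i j. i < p \<Longrightarrow> j < p \<Longrightarrow> \<bar>int i - int j\<bar> > int k \<Longrightarrow> \<Gamma> $$ (i, j) = 0"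
    using \<Gamma> by (auto simp: F_band_def)
  note car = psd_carrier[OF \<Sigma>_psd] psd_carrier[OF \<Gamma>_psd]
  have scaled: "qform p (\<lambda>i j. (c \<cdot>\<^sub>m S) $$ (i, j)) v = c * qform p (\<lambda>i j. S $$ (i, j)) v" if "S \<in> carrier_mat p p" for c S v
    unfolding qform_def sum_distrib_left using that by (intro sum.cong refl) auto
  have "depth_const \<cdot>\<^sub>m \<Sigma> \<in> F_band p k"
  proof -
    have "transpose_mat (depth_const \<cdot>\<^sub>m \<Sigma>) = depth_const \<cdot>\<^sub>m \<Sigma>"
      using car(1) psd_sym[OF \<Sigma>_psd] by (intro eq_matI) auto
    moreover have "0 \<le> v \<bullet> ((depth_const \<cdot>\<^sub>m \<Sigma>) *\<^sub>v v)" if "v \<in> carrier_vec p" for v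
      using that car(1) depth_const_pos psd_qform_nonneg[OF \<Sigma>_psd] by (simp add: quad_form_eq_qform[of _ p] scaled)
    ultimately show ?thesis using car(1) \<Sigma>_band by (auto simp: F_band_def psd_def)
  qed
  moreover have "?\<kappa> \<le> matrix_depth (U_dirs p k) n (depth_const \<cdot>\<^sub>m \<Sigma>) X"
    using n U_dirs_nonempty[OF p k] ctrl unfolding depth_controlled_def by (intro matrix_depth_geI) blast+
  ultimately have deep: "?\<kappa> \<le> matrix_depth (U_dirs p k) n \<Gamma> X" using opt order_trans by blast
  let ?B = "(1 / depth_const) \<cdot>\<^sub>m \<Gamma> - \<Sigma>"
  have B: "?B \<in> carrier_mat p p" using car(1) by (rule minus_carrier_mat)
  have Bij: "?B $$ (i, j) = \<Gamma> $$ (i, j) / depth_const - \<Sigma> $$ (i, j)" if "i < p" "j < p" for i j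
    using car that by simp
  have qB: "qform p (\<lambda>i j. ?B $$ (i, j)) v = qform p (\<lambda>i j. \<Gamma> $$ (i, j)) v / depth_const - qform p (\<lambda>i j. \<Sigma> $$ (i, j)) v" for v
  proof -
    have "qform p (\<lambda>i j. ?B $$ (i, j)) v = (\<Sum>i<p. \<Sum>j<p. v i * v j * \<Gamma> $$ (i, j) / depth_const - v i * v j * \<Sigma> $$ (i, j))"
      unfolding qform_def by (intro sum.cong refl) (simp add: Bij right_diff_distrib del: index_minus_mat)
    then show ?thesis by (simp add: qform_def sum_subtractf sum_divide_distrib)
  qed
  have dir: "\<bar>qform p (\<lambda>i j. ?B $$ (i, j)) (vec_index u)\<bar> \<le> 2000 / std_normal_density 4 * (\<epsilon> + r) * M" if u: "u \<in> U_dirs p k" for u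
  proof -
    have us: "u \<in> unit_sphere p" using u by (auto simp: U_dirs_def V_dirs_def split: if_splits)
    then have uc: "u \<in> carrier_vec p" by (simp add: unit_sphere_def)
    have u1: "sq_norm p (vec_index u) = 1" using us uc by (simp add: unit_sphere_def scalar_prod_eq_ip)
    have "\<bar>qform p (\<lambda>i j. ?B $$ (i, j)) (vec_index u)\<bar> = \<bar>u \<bullet> (\<Gamma> *\<^sub>v u) / depth_const - u \<bullet> (\<Sigma> *\<^sub>v u)\<bar>"
      using uc car by (simp add: qB quad_form_eq_qform)
    also have "\<dots> \<le> 2000 / std_normal_density 4 * (\<epsilon> + r) * (u \<bullet> (\<Sigma> *\<^sub>v u))"
      using ctrl[OF u] \<Gamma>_psd matrix_depth_le[OF n u deep] unfolding depth_controlled_def by blast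
    also have "\<dots> \<le> 2000 / std_normal_density 4 * (\<epsilon> + r) * M"
    proof (rule mult_left_mono)
      show "u \<bullet> (\<Sigma> *\<^sub>v u) \<le> M"
        using qform_le_s_max[OF \<Sigma>_psd p \<Sigma>_M, of "vec_index u"] uc car u1 by (simp add: quad_form_eq_qform)
      show "0 \<le> 2000 / std_normal_density 4 * (\<epsilon> + r)" using \<epsilon> r by simp
    qed
    finally show ?thesis .
  qed
  have sym: "?B $$ (i, j) = ?B $$ (j, i)" if "i < p" "j < p" for i j
    using that psd_sym[OF \<Sigma>_psd that] psd_sym[OF \<Gamma>_psd that] by (simp only: Bij)
  have band: "?B $$ (i, j) = 0" if "i < p" "j < p" "\<bar>int i - int j\<bar> > int k" for i j
    using Bij[OF that(1,2)] \<Sigma>_band[OF that] \<Gamma>_band[OF that] by simp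
  show "0 \<le> op_norm ?B" "op_norm ?B \<le> 3 * (2000 / std_normal_density 4 * (\<epsilon> + r) * M)"
    using op_norm_le_U_dirs[OF B p k sym band dir] by auto
qed

lemma simultaneous_control:
  fixes n p k :: nat and \<epsilon> \<delta> r D :: real
  assumes n: "0 < n" and p: "0 < p" and k: "0 < k" and \<epsilon>: "0 \<le> \<epsilon>" "\<epsilon> < 1/5" and \<delta>: "0 < \<delta>" "\<delta> < 1/2"
    and Q: "prob_space Q" "sets Q = sets (borel_vec p)" and psd: "psd p \<Sigma>"
    and D: "D = 2 * real k + ln (real p) + ln (1 / \<delta>) + 3" "D \<le> real n"
    and r: "r = 300 * sqrt (D / real n)" "r \<le> 1 / 200"
  shows "\<exists>E\<in>sets (sample n (contaminated p \<epsilon> \<Sigma> Q)). 1 - 2 * \<delta> \<le> measure (sample n (contaminated p \<epsilon> \<Sigma> Q)) E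
    \<and> (\<forall>X\<in>E. \<forall>u\<in>U_dirs p k. depth_controlled p n \<epsilon> r \<Sigma> X u)"
proof -
  let ?P = "contaminated p \<epsilon> \<Sigma> Q"
  have \<epsilon>1: "\<epsilon> \<le> 1" using \<epsilon> by simp
  note W = windows_properties[OF p k]
  have lnp: "0 \<le> ln (real p)" using p by simp
  have ln\<delta>: "0 \<le> ln (1 / \<delta>)" using \<delta> by simp
  have D1: "1 \<le> D" using D lnp ln\<delta> by simp
  have "\<exists>E. E \<in> sets (sample n ?P) \<and> 1 - 26 * exp (- D) \<le> measure (sample n ?P) E \<and>
      (\<forall>X\<in>E. \<forall>u\<in>V_dirs p J. depth_controlled p n \<epsilon> r \<Sigma> X u)" if J: "J \<in> windows p k" for J
  proof -
    from clean_window_exists[OF \<epsilon>(1) \<epsilon>1 Q psd, of J] W(4)[OF J]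
    obtain A m e T R \<gamma> where m: "m \<le> card J" and cw: "clean_window p \<epsilon> \<Sigma> Q J A m e T R \<gamma>" by blast
    have "real m \<le> D" using m W(4)[OF J] D(1) lnp ln\<delta> by linarith
    from clean_window.directional_control[OF cw n D1 this D(2) \<epsilon>(2) r] show ?thesis by blast
  qed
  then have "\<forall>J\<in>windows p k. \<exists>E. E \<in> sets (sample n ?P) \<and> 1 - 26 * exp (- D) \<le> measure (sample n ?P) E \<and>
      (\<forall>X\<in>E. \<forall>u\<in>V_dirs p J. depth_controlled p n \<epsilon> r \<Sigma> X u)" by blast
  from bchoice[OF this] obtain E where E: "\<And>J. J \<in> windows p k \<Longrightarrow> E J \<in> sets (sample n ?P)"
    "\<And>J. J \<in> windows p k \<Longrightarrow> 1 - 26 * exp (- D) \<le> measure (sample n ?P) (E J)"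
    "\<And>J X u. J \<in> windows p k \<Longrightarrow> X \<in> E J \<Longrightarrow> u \<in> V_dirs p J \<Longrightarrow> depth_controlled p n \<epsilon> r \<Sigma> X u"
    by blast
  have "prob_space (sample n ?P)"
  proof -
    obtain J where J: "J \<in> windows p k" using W(2) by blast
    from clean_window_exists[OF \<epsilon>(1) \<epsilon>1 Q psd, of J] W(4)[OF J]
    obtain A m e T R \<gamma> where cw: "clean_window p \<epsilon> \<Sigma> Q J A m e T R \<gamma>" by blast
    show ?thesis by (rule prob_space_sample[OF clean_window.prob_space_P[OF cw]])
  qed
  then have "1 - real (card (windows p k)) * (26 * exp (- D)) \<le> measure (sample n ?P) (\<Inter>J\<in>windows p k. E J)"
    by (rule prob_space.prob_finite_INT_ge) (use W E in auto)
  moreover have "real (card (windows p k)) * (26 * exp (- D)) \<le> 2 * \<delta>"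
  proof -
    have "exp (- D) = exp (- (2 * real k + 3)) * (1 / real p) * \<delta>"
    proof -
      have "- D = - (2 * real k + 3) + - ln (real p) + ln \<delta>" using \<delta> by (simp add: D(1) ln_div)
      then have "exp (- D) = exp (- (2 * real k + 3)) * exp (- ln (real p)) * exp (ln \<delta>)" by (simp only: exp_add)
      then show ?thesis using p \<delta> by (simp add: exp_minus inverse_eq_divide)
    qed
    \<comment> \<open>The summand \<open>3\<close> of \<open>D\<close> absorbs the factor \<open>26\<close>, since \<open>exp 3 \<ge> 13\<close>.\<close>
    moreover have "exp (- (2 * real k + 3)) \<le> 1 / 13"
    proof -
      have "5/2 \<le> exp (1::real)" using exp_lower_Taylor_quadratic[of 1] by simp
      then have "(5/2)^3 \<le> exp (1::real) ^ 3" by (intro power_mono) auto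
      then have "13 \<le> exp (3::real)" by (simp add: exp_of_nat_mult[symmetric] power_divide)
      also have "\<dots> \<le> exp (2 * real k + 3)" by simp
      finally have "1 / exp (2 * real k + 3) \<le> 1 / 13" by (intro divide_left_mono) auto
      then show ?thesis by (simp only: exp_minus inverse_eq_divide)
    qed
    ultimately have "26 * exp (- D) \<le> 26 * (1 / 13 * (1 / real p) * \<delta>)"
      using \<delta> by (simp only:) (intro mult_left_mono mult_right_mono, auto)
    then have "real p * (26 * exp (- D)) \<le> real p * (26 * (1 / 13 * (1 / real p) * \<delta>))" by (intro mult_left_mono) auto
    also have "\<dots> = 2 * \<delta>" using p by simp
    finally have "real p * (26 * exp (- D)) \<le> 2 * \<delta>" .
    moreover have "real (card (windows p k)) * (26 * exp (- D)) \<le> real p * (26 * exp (- D))"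
      using W(3) by (intro mult_right_mono) auto
    ultimately show ?thesis by linarith
  qed
  ultimately have "1 - 2 * \<delta> \<le> measure (sample n ?P) (\<Inter>J\<in>windows p k. E J)" by linarith
  moreover have "(\<Inter>J\<in>windows p k. E J) \<in> sets (sample n ?P)" using W(1,2) E(1) by (intro sets.finite_INT) auto
  moreover have "depth_controlled p n \<epsilon> r \<Sigma> X u" if "X \<in> (\<Inter>J\<in>windows p k. E J)" "u \<in> U_dirs p k" for X u
    using that E(3) unfolding U_dirs_eq_windows by blast
  ultimately show ?thesis by blast
qed

theorem theorem3p3:
  fixes M :: real
  assumes "M > 0"
  shows "\<exists>C>0. \<exists>C1>0. \<forall>(n::nat)>0. \<forall>(p::nat)>0. \<forall>(k::nat)>0. \<forall>\<epsilon>\<in>{0..<1/5::real}.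
    \<forall>\<Gamma>hat :: (nat \<Rightarrow> real vec) \<Rightarrow> real mat.
      (\<forall>X \<in> space (iid_sample n (borel_vec p)).
         is_arg_max (\<lambda>\<Gamma>. matrix_depth (U_dirs p k) n \<Gamma> X) (\<lambda>\<Gamma>. \<Gamma> \<in> F_band p k) (\<Gamma>hat X)) \<longrightarrow>
    (\<forall>\<delta>\<in>{0<..<1/2::real}.
      C1 * ((real k + ln (real p)) / real n + ln (1 / \<delta>) / real n) < 1 \<longrightarrow>
      (\<forall>Q. prob_space Q \<and> sets Q = sets (borel_vec p) \<longrightarrow>
        (\<forall>\<Sigma> \<in> F_band_bounded p k M. \<Sigma> \<noteq> 0\<^sub>m p p \<longrightarrow>
          with_prob_at_least (iid_sample n (contaminated p \<epsilon> \<Sigma> Q)) (1 - 2 * \<delta>)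
            (\<lambda>X. (op_norm ((1 / depth_const) \<cdot>\<^sub>m \<Gamma>hat X - \<Sigma>))\<^sup>2
                 \<le> C * (max ((real k + ln (real p)) / real n) (\<epsilon>\<^sup>2) + ln (1 / \<delta>) / real n)))))"
proof -
  define K where "K = 3 * (2000 / std_normal_density 4) * M"
  have K: "0 < K" using assms by (simp add: K_def normal_density_pos)
  define C where "C = 2 * K\<^sup>2 * 450001"
  \<comment> \<open>\<open>D \<le> 5 (k + log p + log (1/\<delta>))\<close>, so this \<open>C1\<close> gives \<open>sqrt (D / n) \<le> 1/60000\<close>, that is
    \<open>r \<le> 1/200\<close>.  In \<open>C\<close>, \<open>450000 = 5 \<cdot> 300\<^sup>2\<close> comes from \<open>r\<^sup>2 = 300\<^sup>2 D / n\<close>, and the extra unit pays for \<open>\<epsilon>\<^sup>2\<close>.\<close>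
  define C1 :: real where "C1 = 5 * 60000\<^sup>2"
  have main: "with_prob_at_least (iid_sample n (contaminated p \<epsilon> \<Sigma> Q)) (1 - 2 * \<delta>)
            (\<lambda>X. (op_norm ((1 / depth_const) \<cdot>\<^sub>m \<Gamma>hat X - \<Sigma>))\<^sup>2
                 \<le> C * (max ((real k + ln (real p)) / real n) (\<epsilon>\<^sup>2) + ln (1 / \<delta>) / real n))"
    if n: "0 < n" and p: "0 < p" and k: "0 < k" and \<epsilon>: "\<epsilon> \<in> {0..<1/5}"
      and argmax: "\<forall>X \<in> space (iid_sample n (borel_vec p)).
         is_arg_max (\<lambda>\<Gamma>. matrix_depth (U_dirs p k) n \<Gamma> X) (\<lambda>\<Gamma>. \<Gamma> \<in> F_band p k) (\<Gamma>hat X)"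
      and \<delta>: "\<delta> \<in> {0<..<1/2}" and small: "C1 * ((real k + ln (real p)) / real n + ln (1 / \<delta>) / real n) < 1"
      and Q: "prob_space Q \<and> sets Q = sets (borel_vec p)" and \<Sigma>: "\<Sigma> \<in> F_band_bounded p k M"
    for n p k :: nat and \<epsilon> \<delta> :: real and \<Gamma>hat :: "(nat \<Rightarrow> real vec) \<Rightarrow> real mat" and Q and \<Sigma> :: "real mat"
  proof -
    let ?P = "contaminated p \<epsilon> \<Sigma> Q"
    define \<kappa> where "\<kappa> = (real k + ln (real p)) / real n"
    define lam where "lam = ln (1 / \<delta>) / real n"
    have n0: "0 < real n" using n by simp
    have lnp: "0 \<le> ln (real p)" using p by simp
    have ln\<delta>: "0 \<le> ln (1 / \<delta>)" using \<delta> by simp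
    have \<kappa>0: "0 \<le> \<kappa>" and lam0: "0 \<le> lam" using lnp ln\<delta> by (auto simp: \<kappa>_def lam_def)
    define D where "D = 2 * real k + ln (real p) + ln (1 / \<delta>) + 3"
    define r where "r = 300 * sqrt (D / real n)"
    have Dn: "D / real n \<le> 5 * (\<kappa> + lam)"
    proof -
      have "D \<le> 5 * (real k + ln (real p) + ln (1 / \<delta>))" using k lnp ln\<delta> by (simp add: D_def)
      then have "D / real n \<le> 5 * (real k + ln (real p) + ln (1 / \<delta>)) / real n" using n0 by (intro divide_right_mono) auto
      then show ?thesis by (simp add: \<kappa>_def lam_def add_divide_distrib)
    qed
    have C1_eq: "C1 = 18000000000" by (simp add: C1_def)
    have "C1 * (\<kappa> + lam) < 1" using small unfolding \<kappa>_def lam_def .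
    then have D60': "D / real n \<le> 1 / 3600000000" unfolding C1_eq using Dn by linarith
    then have D60: "D / real n \<le> (1 / 60000)\<^sup>2" by (simp only: power_divide) simp
    have "D / real n \<le> 1" using D60' by linarith
    then have D_le: "D \<le> real n" using n0 by (simp add: pos_divide_le_eq)
    have "sqrt (D / real n) \<le> 1 / 60000" using D60 by (intro real_le_lsqrt) auto
    then have r200: "r \<le> 1 / 200" by (simp add: r_def)
    have D0: "0 \<le> D" using lnp ln\<delta> by (simp add: D_def)
    have r0: "0 \<le> r" using D0 n0 by (simp add: r_def)
    have r2: "r\<^sup>2 \<le> 450000 * (\<kappa> + lam)"
      using Dn D0 n0 by (simp add: r_def power_mult_distrib)
    have psd: "psd p \<Sigma>" using \<Sigma> by (simp add: F_band_bounded_def F_band_def)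
    have \<epsilon>': "0 \<le> \<epsilon>" "\<epsilon> < 1/5" and \<delta>': "0 < \<delta>" "\<delta> < 1/2" using \<epsilon> \<delta> by auto
    obtain E where E: "E \<in> sets (sample n ?P)" "1 - 2 * \<delta> \<le> measure (sample n ?P) E"
      "\<And>X u. X \<in> E \<Longrightarrow> u \<in> U_dirs p k \<Longrightarrow> depth_controlled p n \<epsilon> r \<Sigma> X u"
      using simultaneous_control[OF n p k \<epsilon>' \<delta>' conjunct1[OF Q] conjunct2[OF Q] psd D_def D_le r_def r200] by blast
    have "(op_norm ((1 / depth_const) \<cdot>\<^sub>m \<Gamma>hat X - \<Sigma>))\<^sup>2 \<le> C * (max \<kappa> (\<epsilon>\<^sup>2) + lam)" if X: "X \<in> E" for X
    proof -
      have "X \<in> space (sample n ?P)" using X E(1) sets.sets_into_space by blast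
      moreover have "space (sample n ?P) = space (sample n (borel_vec p))"
        by (simp add: space_PiM contaminated_def gaussian_vec_def)
      ultimately have "is_arg_max (\<lambda>\<Gamma>. matrix_depth (U_dirs p k) n \<Gamma> X) (\<lambda>\<Gamma>. \<Gamma> \<in> F_band p k) (\<Gamma>hat X)"
        using argmax by (simp add: iid_sample_def)
      note op = depth_controlled_op_norm[OF n p k \<Sigma> \<epsilon>'(1) r0 E(3)[OF X] this]
      have "op_norm ((1 / depth_const) \<cdot>\<^sub>m \<Gamma>hat X - \<Sigma>) \<le> K * (\<epsilon> + r)"
        using op(2) by (simp add: K_def algebra_simps)
      then have "(op_norm ((1 / depth_const) \<cdot>\<^sub>m \<Gamma>hat X - \<Sigma>))\<^sup>2 \<le> (K * (\<epsilon> + r))\<^sup>2"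
        using op(1) by (rule power_mono)
      also have "\<dots> = K\<^sup>2 * (\<epsilon> + r)\<^sup>2" by (rule power_mult_distrib)
      also have "\<dots> \<le> K\<^sup>2 * (2 * (\<epsilon>\<^sup>2 + r\<^sup>2))"
      proof (rule mult_left_mono)
        have "0 \<le> (\<epsilon> - r)\<^sup>2" by simp
        then show "(\<epsilon> + r)\<^sup>2 \<le> 2 * (\<epsilon>\<^sup>2 + r\<^sup>2)" by (simp add: power2_eq_square algebra_simps)
      qed simp
      also have "\<dots> \<le> K\<^sup>2 * (2 * (450001 * (max \<kappa> (\<epsilon>\<^sup>2) + lam)))"
        using r2 lam0 by (intro mult_left_mono) auto
      also have "\<dots> = C * (max \<kappa> (\<epsilon>\<^sup>2) + lam)" by (simp add: C_def)
      finally show ?thesis .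
    qed
    then show ?thesis
      unfolding with_prob_at_least_def iid_sample_def \<kappa>_def lam_def using E(1,2) by blast
  qed
  have "0 < C" "0 < C1" using K by (auto simp: C_def C1_def)
  then show ?thesis using main by (intro exI[of _ C] conjI exI[of _ C1] allI impI ballI) simp_all
qed

end
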